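(* Let $(X,\mathscr B,m)$ and $(T,\mathscr A,p)$ be compact Polish probability spaces, where $p$ is the unique stationary probability measure of a transition probability $Q(t,A)$ on $T$. Let $\mathbb P$ be the Markov measure on $\Omega=T^{\mathbb N}$ with initial distribution $p$ and kernel $Q(t,A)$, and let $f:T\times X\to X$ be a fibered $(p,m)$-nonsingular random map with associated skew-product $F$. Let $$\hat P((t,x),B)=\int 1_B(u,f_u(x))\,Q(t,du),\qquad (t,x)\in T\times X,\ B\in\mathscr A\otimes\mathscr B.$$ If $\hat P^{n_0}((t,x),B)$ is strong Feller for some $n_0\in\mathbb N$, then (a) $F$ satisfies (FPM) with respect to $\mathbb P\times m$; and (b) the operator $\hat P:L^\infty(p\times m)\to L^\infty(p\times m)$, $\hat P\varphi(t,x)=\int\varphi(\hat u)\,\hat P((t,x),d\hat u)$, is eventually compact; namely, $\hat P^{2n_0}$ is a compact operator.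
   Context: A transition probability on $(T,\mathscr A)$ is a function $Q:T\times\mathscr A\to[0,1]$ such that $Q(t,\cdot)$ is a probability measure for every $t$ and $Q(\cdot,A)$ is measurable for every $A$. A probability $p$ is $Q$-stationary if $p=\int Q(t,\cdot)\,dp(t)$. The Markov measure $\mathbb P$ with transition probability $Q$ and initial distribution $p$ is the unique shift-invariant probability on $\Omega=T^{\mathbb N}$ with $\mathbb P(A_0\times\dots\times A_{m-1}\times\Omega)=\int_{A_0}\cdots\int_{A_{m-1}}Q(t_{m-2},dt_{m-1})\cdots Q(t_0,dt_1)\,dp(t_0)$. A random map is a measurable map $f:T\times X\to X$; $f_t=f(t,\cdot)$. Its skew-product is $F(\omega,x)=(\sigma(\omega),f_{\omega_0}(x))$ on $\Omega\times X$, with $\sigma$ the shift. $f$ is fibered $(p,m)$-nonsingular if for $p$-a.e. $t\in T$ the map $f_t$ is $m$-nonsingular, i.e. $f_t$-preimages of $m$-null sets are $m$-null. $\hat P^{n}$ denotes the $n$-step transition probability of $\hat P$. A transition probability $K(x,A)$ is strong Feller if $x\mapsto K(x,\cdot)$ is continuous for setwise convergence of probabilities, i.e. $x\mapsto K(x,A)$ is continuous for every measurable $A$. A linear operator $P$ is eventually compact if $P^n$ is compact for some $n\in\mathbb N$. $\mathbb P$-Markovian measure: an $F$-invariant probability measure $\bar\mu$ on $\Omega\times X$ whose first marginal is $\mathbb P$ and which admits a disintegration $d\bar\mu=\bar\mu_{\omega_0}\,d\mathbb P(\omega)$ (fiber measures depending only on $\omega_0$). (FPM) for $F$ with respect to $\bar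 m=\mathbb P\times m$: there are finitely many ergodic $F$-invariant probability measures $\bar\mu_1,\dots,\bar\mu_r$ on $\Omega\times X$ such that 1) each $\bar\mu_i$ is $\mathbb P$-Markovian; 2) $\bar\mu_i\ll\bar m$ for each $i$; 3) for every bounded measurable $\varphi:\Omega\times X\to\mathbb R$, $\bar m(B(\bar\mu_1,\varphi)\cup\dots\cup B(\bar\mu_r,\varphi))=1$, where $B(\bar\mu_i,\varphi)=\{(\omega,x):\lim_{n\to\infty}\frac1n\sum_{j=0}^{n-1}\varphi(F^j(\omega,x))=\int\varphi\,d\bar\mu_i\}$. *)

theory Defs
  imports "HOL-Probability.Probability"
begin

section \<open>Transition probabilities and Markov measures\<close>

text \<open>A transition probability on a topological space \<^term>\<open>T\<close> with its Borel sets is a map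
  \<^prop>\<open>Q \<in> borel \<rightarrow>\<^sub>M prob_algebra borel\<close>.\<close>

definition stationary :: "('t::topological_space \<Rightarrow> 't measure) \<Rightarrow> 't measure \<Rightarrow> bool" where
  "stationary Q p \<longleftrightarrow> prob_space p \<and> sets p = sets borel \<and> p = p \<bind> Q"

definition shift :: "(nat \<Rightarrow> 't) \<Rightarrow> nat \<Rightarrow> 't" where
  "shift \<omega> = (\<lambda>n. \<omega> (Suc n))"

definition invariant_measure :: "('a \<Rightarrow> 'a) \<Rightarrow> 'a measure \<Rightarrow> bool" where
  "invariant_measure F M \<longleftrightarrow> F \<in> M \<rightarrow>\<^sub>M M \<and> distr M M F = M"

definition ergodic_measure :: "('a \<Rightarrow> 'a) \<Rightarrow> 'a measure \<Rightarrow> bool" where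
  "ergodic_measure F M \<longleftrightarrow> prob_space M \<and> invariant_measure F M \<and>
     (\<forall>A\<in>sets M. F -` A \<inter> space M = A \<longrightarrow> emeasure M A = 0 \<or> emeasure M A = 1)"

text \<open>For \<^term>\<open>p\<close> in place of \<^term>\<open>M\<close> and a list of sets \<open>A\<^sub>0, \<dots>, A\<^sub>k\<close> this is the iterated
  integral \<open>\<integral>\<^bsub>A\<^sub>0\<^esub> \<integral>\<^bsub>A\<^sub>1\<^esub> \<dots> \<integral>\<^bsub>A\<^sub>k\<^esub> Q(t\<^bsub>k-1\<^esub>, dt\<^sub>k) \<dots> Q(t\<^sub>0, dt\<^sub>1) dp(t\<^sub>0)\<close>.\<close>

primrec cylinder_integral :: "('t \<Rightarrow> 't measure) \<Rightarrow> 't set list \<Rightarrow> 't measure \<Rightarrow> ennreal" where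
  "cylinder_integral Q [] M = 1"
| "cylinder_integral Q (A # As) M = (\<integral>\<^sup>+t\<in>A. cylinder_integral Q As (Q t) \<partial>M)"

definition markov_measure ::
    "('t::topological_space \<Rightarrow> 't measure) \<Rightarrow> 't measure \<Rightarrow> (nat \<Rightarrow> 't) measure \<Rightarrow> bool" where
  "markov_measure Q p \<P> \<longleftrightarrow>
     prob_space \<P> \<and> sets \<P> = sets (Pi\<^sub>M UNIV (\<lambda>_::nat. borel :: 't measure)) \<and>
     invariant_measure shift \<P> \<and>
     (\<forall>As. set As \<subseteq> sets borel \<longrightarrow>
        emeasure \<P> {\<omega>. \<forall>i<length As. \<omega> i \<in> As ! i} = cylinder_integral Q As p)"

primrec kernel_pow :: "('a \<Rightarrow> 'a measure) \<Rightarrow> 'a measure \<Rightarrow> nat \<Rightarrow> 'a \<Rightarrow> 'a measure" where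
  "kernel_pow K N 0 z = return N z"
| "kernel_pow K N (Suc n) z = K z \<bind> kernel_pow K N n"

definition strong_feller :: "('a::topological_space \<Rightarrow> 'a measure) \<Rightarrow> 'a measure \<Rightarrow> bool" where
  "strong_feller K N \<longleftrightarrow> (\<forall>A\<in>sets N. continuous_on UNIV (\<lambda>z. measure (K z) A))"


section \<open>Random maps\<close>

definition fibered_nonsingular :: "('t \<times> 'x \<Rightarrow> 'x) \<Rightarrow> 't measure \<Rightarrow> 'x measure \<Rightarrow> bool" where
  "fibered_nonsingular f p m \<longleftrightarrow>
     (AE t in p. \<forall>A\<in>null_sets m. (\<lambda>x. f (t, x)) -` A \<inter> space m \<in> null_sets m)"

definition skew_product ::
    "('t \<times> 'x \<Rightarrow> 'x) \<Rightarrow> (nat \<Rightarrow> 't) \<times> 'x \<Rightarrow> (nat \<Rightarrow> 't) \<times> 'x" where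
  "skew_product f = (\<lambda>(\<omega>, x). (shift \<omega>, f (\<omega> 0, x)))"

text \<open>The kernel sending a set \<open>B\<close> to \<open>Q(t, {u. (u, f(u, x)) \<in> B})\<close>.\<close>

definition phat ::
    "('t::topological_space \<Rightarrow> 't measure) \<Rightarrow> ('t \<times> 'x::topological_space \<Rightarrow> 'x)
       \<Rightarrow> 't \<times> 'x \<Rightarrow> ('t \<times> 'x) measure" where
  "phat Q f = (\<lambda>(t, x). distr (Q t) (borel \<Otimes>\<^sub>M borel) (\<lambda>u. (u, f (u, x))))"

definition kernel_op :: "('a \<Rightarrow> 'a measure) \<Rightarrow> ('a \<Rightarrow> real) \<Rightarrow> 'a \<Rightarrow> real" where
  "kernel_op K \<phi> z = (\<integral>y. \<phi> y \<partial>K z)"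

definition markovian_measure ::
    "(nat \<Rightarrow> 't::topological_space) measure \<Rightarrow> 'x::topological_space measure
       \<Rightarrow> ((nat \<Rightarrow> 't) \<times> 'x \<Rightarrow> (nat \<Rightarrow> 't) \<times> 'x) \<Rightarrow> ((nat \<Rightarrow> 't) \<times> 'x) measure \<Rightarrow> bool" where
  "markovian_measure \<P> m F \<mu> \<longleftrightarrow>
     prob_space \<mu> \<and> sets \<mu> = sets (\<P> \<Otimes>\<^sub>M m) \<and> invariant_measure F \<mu> \<and>
     distr \<mu> \<P> fst = \<P> \<and>
     (\<exists>\<kappa>::'t \<Rightarrow> 'x measure. \<kappa> \<in> borel \<rightarrow>\<^sub>M prob_algebra borel \<and>
        (\<forall>C\<in>sets \<mu>. emeasure \<mu> C = (\<integral>\<^sup>+\<omega>. emeasure (\<kappa> (\<omega> 0)) (Pair \<omega> -` C) \<partial>\<P>)))"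

definition birkhoff_basin :: "('a \<Rightarrow> 'a) \<Rightarrow> 'a measure \<Rightarrow> ('a \<Rightarrow> real) \<Rightarrow> 'a set" where
  "birkhoff_basin F \<mu> \<phi> =
     {z. (\<lambda>n. (1 / real n) * (\<Sum>j<n. \<phi> ((F ^^ j) z))) \<longlonglongrightarrow> (\<integral>w. \<phi> w \<partial>\<mu>)}"

definition FPM ::
    "(nat \<Rightarrow> 't::topological_space) measure \<Rightarrow> 'x::topological_space measure
       \<Rightarrow> ((nat \<Rightarrow> 't) \<times> 'x \<Rightarrow> (nat \<Rightarrow> 't) \<times> 'x) \<Rightarrow> bool" where
  "FPM \<P> m F \<longleftrightarrow>
     (\<exists>S. finite S \<and>
        (\<forall>\<mu>\<in>S. sets \<mu> = sets (\<P> \<Otimes>\<^sub>M m) \<and> ergodic_measure F \<mu> \<and>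
                markovian_measure \<P> m F \<mu> \<and> absolutely_continuous (\<P> \<Otimes>\<^sub>M m) \<mu>) \<and>
        (\<forall>\<phi>. \<phi> \<in> borel_measurable (\<P> \<Otimes>\<^sub>M m) \<and> bounded (range \<phi>) \<longrightarrow>
             emeasure (\<P> \<Otimes>\<^sub>M m) (\<Union>\<mu>\<in>S. birkhoff_basin F \<mu> \<phi>) = 1))"


section \<open>The real Banach space of essentially bounded functions\<close>

text \<open>Its points are the classes, modulo almost everywhere equality, of measurable functions with
  finite essential supremum norm.\<close>

definition ess_norm :: "'a measure \<Rightarrow> ('a \<Rightarrow> real) \<Rightarrow> real" where
  "ess_norm M \<phi> = real_of_ereal (esssup M (\<lambda>x. ereal \<bar>\<phi> x\<bar>))"

definition ess_bounded :: "'a measure \<Rightarrow> ('a \<Rightarrow> real) set" where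
  "ess_bounded M = {\<phi>. \<phi> \<in> borel_measurable M \<and> esssup M (\<lambda>x. ereal \<bar>\<phi> x\<bar>) < \<infinity>}"

definition ae_eq :: "'a measure \<Rightarrow> (('a \<Rightarrow> real) \<times> ('a \<Rightarrow> real)) set" where
  "ae_eq M = {(\<phi>, \<psi>). \<phi> \<in> ess_bounded M \<and> \<psi> \<in> ess_bounded M \<and> (AE x in M. \<phi> x = \<psi> x)}"

definition Linf :: "'a measure \<Rightarrow> ('a \<Rightarrow> real) set set" where
  "Linf M = ess_bounded M // ae_eq M"

text \<open>The representatives chosen below do not matter (lemma \<open>Linf_dist_class\<close>). The value outside
  \<^term>\<open>Linf M\<close> is set to 0 because \<^locale>\<open>Metric_space\<close> demands symmetry and nonnegativity
  everywhere.\<close>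

definition Linf_dist :: "'a measure \<Rightarrow> ('a \<Rightarrow> real) set \<Rightarrow> ('a \<Rightarrow> real) set \<Rightarrow> real" where
  "Linf_dist M c d =
     (if c \<in> Linf M \<and> d \<in> Linf M
      then THE r. \<exists>\<phi>\<in>c. \<exists>\<psi>\<in>d. r = ess_norm M (\<lambda>x. \<phi> x - \<psi> x) else 0)"

definition Linf_comb ::
    "'a measure \<Rightarrow> real \<Rightarrow> ('a \<Rightarrow> real) set \<Rightarrow> real \<Rightarrow> ('a \<Rightarrow> real) set \<Rightarrow> ('a \<Rightarrow> real) set" where
  "Linf_comb M a c b d = ae_eq M `` {(\<lambda>x. a * \<phi> x + b * \<psi> x) |\<phi> \<psi>. \<phi> \<in> c \<and> \<psi> \<in> d}"

text \<open>The map on classes induced by a map on functions; the value is again a class only if the map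
  on functions respects almost everywhere equality.\<close>

definition Linf_lift ::
    "'a measure \<Rightarrow> (('a \<Rightarrow> real) \<Rightarrow> 'a \<Rightarrow> real) \<Rightarrow> ('a \<Rightarrow> real) set \<Rightarrow> ('a \<Rightarrow> real) set" where
  "Linf_lift M A c = ae_eq M `` (A ` c)"

definition Linf_linear :: "'a measure \<Rightarrow> (('a \<Rightarrow> real) set \<Rightarrow> ('a \<Rightarrow> real) set) \<Rightarrow> bool" where
  "Linf_linear M A \<longleftrightarrow> A \<in> Linf M \<rightarrow> Linf M \<and>
     (\<forall>c\<in>Linf M. \<forall>d\<in>Linf M. \<forall>a b. A (Linf_comb M a c b d) = Linf_comb M a (A c) b (A d))"

abbreviation Linf_topology :: "'a measure \<Rightarrow> ('a \<Rightarrow> real) set topology" where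
  "Linf_topology M \<equiv> Metric_space.mtopology (Linf M) (Linf_dist M)"

definition Linf_compact :: "'a measure \<Rightarrow> (('a \<Rightarrow> real) set \<Rightarrow> ('a \<Rightarrow> real) set) \<Rightarrow> bool" where
  "Linf_compact M A \<longleftrightarrow> Linf_linear M A \<and>
     (\<forall>S. Metric_space.mbounded (Linf M) (Linf_dist M) S \<longrightarrow>
        compactin (Linf_topology M) (Linf_topology M closure_of (A ` S)))"

definition Linf_eventually_compact ::
    "'a measure \<Rightarrow> (('a \<Rightarrow> real) set \<Rightarrow> ('a \<Rightarrow> real) set) \<Rightarrow> bool" where
  "Linf_eventually_compact M A \<longleftrightarrow> Linf_linear M A \<and> (\<exists>n. Linf_compact M (A ^^ n))"


subsection \<open>The distance is a metric\<close>

lemma equiv_ae_eq: "equiv (ess_bounded M) (ae_eq M)"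
  by (rule equivI) (auto simp: ae_eq_def refl_on_def sym_def trans_def elim: eventually_elim2)

lemma ess_bounded_iff:
  assumes "prob_space M"
  shows "\<phi> \<in> ess_bounded M \<longleftrightarrow> \<phi> \<in> borel_measurable M \<and> (\<exists>C. AE x in M. \<bar>\<phi> x\<bar> \<le> C)"
proof -
  interpret prob_space M by fact
  have "\<exists>C. AE x in M. \<bar>\<phi> x\<bar> \<le> C"
    if "esssup M (\<lambda>x. ereal \<bar>\<phi> x\<bar>) < \<infinity>"
  proof -
    have *: "AE x in M. ereal \<bar>\<phi> x\<bar> \<le> esssup M (\<lambda>x. ereal \<bar>\<phi> x\<bar>)"
      by (rule esssup_AE)
    show ?thesis
    proof (cases "esssup M (\<lambda>x. ereal \<bar>\<phi> x\<bar>)")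
      case (real r)
      with * show ?thesis by auto
    next
      case MInf
      with * have "AE x in M. \<bar>\<phi> x\<bar> \<le> 0" by auto
      then show ?thesis by blast
    qed (use that in auto)
  qed
  moreover have "esssup M (\<lambda>x. ereal \<bar>\<phi> x\<bar>) < \<infinity>"
    if "\<phi> \<in> borel_measurable M" "AE x in M. \<bar>\<phi> x\<bar> \<le> C" for C
  proof -
    have "esssup M (\<lambda>x. ereal \<bar>\<phi> x\<bar>) \<le> ereal C"
      using that by (intro esssup_I) auto
    then show ?thesis by (rule le_less_trans) simp
  qed
  ultimately show ?thesis by (auto simp: ess_bounded_def)
qed

lemma ess_bounded_diff:
  assumes "prob_space M" "\<phi> \<in> ess_bounded M" "\<psi> \<in> ess_bounded M"
  shows "(\<lambda>x. \<phi> x - \<psi> x) \<in> ess_bounded M"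
proof -
  obtain C D where "AE x in M. \<bar>\<phi> x\<bar> \<le> C" "AE x in M. \<bar>\<psi> x\<bar> \<le> D"
    using assms ess_bounded_iff by blast
  then have "AE x in M. \<bar>\<phi> x - \<psi> x\<bar> \<le> C + D" by eventually_elim auto
  with assms show ?thesis by (auto simp: ess_bounded_iff)
qed

lemma ess_norm_AE:
  assumes "prob_space M" "\<phi> \<in> ess_bounded M"
  shows "0 \<le> ess_norm M \<phi>" "AE x in M. \<bar>\<phi> x\<bar> \<le> ess_norm M \<phi>"
proof -
  interpret prob_space M by fact
  have nz: "emeasure M (space M) \<noteq> 0" using emeasure_space_1 by simp
  have meas: "(\<lambda>x. ereal \<bar>\<phi> x\<bar>) \<in> borel_measurable M" and
    fin: "esssup M (\<lambda>x. ereal \<bar>\<phi> x\<bar>) < \<infinity>"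
    using assms(2) by (auto simp: ess_bounded_def)
  have ge: "0 \<le> esssup M (\<lambda>x. ereal \<bar>\<phi> x\<bar>)"
    using esssup_mono[of "\<lambda>_. 0" M "\<lambda>x. ereal \<bar>\<phi> x\<bar>"] esssup_const[OF nz, of "0::ereal"] meas
    by auto
  from ge fin obtain r where r: "esssup M (\<lambda>x. ereal \<bar>\<phi> x\<bar>) = ereal r"
    by (cases "esssup M (\<lambda>x. ereal \<bar>\<phi> x\<bar>)") auto
  show "0 \<le> ess_norm M \<phi>" using ge r by (simp add: ess_norm_def)
  show "AE x in M. \<bar>\<phi> x\<bar> \<le> ess_norm M \<phi>"
    using esssup_AE[of "\<lambda>x. ereal \<bar>\<phi> x\<bar>" M] unfolding r ess_norm_def by simp
qed

lemma ess_norm_le: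
  assumes "prob_space M" "\<phi> \<in> ess_bounded M" "AE x in M. \<bar>\<phi> x\<bar> \<le> C"
  shows "ess_norm M \<phi> \<le> C"
proof -
  interpret prob_space M by fact
  have "AE x in M. 0 \<le> C" using assms(3) by eventually_elim auto
  then have C: "0 \<le> C" by auto
  have "esssup M (\<lambda>x. ereal \<bar>\<phi> x\<bar>) \<le> ereal C"
    using assms by (intro esssup_I) (auto simp: ess_bounded_def)
  then show ?thesis using C unfolding ess_norm_def
    by (cases "esssup M (\<lambda>x. ereal \<bar>\<phi> x\<bar>)") auto
qed

lemma Linf_dist_class:
  assumes "prob_space M" "c \<in> Linf M" "d \<in> Linf M" "\<phi> \<in> c" "\<psi> \<in> d"
  shows "Linf_dist M c d = ess_norm M (\<lambda>x. \<phi> x - \<psi> x)"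
proof -
  have "(THE r. \<exists>\<phi>\<in>c. \<exists>\<psi>\<in>d. r = ess_norm M (\<lambda>x. \<phi> x - \<psi> x)) = ess_norm M (\<lambda>x. \<phi> x - \<psi> x)"
  proof (rule the_equality)
    show "\<exists>\<phi>'\<in>c. \<exists>\<psi>'\<in>d. ess_norm M (\<lambda>x. \<phi> x - \<psi> x) = ess_norm M (\<lambda>x. \<phi>' x - \<psi>' x)"
      using assms by blast
  next
    fix r assume "\<exists>\<phi>'\<in>c. \<exists>\<psi>'\<in>d. r = ess_norm M (\<lambda>x. \<phi>' x - \<psi>' x)"
    then obtain \<phi>' \<psi>' where *: "\<phi>' \<in> c" "\<psi>' \<in> d" "r = ess_norm M (\<lambda>x. \<phi>' x - \<psi>' x)"
      by blast
    have "(\<phi>, \<phi>') \<in> ae_eq M" "(\<psi>, \<psi>') \<in> ae_eq M"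
      using assms * equiv_ae_eq quotient_eq_iff unfolding Linf_def by metis+
    then have m: "\<phi> \<in> borel_measurable M" "\<phi>' \<in> borel_measurable M"
        "\<psi> \<in> borel_measurable M" "\<psi>' \<in> borel_measurable M"
      and ae: "AE x in M. \<phi> x = \<phi>' x" "AE x in M. \<psi> x = \<psi>' x"
      by (auto simp: ae_eq_def ess_bounded_def)
    from ae have "AE x in M. ereal \<bar>\<phi>' x - \<psi>' x\<bar> = ereal \<bar>\<phi> x - \<psi> x\<bar>"
      by eventually_elim auto
    then show "r = ess_norm M (\<lambda>x. \<phi> x - \<psi> x)"
      unfolding * ess_norm_def using m by (intro arg_cong[where f = real_of_ereal] esssup_AE_cong) auto
  qed
  then show ?thesis using assms by (simp add: Linf_dist_def)
qed

lemma Linf_rep: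
  assumes "c \<in> Linf M"
  obtains \<phi> where "\<phi> \<in> c" "\<phi> \<in> ess_bounded M"
  using assms equiv_ae_eq[of M] unfolding Linf_def
  by (metis equiv_class_self quotientE)

lemma Metric_space_Linf:
  assumes M: "prob_space M"
  shows "Metric_space (Linf M) (Linf_dist M)"
proof
  interpret prob_space M by fact
  note D = Linf_dist_class[OF M]
  have nonneg: "0 \<le> Linf_dist M c d" if cd: "c \<in> Linf M" "d \<in> Linf M" for c d
  proof -
    from cd obtain \<phi> \<psi> where "\<phi> \<in> c" "\<phi> \<in> ess_bounded M" "\<psi> \<in> d" "\<psi> \<in> ess_bounded M"
      by (metis Linf_rep)
    then show ?thesis
      using D[OF cd] ess_norm_AE(1)[OF M ess_bounded_diff[OF M]] by metis
  qed
  show "0 \<le> Linf_dist M c d" for c d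
    using nonneg[of c d] by (cases "c \<in> Linf M \<and> d \<in> Linf M") (auto simp: Linf_dist_def)
  show "Linf_dist M c d = Linf_dist M d c" for c d
  proof (cases "c \<in> Linf M \<and> d \<in> Linf M")
    case True
    then obtain \<phi> \<psi> where "\<phi> \<in> c" "\<psi> \<in> d" by (metis Linf_rep)
    with True show ?thesis
      by (simp add: D[of c d \<phi> \<psi>] D[of d c \<psi> \<phi>] ess_norm_def abs_minus_commute)
  qed (auto simp: Linf_dist_def)
  show "Linf_dist M c d = 0 \<longleftrightarrow> c = d" if cd: "c \<in> Linf M" "d \<in> Linf M" for c d
  proof -
    from cd obtain \<phi> \<psi> where
      r: "\<phi> \<in> c" "\<phi> \<in> ess_bounded M" "\<psi> \<in> d" "\<psi> \<in> ess_bounded M"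
      by (metis Linf_rep)
    note b = ess_bounded_diff[OF M r(2,4)]
    have "c = d \<longleftrightarrow> (\<phi>, \<psi>) \<in> ae_eq M"
      using quotient_eq_iff[OF equiv_ae_eq] cd r unfolding Linf_def by metis
    also have "\<dots> \<longleftrightarrow> (AE x in M. \<phi> x = \<psi> x)"
      using r by (simp add: ae_eq_def)
    also have "\<dots> \<longleftrightarrow> ess_norm M (\<lambda>x. \<phi> x - \<psi> x) = 0"
    proof
      assume "AE x in M. \<phi> x = \<psi> x"
      then have "AE x in M. \<bar>\<phi> x - \<psi> x\<bar> \<le> 0" by eventually_elim auto
      from ess_norm_le[OF M b this] ess_norm_AE(1)[OF M b]
      show "ess_norm M (\<lambda>x. \<phi> x - \<psi> x) = 0" by simp
    next
      assume *: "ess_norm M (\<lambda>x. \<phi> x - \<psi> x) = 0"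
      from ess_norm_AE(2)[OF M b] show "AE x in M. \<phi> x = \<psi> x"
        unfolding * by eventually_elim auto
    qed
    finally show ?thesis using D[OF cd r(1,3)] by simp
  qed
  show "Linf_dist M c e \<le> Linf_dist M c d + Linf_dist M d e"
    if cde: "c \<in> Linf M" "d \<in> Linf M" "e \<in> Linf M" for c d e
  proof -
    obtain \<phi> where f: "\<phi> \<in> c" "\<phi> \<in> ess_bounded M" using Linf_rep cde(1) by metis
    obtain \<psi> where g: "\<psi> \<in> d" "\<psi> \<in> ess_bounded M" using Linf_rep cde(2) by metis
    obtain \<theta> where h: "\<theta> \<in> e" "\<theta> \<in> ess_bounded M" using Linf_rep cde(3) by metis
    note fg = ess_norm_AE(2)[OF M ess_bounded_diff[OF M f(2) g(2)]]
    note gh = ess_norm_AE(2)[OF M ess_bounded_diff[OF M g(2) h(2)]]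
    have "AE x in M. \<bar>\<phi> x - \<theta> x\<bar>
        \<le> ess_norm M (\<lambda>x. \<phi> x - \<psi> x) + ess_norm M (\<lambda>x. \<psi> x - \<theta> x)"
      using fg gh by eventually_elim linarith
    from ess_norm_le[OF M ess_bounded_diff[OF M f(2) h(2)] this]
    show ?thesis
      using D[OF cde(1,3) f(1) h(1)] D[OF cde(1,2) f(1) g(1)] D[OF cde(2,3) g(1) h(1)] by simp
  qed
qed

end

theory Submission
  imports Defs
begin

text \<open>
Let \<open>z\<^sub>n = (\<omega>\<^sub>n\<^sub>-\<^sub>1, x\<^sub>n)\<close> along an orbit \<open>x\<^sub>n\<^sub>+\<^sub>1 = f (\<omega>\<^sub>n, x\<^sub>n)\<close>. This is a Markov chain on
\<open>T \<times> X\<close> whose kernel is \<^term>\<open>phat Q f\<close>, and the proof moves every question about the skew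
product to this chain. The bridge is the law \<open>K (t, x)\<close> of \<open>(\<omega>, x)\<close> when the letter before \<open>\<omega>\<close> was
\<open>t\<close>: its image under the skew product is the average of \<open>K\<close> over \<^term>\<open>phat Q f (t, x)\<close>
(\<open>distr_K_F\<close>), and \<open>\<P> \<times> m\<close> is the average of \<open>K\<close> over \<open>p \<times> m\<close> (\<open>pair_markov_measure\<close>).

Both parts rest on one compactness fact (\<open>strong_feller_comp_uniform_subsequence\<close>). If two kernels
are strong Feller and \<open>\<phi>\<^sub>n\<close> is a bounded sequence of measurable functions, then along a subsequence
the image of \<open>\<phi>\<^sub>n\<close> under the composition converges uniformly. The measures of the second kernel are
absolutely continuous with respect to one measure, so weak compactness makes the first image converge
pointwise; the suprema of the tails of the errors decrease to 0, the first kernel makes them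
continuous, and Dini's theorem makes the convergence uniform. Applied to the \<open>n\<^sub>0\<close>-th power twice, this
is the compactness of the \<open>2 n\<^sub>0\<close>-th power of the operator; fibered nonsingularity is what lets the
operator act on classes modulo null sets.

For the physical measures, Dini's theorem also makes the averages of the laws \<open>(p \<times> m) P\<^sup>k\<close>, \<open>k \<ge> n\<^sub>0\<close>,
uniformly countably additive. They therefore cluster, setwise, at a stationary law \<open>\<rho>\<close> that is
absolutely continuous with respect to \<open>p \<times> m\<close> (\<open>stationary_limit\<close>), and the average \<open>\<mu>\<close> of \<open>K\<close> over \<open>\<rho>\<close>
is an invariant measure that is absolutely continuous with respect to \<open>\<P> \<times> m\<close> and gives every
invariant set the same mass as \<open>\<P> \<times> m\<close>. A zero-one law (\<open>prob_in_next_state_eq_indicator\<close>) says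
that under \<open>\<mu>\<close> the state \<open>(\<omega>\<^sub>0, f (\<omega>\<^sub>0, x))\<close> already decides whether \<open>(\<omega>, x)\<close> lies in an invariant set.
The functions \<open>z \<mapsto> K z C\<close> with \<open>C\<close> invariant are harmonic, so they form a relatively compact set,
while by the zero-one law two of them differ by 1 at some state unless the invariant sets coincide
up to null sets. So invariant sets of positive measure cannot be arbitrarily small
(\<open>invariant_measure_gap\<close>). Hence finitely many ergodic components \<open>C\<close> exhaust \<open>\<mu>\<close>, and Birkhoff's
theorem on each of them gives the basins first up to \<open>\<mu>\<close>-null sets and then, the union being
invariant, up to \<open>\<P> \<times> m\<close>-null sets. The conditional measure \<open>\<mu>(\<cdot> | C)\<close> is Markovian: by the zero-one
law it has a density in \<open>(\<omega>\<^sub>0, x)\<close>, and the law of \<open>\<omega>\<^sub>0\<close> under it is stationary for \<open>Q\<close>,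
hence equal to \<open>p\<close>.
\<close>

section \<open>Strong Feller kernels and compactness\<close>

lemma kernel_prob:
  assumes "K \<in> N \<rightarrow>\<^sub>M prob_algebra L" "z \<in> space N"
  shows "prob_space (K z)" "sets (K z) = sets L" "space (K z) = space L" "K z \<in> space (prob_algebra L)"
  using measurable_space[OF assms] by (auto simp: space_prob_algebra dest: sets_eq_imp_space_eq)

lemma integrable_bounded_prob:
  fixes \<phi> :: "'a \<Rightarrow> real"
  assumes "M \<in> space (prob_algebra N)" "\<phi> \<in> borel_measurable N" "\<And>x. x \<in> space N \<Longrightarrow> \<bar>\<phi> x\<bar> \<le> C"
  shows "integrable M \<phi>"
proof -
  from assms(1) interpret prob_space M by (simp add: space_prob_algebra)
  have s: "sets M = sets N" using assms(1) by (simp add: space_prob_algebra)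
  show ?thesis
  proof (rule integrable_const_bound[where B = C])
    show "AE x in M. norm (\<phi> x) \<le> C" using assms(3) sets_eq_imp_space_eq[OF s] by (intro AE_I2) auto
    show "\<phi> \<in> borel_measurable M" using assms(2) measurable_cong_sets[OF s refl] by auto
  qed
qed

lemma abs_integral_diff_le:
  fixes \<phi> \<psi> :: "'a \<Rightarrow> real"
  assumes M: "M \<in> space (prob_algebra N)"
    and "\<phi> \<in> borel_measurable N" "\<And>x. x \<in> space N \<Longrightarrow> \<bar>\<phi> x\<bar> \<le> C"
    and "\<psi> \<in> borel_measurable N" "\<And>x. x \<in> space N \<Longrightarrow> \<bar>\<psi> x\<bar> \<le> D"
    and d: "\<And>x. x \<in> space N \<Longrightarrow> \<bar>\<phi> x - \<psi> x\<bar> \<le> \<delta>"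
  shows "\<bar>(\<integral>x. \<phi> x \<partial>M) - (\<integral>x. \<psi> x \<partial>M)\<bar> \<le> \<delta>"
proof -
  interpret prob_space M using M by (simp add: space_prob_algebra)
  have s: "sets M = sets N" using M by (simp add: space_prob_algebra)
  have i: "integrable M \<phi>" "integrable M \<psi>"
    using integrable_bounded_prob[OF M] assms by blast+
  have "\<bar>(\<integral>x. \<phi> x \<partial>M) - (\<integral>x. \<psi> x \<partial>M)\<bar> = \<bar>\<integral>x. \<phi> x - \<psi> x \<partial>M\<bar>"
    using i by simp
  also have "\<dots> \<le> (\<integral>x. \<bar>\<phi> x - \<psi> x\<bar> \<partial>M)" by (rule integral_abs_bound)
  also have "\<dots> \<le> (\<integral>x. \<delta> \<partial>M)"
    using i d sets_eq_imp_space_eq[OF s] by (intro integral_mono) auto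
  also have "\<dots> = \<delta>" by (simp add: prob_space)
  finally show ?thesis .
qed

lemma abs_integral_le:
  fixes \<phi> :: "'a \<Rightarrow> real"
  assumes M: "M \<in> space (prob_algebra N)"
    and "\<phi> \<in> borel_measurable N" "\<And>x. x \<in> space N \<Longrightarrow> \<bar>\<phi> x\<bar> \<le> C"
  shows "\<bar>\<integral>x. \<phi> x \<partial>M\<bar> \<le> C"
  using abs_integral_diff_le[OF M assms(2,3), of "\<lambda>_. 0" 0 C] assms(3) by simp

text \<open>A bounded function is uniformly close to a combination of finitely many indicators, namely of
  the sets on which \<open>\<lfloor>\<phi>/\<delta>\<rfloor>\<close> is constant, and for indicators the convergence is the hypothesis.\<close>

lemma tendsto_integral_setwise:
  fixes \<nu> :: "'i \<Rightarrow> 'a measure" and \<phi> :: "'a \<Rightarrow> real"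
  assumes \<nu>: "\<And>i. \<nu> i \<in> space (prob_algebra N)" and \<rho>: "\<rho> \<in> space (prob_algebra N)"
    and conv: "\<And>A. A \<in> sets N \<Longrightarrow> ((\<lambda>i. measure (\<nu> i) A) \<longlongrightarrow> measure \<rho> A) H"
    and [measurable]: "\<phi> \<in> borel_measurable N" and bd: "\<And>x. x \<in> space N \<Longrightarrow> \<bar>\<phi> x\<bar> \<le> C"
  shows "((\<lambda>i. \<integral>x. \<phi> x \<partial>\<nu> i) \<longlongrightarrow> (\<integral>x. \<phi> x \<partial>\<rho>)) H"
proof (rule tendstoI)
  fix e :: real assume e: "0 < e"
  define \<delta> where "\<delta> = e / 3"
  have \<delta>: "0 < \<delta>" using e by (simp add: \<delta>_def)
  define K where "K = \<lceil>C / \<delta>\<rceil> + 1"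
  define E where "E k = {x \<in> space N. \<lfloor>\<phi> x / \<delta>\<rfloor> = k}" for k :: int
  have E[measurable]: "E k \<in> sets N" for k unfolding E_def by measurable
  define \<psi> where "\<psi> x = (\<Sum>k\<in>{-K..K}. \<delta> * of_int k * indicator (E k) x)" for x
  have \<psi>_eq: "\<psi> x = \<delta> * of_int \<lfloor>\<phi> x / \<delta>\<rfloor>" if x: "x \<in> space N" for x
  proof -
    have "\<bar>\<phi> x / \<delta>\<bar> \<le> C / \<delta>" using bd[OF x] \<delta> by (simp add: divide_right_mono)
    then have "\<lfloor>\<phi> x / \<delta>\<rfloor> \<in> {-K..K}" unfolding K_def by (simp, linarith)
    moreover have "\<psi> x = (\<Sum>k\<in>{-K..K}. if k = \<lfloor>\<phi> x / \<delta>\<rfloor> then \<delta> * of_int k else 0)"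
      unfolding \<psi>_def using x by (intro sum.cong) (auto simp: E_def indicator_def)
    ultimately show ?thesis by simp
  qed
  have close: "\<bar>\<phi> x - \<psi> x\<bar> \<le> \<delta>" if x: "x \<in> space N" for x
  proof -
    have "\<bar>\<phi> x / \<delta> - of_int \<lfloor>\<phi> x / \<delta>\<rfloor>\<bar> \<le> 1" by linarith
    then have "\<bar>\<delta> * (\<phi> x / \<delta> - of_int \<lfloor>\<phi> x / \<delta>\<rfloor>)\<bar> \<le> \<delta>"
      using \<delta> by (simp add: abs_mult)
    then show ?thesis using \<delta> by (simp add: \<psi>_eq[OF x] right_diff_distrib)
  qed
  have \<psi>m[measurable]: "\<psi> \<in> borel_measurable N" unfolding \<psi>_def by measurable
  have \<psi>b: "\<bar>\<psi> x\<bar> \<le> C + \<delta>" if "x \<in> space N" for x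
    using close[OF that] bd[OF that] by linarith
  have int_\<psi>: "(\<integral>x. \<psi> x \<partial>M) = (\<Sum>k\<in>{-K..K}. \<delta> * of_int k * measure M (E k))"
    if M: "M \<in> space (prob_algebra N)" for M
  proof -
    interpret prob_space M using M by (simp add: space_prob_algebra)
    have s: "sets M = sets N" using M by (simp add: space_prob_algebra)
    have [simp]: "E k \<in> sets M" for k using s by simp
    have "E k \<inter> space M = E k" for k
      using sets_eq_imp_space_eq[OF s] by (auto simp: E_def)
    then show ?thesis unfolding \<psi>_def
      by (subst Bochner_Integration.integral_sum) (auto simp: emeasure_eq_measure)
  qed
  have "((\<lambda>i. \<integral>x. \<psi> x \<partial>\<nu> i) \<longlongrightarrow> (\<integral>x. \<psi> x \<partial>\<rho>)) H"
    unfolding int_\<psi>[OF \<nu>] int_\<psi>[OF \<rho>] by (intro tendsto_intros conv E)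
  from tendstoD[OF this \<delta>]
  show "\<forall>\<^sub>F i in H. dist (\<integral>x. \<phi> x \<partial>\<nu> i) (\<integral>x. \<phi> x \<partial>\<rho>) < e"
  proof eventually_elim
    case (elim i)
    have "\<bar>(\<integral>x. \<phi> x \<partial>\<nu> i) - (\<integral>x. \<psi> x \<partial>\<nu> i)\<bar> \<le> \<delta>"
      by (rule abs_integral_diff_le[OF \<nu> _ bd _ \<psi>b close]) auto
    moreover have "\<bar>(\<integral>x. \<phi> x \<partial>\<rho>) - (\<integral>x. \<psi> x \<partial>\<rho>)\<bar> \<le> \<delta>"
      by (rule abs_integral_diff_le[OF \<rho> _ bd _ \<psi>b close]) auto
    moreover have "e = 3 * \<delta>" by (simp add: \<delta>_def)
    ultimately show ?case using elim unfolding dist_real_def by linarith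
  qed
qed

lemma strong_feller_continuous_integral:
  fixes P :: "'a::topological_space \<Rightarrow> 'a measure" and \<phi> :: "'a \<Rightarrow> real"
  assumes P: "P \<in> borel \<rightarrow>\<^sub>M prob_algebra borel" and sf: "strong_feller P borel"
    and \<phi>: "\<phi> \<in> borel_measurable borel" "\<And>x. \<bar>\<phi> x\<bar> \<le> C"
  shows "continuous_on UNIV (\<lambda>z. \<integral>y. \<phi> y \<partial>P z)"
  unfolding continuous_on_def
proof
  fix z
  show "((\<lambda>z. \<integral>y. \<phi> y \<partial>P z) \<longlongrightarrow> (\<integral>y. \<phi> y \<partial>P z)) (at z within UNIV)"
    using sf \<phi>(2) unfolding strong_feller_def continuous_on_def
    by (intro tendsto_integral_setwise[OF _ _ _ \<phi>(1)] kernel_prob(4)[OF P]) auto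
qed

lemma dini:
  fixes g :: "nat \<Rightarrow> 'a::topological_space \<Rightarrow> real"
  assumes comp: "compact (UNIV :: 'a set)"
    and cont: "\<And>n. continuous_on UNIV (g n)"
    and dec: "\<And>n z. g (Suc n) z \<le> g n z"
    and lim: "\<And>z. (\<lambda>n. g n z) \<longlonglongrightarrow> 0" and e: "0 < e"
  shows "\<exists>n. \<forall>k\<ge>n. \<forall>z. g k z < e"
proof -
  have mono: "g k z \<le> g n z" if "n \<le> k" for n k z
    using decseqD[OF decseq_SucI[of "\<lambda>n. g n z"] that] dec by auto
  have "UNIV \<subseteq> (\<Union>n. {z. g n z < e})"
  proof
    fix z
    have "\<forall>\<^sub>F n in sequentially. g n z < e" using order_tendstoD(2)[OF lim e] .
    then show "z \<in> (\<Union>n. {z. g n z < e})" by (auto simp: eventually_sequentially)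
  qed
  moreover have "open {z. g n z < e}" for n
    using cont[of n] by (simp add: open_Collect_less continuous_on_const)
  ultimately obtain F where F: "finite F" "UNIV \<subseteq> (\<Union>n\<in>F. {z. g n z < e})"
    using compactE_image[OF comp, of UNIV "\<lambda>n. {z. g n z < e}"] by auto
  have "\<forall>z. g k z < e" if "Max (insert 0 F) \<le> k" for k
  proof
    fix z obtain n where n: "n \<in> F" "g n z < e" using F by auto
    then have "n \<le> k" using that F(1) Max_ge[of "insert 0 F" n] by simp
    with mono[of n k z] n show "g k z < e" by simp
  qed
  then show ?thesis by blast
qed

text \<open>Uniform limits of convergent sequences converge; this carries weak convergence from the sets of a
  generator to all integrable functions.\<close>

lemma convergent_if_approximable:
  fixes x :: "nat \<Rightarrow> real"
  assumes "\<And>e. 0 < e \<Longrightarrow> \<exists>y. convergent y \<and> (\<forall>n. \<bar>x n - y n\<bar> \<le> e)"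
  shows "convergent x"
proof -
  have "Cauchy x"
  proof (rule metric_CauchyI)
    fix e :: real assume "0 < e"
    then obtain y where y: "convergent y" "\<And>n. \<bar>x n - y n\<bar> \<le> e / 4"
      using assms[of "e / 4"] by auto
    from y(1) have "Cauchy y" by (simp add: Cauchy_convergent_iff)
    then obtain M where "\<And>m n. m \<ge> M \<Longrightarrow> n \<ge> M \<Longrightarrow> dist (y m) (y n) < e / 4"
      using metric_CauchyD[of y "e/4"] \<open>0 < e\<close> by auto
    then have "dist (x m) (x n) < e" if "m \<ge> M" "n \<ge> M" for m n
    proof -
      have "\<bar>y m - y n\<bar> < e / 4" if "m \<ge> M" "n \<ge> M" for m n
        using \<open>\<And>m n. m \<ge> M \<Longrightarrow> n \<ge> M \<Longrightarrow> dist (y m) (y n) < e / 4\<close>[OF that] by (simp add: dist_real_def)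
      from this[OF that] show ?thesis
        using y(2)[of m] y(2)[of n] \<open>0 < e\<close> unfolding dist_real_def by linarith
    qed
    then show "\<exists>M. \<forall>m\<ge>M. \<forall>n\<ge>M. dist (x m) (x n) < e" by blast
  qed
  then show ?thesis by (simp add: Cauchy_convergent_iff)
qed

lemma countable_Int_stable_generator:
  obtains G :: "'a::second_countable_topology set set"
  where "countable G" "Int_stable G" "UNIV \<in> G" "sets borel = sigma_sets UNIV G"
proof -
  obtain B :: "'a set set" where B: "countable B" "topological_basis B"
    using ex_countable_basis by blast
  define G where "G = Inter ` {F. finite F \<and> F \<subseteq> B}"
  have "countable G" unfolding G_def
    using countable_Collect_finite_subset[OF B(1)] by simp
  moreover have "Int_stable G"
  proof (rule Int_stableI)
    fix a b assume "a \<in> G" "b \<in> G"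
    then obtain F F' where "finite F" "F \<subseteq> B" "finite F'" "F' \<subseteq> B" "a = \<Inter>F" "b = \<Inter>F'"
      by (auto simp: G_def)
    then have "a \<inter> b = \<Inter>(F \<union> F')" "finite (F \<union> F')" "F \<union> F' \<subseteq> B" by auto
    then show "a \<inter> b \<in> G" unfolding G_def by blast
  qed
  moreover have "UNIV \<in> G" unfolding G_def by (auto intro!: image_eqI[of _ _ "{}"])
  moreover have "sets borel = sigma_sets UNIV G"
  proof -
    have "B \<subseteq> G" unfolding G_def by (auto intro!: image_eqI[of _ _ "{_}"])
    have s: "sets borel = sigma_sets UNIV B"
      using arg_cong[OF borel_eq_countable_basis[OF B], of sets] sets_measure_of[of B UNIV] by simp
    have "\<Inter>F \<in> sets borel" if "finite F" "F \<subseteq> B" for F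
      using that
    proof (induction F rule: finite_induct)
      case (insert x F)
      then have "x \<in> sets borel" "\<Inter>F \<in> sets borel" unfolding s by auto
      then show ?case by simp
    qed simp
    then have "G \<subseteq> sets borel" unfolding G_def by auto
    then have "sigma_sets UNIV G \<subseteq> sets borel"
      using sets.sigma_sets_subset[of G borel] by simp
    moreover have "sigma_sets UNIV B \<subseteq> sigma_sets UNIV G"
      using \<open>B \<subseteq> G\<close> by (rule sigma_sets_mono')
    ultimately show ?thesis using s by auto
  qed
  ultimately show ?thesis using that by blast
qed

text \<open>Sequential weak* compactness of the unit ball of \<open>L\<^sup>\<infinity>\<close>. A diagonal argument gives convergence
  against the indicators of a countable generator that is closed under intersections. The sets with
  this property form a Dynkin system, so it holds for all Borel sets, and then for all integrable
  functions by approximation in \<open>L\<^sup>1\<close>.\<close>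

lemma weak_convergent_subsequence:
  fixes \<eta> :: "'a::second_countable_topology measure" and \<phi> :: "nat \<Rightarrow> 'a \<Rightarrow> real"
  assumes \<eta>: "\<eta> \<in> space (prob_algebra borel)"
    and \<phi>: "\<And>n. \<phi> n \<in> borel_measurable borel" "\<And>n x. \<bar>\<phi> n x\<bar> \<le> C"
  shows "\<exists>r::nat\<Rightarrow>nat. strict_mono r \<and>
    (\<forall>k. integrable \<eta> k \<longrightarrow> convergent (\<lambda>n. \<integral>x. k x * \<phi> (r n) x \<partial>\<eta>))"
proof -
  interpret prob_space \<eta> using \<eta> by (simp add: space_prob_algebra)
  have s[measurable_cong, simp]: "sets \<eta> = sets borel" using \<eta> by (simp add: space_prob_algebra)
  have sp[simp]: "space \<eta> = UNIV" using sets_eq_imp_space_eq[OF s] by simp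
  note \<phi>(1)[measurable]
  have C: "0 \<le> C" using \<phi>(2)[of 0 undefined] by linarith
  have int: "integrable \<eta> (\<lambda>x. k x * \<phi> n x)" if "integrable \<eta> k" for k n
  proof (rule Bochner_Integration.integrable_bound[of _ "\<lambda>x. C * k x"])
    show "AE x in \<eta>. norm (k x * \<phi> n x) \<le> norm (C * k x)"
      using \<phi>(2) C by (intro AE_I2) (auto simp: abs_mult mult.commute[of C] intro!: mult_left_mono)
  qed (use that in auto)
  have diff: "\<bar>(\<integral>x. k x * \<phi> n x \<partial>\<eta>) - (\<integral>x. k' x * \<phi> n x \<partial>\<eta>)\<bar> \<le> C * (\<integral>x. \<bar>k x - k' x\<bar> \<partial>\<eta>)"
    if k: "integrable \<eta> k" "integrable \<eta> k'" for k k' n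
  proof -
    have "\<bar>(\<integral>x. k x * \<phi> n x \<partial>\<eta>) - (\<integral>x. k' x * \<phi> n x \<partial>\<eta>)\<bar> = \<bar>\<integral>x. (k x - k' x) * \<phi> n x \<partial>\<eta>\<bar>"
      using int[OF k(1)] int[OF k(2)] by (simp add: left_diff_distrib)
    also have "\<dots> \<le> (\<integral>x. \<bar>(k x - k' x) * \<phi> n x\<bar> \<partial>\<eta>)" by (rule integral_abs_bound)
    also have "\<dots> \<le> (\<integral>x. C * \<bar>k x - k' x\<bar> \<partial>\<eta>)"
      using integrable_abs[OF int[of "\<lambda>x. k x - k' x" n]] k \<phi>(2)
      by (intro integral_mono) (auto simp: abs_mult mult.commute[of C] intro!: mult_left_mono simp del: abs_mult_self_eq)
    finally show ?thesis by simp
  qed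
  obtain G :: "'a set set" where G: "countable G" "Int_stable G" "UNIV \<in> G" "sets borel = sigma_sets UNIV G"
    by (rule countable_Int_stable_generator)
  define a where "a = from_nat_into G"
  have a: "range a = G" unfolding a_def using G by (intro range_from_nat_into) auto
  define L where "L k n = (\<integral>x. k x * \<phi> n x \<partial>\<eta>)" for k n
  interpret subseqs "\<lambda>i s. convergent (\<lambda>n. L (indicator (a i)) (s n))"
  proof
    fix i :: nat and s :: "nat \<Rightarrow> nat" assume "strict_mono s"
    have "\<bar>L (indicator (a i)) n\<bar> \<le> C" for n unfolding L_def
    proof (rule abs_integral_le[OF \<eta>])
      have "a i \<in> sets borel" using a G(4) by auto
      then show "(\<lambda>x. indicator (a i) x * \<phi> n x) \<in> borel_measurable borel" by measurable
      show "\<bar>indicator (a i) x * \<phi> n x\<bar> \<le> C" for x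
        using \<phi>(2)[of n x] C by (auto simp: indicator_def)
    qed
    then have "bounded (range (\<lambda>n. L (indicator (a i)) (s n)))"
      by (auto simp: bounded_iff)
    from bounded_imp_convergent_subsequence[OF this] obtain l r where
      "strict_mono (r :: nat \<Rightarrow> nat)" "((\<lambda>n. L (indicator (a i)) (s n)) \<circ> r) \<longlonglongrightarrow> l" by metis
    then show "\<exists>r'. strict_mono r' \<and> convergent (\<lambda>n. L (indicator (a i)) ((s \<circ> r') n))"
      by (auto simp: convergent_def comp_def intro!: exI[of _ r])
  qed
  define r where "r = diagseq"
  have r: "strict_mono r" unfolding r_def by (rule subseq_diagseq)
  have conv_G: "convergent (\<lambda>n. L (indicator A) (r n))" if "A \<in> G" for A
  proof -
    have "A \<in> range a" using that a by simp
    then obtain i where i: "A = a i" by auto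
    have "convergent (\<lambda>n. L (indicator (a i)) ((diagseq \<circ> (+) (Suc i)) n))"
    proof (rule diagseq_holds)
      fix r s :: "nat \<Rightarrow> nat" and i
      assume "strict_mono r" "convergent (\<lambda>n. L (indicator (a i)) (s n))"
      then show "convergent (\<lambda>n. L (indicator (a i)) ((s \<circ> r) n))"
        by (auto simp: convergent_def comp_def dest: LIMSEQ_subseq_LIMSEQ[unfolded comp_def])
    qed
    then have "convergent (\<lambda>n. L (indicator A) (r (n + Suc i)))"
      by (simp add: i r_def comp_def add.commute)
    then show ?thesis
      unfolding convergent_def using LIMSEQ_offset[of "\<lambda>n. L (indicator A) (r n)" "Suc i"] by blast
  qed
  have conv_approx: "convergent (\<lambda>n. L k (r n))"
    if k: "integrable \<eta> k" "\<And>i. integrable \<eta> (s i)" "\<And>i::nat. convergent (\<lambda>n. L (s i) (r n))"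
      and lim: "(\<lambda>i. \<integral>x. \<bar>k x - s i x\<bar> \<partial>\<eta>) \<longlonglongrightarrow> 0" for k s
  proof (rule convergent_if_approximable)
    fix e :: real assume e: "0 < e"
    have "(\<lambda>i. C * (\<integral>x. \<bar>k x - s i x\<bar> \<partial>\<eta>)) \<longlonglongrightarrow> 0" using tendsto_mult_right_zero[OF lim] .
    then have "\<forall>\<^sub>F i in sequentially. C * (\<integral>x. \<bar>k x - s i x\<bar> \<partial>\<eta>) < e"
      by (rule order_tendstoD) (rule e)
    then obtain i where i: "C * (\<integral>x. \<bar>k x - s i x\<bar> \<partial>\<eta>) < e"
      by (auto simp: eventually_sequentially)
    have "\<bar>L k (r n) - L (s i) (r n)\<bar> \<le> e" for n
      using diff[OF k(1) k(2), of "r n" i] i unfolding L_def by linarith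
    then show "\<exists>y. convergent y \<and> (\<forall>n. \<bar>L k (r n) - y n\<bar> \<le> e)"
      using k(3)[of i] by blast
  qed
  have Lsum: "L (\<lambda>x. k x + k' x) n = L k n + L k' n" if "integrable \<eta> k" "integrable \<eta> k'" for k k' n
    unfolding L_def using int[OF that(1)] int[OF that(2)] by (simp add: distrib_right)
  have G_Pow: "G \<subseteq> Pow UNIV" by simp
  have conv_sets: "convergent (\<lambda>n. L (indicator A) (r n))" if "A \<in> sets borel" for A
    using G(2) G_Pow that[unfolded G(4)]
  proof (induction rule: sigma_sets_induct_disjoint)
    case (basic A) then show ?case by (rule conv_G)
  next
    case empty then show ?case by (simp add: L_def convergent_const)
  next
    case (compl A)
    then have [measurable]: "A \<in> sets borel" by (simp add: G(4))
    have "L (indicator UNIV) n = L (indicator A) n + L (indicator (UNIV - A)) n" for n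
    proof -
      have "(indicator UNIV :: 'a \<Rightarrow> real) = (\<lambda>x. indicator A x + indicator (UNIV - A) x)"
        by (auto simp: indicator_def)
      then show ?thesis by (subst Lsum[symmetric]) (auto simp: emeasure_eq_measure)
    qed
    then have "(\<lambda>n. L (indicator (UNIV - A)) (r n)) = (\<lambda>n. L (indicator UNIV) (r n) - L (indicator A) (r n))"
      by (simp add: algebra_simps)
    then show ?case using convergent_diff[OF conv_G[OF G(3)] compl(2)] by simp
  next
    case (union A)
    then have [measurable]: "A i \<in> sets borel" for i using G(4) by auto
    define s where "s N = (\<lambda>x. indicator (\<Union>i<N. A i) x :: real)" for N
    show ?case
    proof (rule conv_approx[of _ s])
      show "integrable \<eta> (indicator (\<Union> (range A)) :: _ \<Rightarrow> real)" by (auto simp: emeasure_eq_measure)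
      show "integrable \<eta> (s i)" for i unfolding s_def by (auto simp: emeasure_eq_measure)
      show "convergent (\<lambda>n. L (s i) (r n))" for i
      proof (induction i)
        case 0 then show ?case by (simp add: s_def L_def convergent_const)
      next
        case (Suc i)
        have "s (Suc i) = (\<lambda>x. s i x + indicator (A i) x)"
        proof
          fix x
          have "x \<notin> A j" if "x \<in> A i" "j < i" for j
            using disjoint_family_onD[OF union(1), of i j] that by auto
          then show "s (Suc i) x = s i x + indicator (A i) x"
            unfolding s_def indicator_def by (auto simp: less_Suc_eq)
        qed
        then have "L (s (Suc i)) n = L (s i) n + L (indicator (A i)) n" for n
          by (simp, subst Lsum) (auto simp: s_def emeasure_eq_measure)
        then show ?case using convergent_add[OF Suc union(3)] by simp
      qed
      have "(\<lambda>i. \<integral>x. \<bar>indicator (\<Union> (range A)) x - s i x\<bar> \<partial>\<eta>) \<longlonglongrightarrow> (\<integral>x. (0::real) \<partial>\<eta>)"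
      proof (rule integral_dominated_convergence[where w = "\<lambda>_. 1"])
        show "AE x in \<eta>. (\<lambda>i. \<bar>indicator (\<Union> (range A)) x - s i x\<bar>) \<longlonglongrightarrow> 0"
        proof (rule AE_I2)
          fix x
          have "\<forall>\<^sub>F i in sequentially. \<bar>indicator (\<Union> (range A)) x - s i x\<bar> = 0"
          proof (cases "x \<in> \<Union> (range A)")
            case True
            then obtain j where "x \<in> A j" by auto
            then have "\<bar>indicator (\<Union> (range A)) x - s i x\<bar> = 0" if "Suc j \<le> i" for i
              using that by (auto simp: s_def indicator_def)
            then show ?thesis unfolding eventually_sequentially by blast
          qed (auto simp: s_def)
          then show "(\<lambda>i. \<bar>indicator (\<Union> (range A)) x - s i x\<bar>) \<longlonglongrightarrow> 0"
            by (rule tendsto_eventually)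
        qed
        show "AE x in \<eta>. norm \<bar>indicator (\<Union> (range A)) x - s i x\<bar> \<le> 1" for i
          by (auto simp: s_def indicator_def)
        show "(\<lambda>x. \<bar>indicator (\<Union> (range A)) x - s i x\<bar>) \<in> borel_measurable \<eta>" for i
          unfolding s_def by measurable
      qed auto
      then show "(\<lambda>i. \<integral>x. \<bar>indicator (\<Union> (range A)) x - s i x\<bar> \<partial>\<eta>) \<longlonglongrightarrow> 0" by simp
    qed
  qed
  have "convergent (\<lambda>n. L k (r n))" if "integrable \<eta> k" for k
    using that
  proof (induction rule: integrable_induct)
    case (base A c)
    then have "convergent (\<lambda>n. c * L (indicator A) (r n))"
      by (intro convergent_mult convergent_const conv_sets) simp
    then show ?case by (simp add: L_def mult.assoc mult.left_commute)
  next
    case (add f g)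
    then show ?case using convergent_add[OF add(3,4)] by (simp add: Lsum)
  next
    case (lim f s)
    show ?case
    proof (rule conv_approx[OF lim(4,1,5)])
      note [measurable] = borel_measurable_integrable[OF lim(4)] borel_measurable_integrable[OF lim(1)]
      have "(\<lambda>i. \<integral>x. \<bar>f x - s i x\<bar> \<partial>\<eta>) \<longlonglongrightarrow> (\<integral>x. 0 \<partial>\<eta>)"
      proof (rule integral_dominated_convergence[where w = "\<lambda>x. 3 * \<bar>f x\<bar>"])
        show "AE x in \<eta>. norm \<bar>f x - s i x\<bar> \<le> 3 * \<bar>f x\<bar>" for i
        proof (rule AE_I2)
          fix x show "norm \<bar>f x - s i x\<bar> \<le> 3 * \<bar>f x\<bar>" using lim(3)[of x i] by simp
        qed
        show "AE x in \<eta>. (\<lambda>i. \<bar>f x - s i x\<bar>) \<longlonglongrightarrow> 0"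
        proof (rule AE_I2)
          fix x assume "x \<in> space \<eta>"
          from tendsto_rabs[OF tendsto_diff[OF tendsto_const[of "f x"] lim(2)[OF this]]]
          show "(\<lambda>i. \<bar>f x - s i x\<bar>) \<longlonglongrightarrow> 0" by simp
        qed
      qed (use lim(4) in auto)
      then show "(\<lambda>i. \<integral>x. \<bar>f x - s i x\<bar> \<partial>\<eta>) \<longlonglongrightarrow> 0" by simp
    qed
  qed
  then show ?thesis using r by (auto simp: L_def)
qed

lemma measurable_integral_kernel:
  fixes \<phi> :: "'b \<Rightarrow> real"
  assumes "K \<in> N \<rightarrow>\<^sub>M prob_algebra L" "\<phi> \<in> borel_measurable L"
  shows "(\<lambda>z. \<integral>y. \<phi> y \<partial>K z) \<in> borel_measurable N"
  using measurable_compose[OF measurable_prob_algebraD[OF assms(1)] integral_measurable_subprob_algebra[OF assms(2)]] .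

text \<open>Mix the measures \<open>P d\<close> over a dense sequence of points \<open>d\<close> with positive weights. A null set of the
  mixture is null for every \<open>P d\<close>, and \<open>z \<mapsto> P z A\<close> is continuous.\<close>

lemma absolutely_continuous_strong_feller:
  fixes P :: "'a::second_countable_topology \<Rightarrow> 'a measure"
  assumes P: "P \<in> borel \<rightarrow>\<^sub>M prob_algebra borel" and sf: "strong_feller P borel"
  obtains \<eta> where "\<eta> \<in> space (prob_algebra borel)" "\<And>z. absolutely_continuous \<eta> (P z)"
proof -
  obtain D :: "'a set" where D: "countable D" "\<And>X. open X \<Longrightarrow> X \<noteq> {} \<Longrightarrow> \<exists>d\<in>D. d \<in> X"
    using countable_dense_exists by metis
  have "D \<noteq> {}" using D(2)[of UNIV] by auto
  define d where "d = from_nat_into D"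
  have d: "range d = D" unfolding d_def using D \<open>D \<noteq> {}\<close> by (intro range_from_nat_into)
  define G where "G = measure_pmf (geometric_pmf (1/2))"
  have G: "G \<in> space (prob_algebra (count_space UNIV))"
    unfolding G_def by (simp add: space_prob_algebra measure_pmf.prob_space_axioms)
  have Pd: "(\<lambda>n. P (d n)) \<in> count_space UNIV \<rightarrow>\<^sub>M prob_algebra borel"
    using kernel_prob(4)[OF P] by simp
  define \<eta> where "\<eta> = G \<bind> (\<lambda>n. P (d n))"
  have \<eta>: "\<eta> \<in> space (prob_algebra borel)"
    unfolding \<eta>_def using prob_space_bind'[OF G Pd] sets_bind'[OF G Pd] by (simp add: space_prob_algebra)
  have "absolutely_continuous \<eta> (P z)" for z
    unfolding absolutely_continuous_def
  proof
    fix A assume "A \<in> null_sets \<eta>"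
    then have A: "A \<in> sets borel" "emeasure \<eta> A = 0"
      using \<eta> by (auto simp: space_prob_algebra)
    have "0 = (\<integral>\<^sup>+n. emeasure (P (d n)) A \<partial>G)"
      using A(2) emeasure_bind_prob_algebra[OF G Pd A(1)] by (simp add: \<eta>_def)
    then have "AE n in G. emeasure (P (d n)) A = 0"
      by (subst (asm) eq_commute, subst (asm) nn_integral_0_iff_AE) (auto simp: G_def)
    then have Pd0: "emeasure (P (d n)) A = 0" for n
      unfolding G_def by (subst (asm) AE_measure_pmf_iff) (auto simp: set_pmf_geometric)
    have "open {z. 0 < measure (P z) A}"
      using sf A(1) unfolding strong_feller_def
      by (intro open_Collect_less continuous_on_const) auto
    moreover have "measure (P x) A = 0" if "x \<in> D" for x
      using Pd0 d that by (metis imageE enn2real_0 measure_def)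
    ultimately have "{z. 0 < measure (P z) A} = {}"
      using D(2)[of "{z. 0 < measure (P z) A}"] by fastforce
    then have "measure (P z) A = 0"
      by (metis (mono_tags, lifting) empty_iff linorder_not_less measure_nonneg mem_Collect_eq order_antisym)
    moreover have "emeasure (P z) A = ennreal (measure (P z) A)"
      using finite_measure.emeasure_eq_measure[OF prob_space.finite_measure[OF kernel_prob(1)[OF P]]] by simp
    ultimately have "emeasure (P z) A = 0" by simp
    then show "A \<in> null_sets (P z)" using A(1) kernel_prob(2)[OF P] by auto
  qed
  with \<eta> show ?thesis using that by blast
qed

lemma strong_feller_pointwise_subsequence:
  fixes P :: "'a::second_countable_topology \<Rightarrow> 'a measure" and \<phi> :: "nat \<Rightarrow> 'a \<Rightarrow> real"
  assumes P: "P \<in> borel \<rightarrow>\<^sub>M prob_algebra borel" and sf: "strong_feller P borel"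
    and \<phi>: "\<And>n. \<phi> n \<in> borel_measurable borel" "\<And>n x. \<bar>\<phi> n x\<bar> \<le> C"
  obtains r :: "nat \<Rightarrow> nat"
  where "strict_mono r" "\<And>z. convergent (\<lambda>n. \<integral>y. \<phi> (r n) y \<partial>P z)"
proof -
  obtain \<eta> where \<eta>: "\<eta> \<in> space (prob_algebra borel)" and ac: "\<And>z. absolutely_continuous \<eta> (P z)"
    using absolutely_continuous_strong_feller[OF P sf] by metis
  obtain r :: "nat \<Rightarrow> nat" where r: "strict_mono r"
    "\<And>k. integrable \<eta> k \<Longrightarrow> convergent (\<lambda>n. \<integral>x. k x * \<phi> (r n) x \<partial>\<eta>)"
    using weak_convergent_subsequence[OF \<eta>, of \<phi> C, OF \<phi>] by blast
  have "convergent (\<lambda>n. \<integral>y. \<phi> (r n) y \<partial>P z)" for z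
  proof -
    interpret \<eta>: prob_space \<eta> using \<eta> by (simp add: space_prob_algebra)
    interpret Pz: prob_space "P z" using kernel_prob(1)[OF P] by simp
    have s: "sets (P z) = sets \<eta>" "sets \<eta> = sets borel"
      using kernel_prob(2)[OF P] \<eta> by (auto simp: space_prob_algebra)
    define k where "k = (\<lambda>x. enn2real (RN_deriv \<eta> (P z) x))"
    have sf': "sigma_finite_measure (P z)" by unfold_locales
    have eq: "(\<integral>y. g y \<partial>P z) = (\<integral>x. k x * g x \<partial>\<eta>)" if "g \<in> borel_measurable borel" for g
      unfolding k_def
      by (rule \<eta>.RN_deriv_integral[OF sf' ac s(1)]) (use that s in \<open>simp cong: measurable_cong_sets\<close>)
    have "integrable \<eta> k"
      using \<eta>.RN_deriv_integrable[OF sf' ac s(1), of "\<lambda>_. 1"] by (simp add: k_def)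
    from r(2)[OF this] show ?thesis by (simp add: eq \<phi>(1))
  qed
  with r(1) show ?thesis using that by blast
qed

text \<open>The second kernel yields pointwise convergence to some \<open>\<psi>\<close>. The suprema \<open>\<Psi>\<close> of the tails of the
  errors decrease to 0 pointwise, and so do their integrals against the first kernel. These integrals
  are continuous, so Dini's theorem applies to them.\<close>

lemma strong_feller_comp_uniform_subsequence:
  fixes P1 P2 :: "'a::second_countable_topology \<Rightarrow> 'a measure" and \<phi> :: "nat \<Rightarrow> 'a \<Rightarrow> real"
  assumes comp: "compact (UNIV :: 'a set)"
    and P1: "P1 \<in> borel \<rightarrow>\<^sub>M prob_algebra borel" "strong_feller P1 borel"
    and P2: "P2 \<in> borel \<rightarrow>\<^sub>M prob_algebra borel" "strong_feller P2 borel"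
    and \<phi>: "\<And>n. \<phi> n \<in> borel_measurable borel" "\<And>n x. \<bar>\<phi> n x\<bar> \<le> C"
  obtains r :: "nat \<Rightarrow> nat" and \<psi>
  where "strict_mono r" "\<psi> \<in> borel_measurable borel" "\<And>x. \<bar>\<psi> x\<bar> \<le> C"
    "uniform_limit UNIV (\<lambda>n z. \<integral>y. (\<integral>x. \<phi> (r n) x \<partial>P2 y) \<partial>P1 z) (\<lambda>z. \<integral>y. \<psi> y \<partial>P1 z) sequentially"
proof -
  obtain r :: "nat \<Rightarrow> nat" where r: "strict_mono r" "\<And>z. convergent (\<lambda>n. \<integral>y. \<phi> (r n) y \<partial>P2 z)"
    using strong_feller_pointwise_subsequence[OF P2, of \<phi> C, OF \<phi>] by metis
  define g where "g n y = (\<integral>x. \<phi> (r n) x \<partial>P2 y)" for n y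
  define \<psi> where "\<psi> y = lim (\<lambda>n. g n y)" for y
  have g_lim: "(\<lambda>n. g n y) \<longlonglongrightarrow> \<psi> y" for y
    using r(2)[of y] unfolding \<psi>_def g_def convergent_LIMSEQ_iff .
  have gm[measurable]: "g n \<in> borel_measurable borel" for n
    unfolding g_def by (rule measurable_integral_kernel[OF P2(1) \<phi>(1)])
  have \<psi>m[measurable]: "\<psi> \<in> borel_measurable borel"
    by (rule borel_measurable_LIMSEQ_real[OF g_lim gm])
  have gb: "\<bar>g n y\<bar> \<le> C" for n y
    unfolding g_def by (rule abs_integral_le[OF kernel_prob(4)[OF P2(1)] \<phi>]) auto
  have \<psi>b: "\<bar>\<psi> y\<bar> \<le> C" for y
    using LIMSEQ_le_const2[OF tendsto_rabs[OF g_lim]] gb by blast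
  have db: "\<bar>g m y - \<psi> y\<bar> \<le> 2 * C" for m y using gb[of m y] \<psi>b[of y] by linarith
  define \<Psi> where "\<Psi> k y = (SUP m\<in>{k..}. \<bar>g m y - \<psi> y\<bar>)" for k y
  have bdd: "bdd_above ((\<lambda>m. \<bar>g m y - \<psi> y\<bar>) ` S)" for S y
    using db by (intro bdd_aboveI[of _ "2 * C"]) auto
  have \<Psi>m[measurable]: "\<Psi> k \<in> borel_measurable borel" for k
    unfolding \<Psi>_def by (rule borel_measurable_cSUP) (auto intro: bdd)
  have \<Psi>_ge: "\<bar>g m y - \<psi> y\<bar> \<le> \<Psi> k y" if "k \<le> m" for k m y
    unfolding \<Psi>_def using that by (intro cSUP_upper bdd) auto
  have \<Psi>0: "0 \<le> \<Psi> k y" for k y using \<Psi>_ge[of k k y] by linarith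
  have \<Psi>b: "\<bar>\<Psi> k y\<bar> \<le> 2 * C" for k y
  proof -
    have "\<Psi> k y \<le> 2 * C" unfolding \<Psi>_def using db by (intro cSUP_least) auto
    then show ?thesis using \<Psi>0[of k y] by simp
  qed
  have \<Psi>_dec: "\<Psi> (Suc k) y \<le> \<Psi> k y" for k y
    unfolding \<Psi>_def by (intro cSUP_subset_mono bdd) auto
  have \<Psi>_lim: "(\<lambda>k. \<Psi> k y) \<longlonglongrightarrow> 0" for y
  proof (rule LIMSEQ_I)
    fix e :: real assume "0 < e"
    then obtain N where N: "\<And>m. N \<le> m \<Longrightarrow> \<bar>g m y - \<psi> y\<bar> < e / 2"
      using LIMSEQ_D[OF g_lim, of "e/2" y] by auto
    have "\<Psi> k y \<le> e / 2" if "N \<le> k" for k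
      unfolding \<Psi>_def using N that by (intro cSUP_least) (auto intro: less_imp_le)
    then show "\<exists>N. \<forall>k\<ge>N. norm (\<Psi> k y - 0) < e"
      using \<open>0 < e\<close> \<Psi>0 by (intro exI[of _ N]) (force intro: le_less_trans[of _ "e / 2"])
  qed
  note P1s = kernel_prob(4)[OF P1(1), simplified]
  define h where "h k z = (\<integral>y. \<Psi> k y \<partial>P1 z)" for k z
  have h_small: "\<exists>n. \<forall>k\<ge>n. \<forall>z. h k z < e" if e: "0 < e" for e
  proof (rule dini[OF comp _ _ _ e])
    show "continuous_on UNIV (h n)" for n
      unfolding h_def by (rule strong_feller_continuous_integral[OF P1 \<Psi>m \<Psi>b])
    show "h (Suc n) z \<le> h n z" for n z
      unfolding h_def using \<Psi>_dec
      by (intro integral_mono integrable_bounded_prob[OF P1s \<Psi>m \<Psi>b]) auto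
    show "(\<lambda>n. h n z) \<longlonglongrightarrow> 0" for z
    proof -
      interpret prob_space "P1 z" using kernel_prob(1)[OF P1(1)] by simp
      have [measurable_cong, simp]: "sets (P1 z) = sets borel" using kernel_prob(2)[OF P1(1)] by simp
      have "(\<lambda>n. \<integral>y. \<Psi> n y \<partial>P1 z) \<longlonglongrightarrow> (\<integral>y. 0 \<partial>P1 z)"
        using \<Psi>_lim \<Psi>b by (intro integral_dominated_convergence[where w = "\<lambda>_. 2 * C"]) auto
      then show ?thesis by (simp add: h_def)
    qed
  qed
  have "uniform_limit UNIV (\<lambda>n z. \<integral>y. g n y \<partial>P1 z) (\<lambda>z. \<integral>y. \<psi> y \<partial>P1 z) sequentially"
  proof (rule uniform_limitI)
    fix e :: real assume "0 < e"
    then obtain N where N: "\<And>k z. N \<le> k \<Longrightarrow> h k z < e" using h_small by blast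
    have "dist (\<integral>y. g k y \<partial>P1 z) (\<integral>y. \<psi> y \<partial>P1 z) < e" if "N \<le> k" for k z
    proof -
      note ig = integrable_bounded_prob[OF P1s gm gb, of z k]
        and i\<psi> = integrable_bounded_prob[OF P1s \<psi>m \<psi>b, of z]
      have "\<bar>(\<integral>y. g k y \<partial>P1 z) - (\<integral>y. \<psi> y \<partial>P1 z)\<bar> = \<bar>\<integral>y. g k y - \<psi> y \<partial>P1 z\<bar>"
        using ig i\<psi> by simp
      also have "\<dots> \<le> (\<integral>y. \<bar>g k y - \<psi> y\<bar> \<partial>P1 z)" by (rule integral_abs_bound)
      also have "\<dots> \<le> h k z" unfolding h_def
        using ig i\<psi> \<Psi>_ge by (intro integral_mono integrable_bounded_prob[OF P1s \<Psi>m \<Psi>b]) auto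
      also have "\<dots> < e" using N that .
      finally show ?thesis by (simp add: dist_real_def)
    qed
    then show "\<forall>\<^sub>F n in sequentially. \<forall>z\<in>UNIV. dist (\<integral>y. g n y \<partial>P1 z) (\<integral>y. \<psi> y \<partial>P1 z) < e"
      by (auto simp: eventually_sequentially)
  qed
  then show ?thesis using that[OF r(1) \<psi>m \<psi>b] by (simp add: g_def)
qed

section \<open>Birkhoff averages and ergodic components\<close>

text \<open>The maximum of the sums \<open>\<Sum>j<n. \<psi> (F\<^sup>j x)\<close> over \<open>n \<le> N\<close>, in the recursive form
  in which Garsia's proof of the maximal ergodic inequality uses it.\<close>

primrec garsia_max :: "('a \<Rightarrow> 'a) \<Rightarrow> ('a \<Rightarrow> real) \<Rightarrow> nat \<Rightarrow> 'a \<Rightarrow> real" where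
  "garsia_max F \<psi> 0 x = 0"
| "garsia_max F \<psi> (Suc N) x = max 0 (\<psi> x + garsia_max F \<psi> N (F x))"

lemma garsia_max_nonneg: "0 \<le> garsia_max F \<psi> N x"
  by (cases N) auto

lemma garsia_max_mono: "garsia_max F \<psi> N x \<le> garsia_max F \<psi> (Suc N) x"
proof (induction N arbitrary: x)
  case (Suc N)
  show ?case using Suc[of "F x"] by (simp only: garsia_max.simps(2)[of F \<psi> N x] garsia_max.simps(2)[of F \<psi> "Suc N" x])
qed simp

lemma sum_le_garsia_max: "(\<Sum>j<n. \<psi> ((F ^^ j) x)) \<le> garsia_max F \<psi> n x"
proof (induction n arbitrary: x)
  case (Suc n)
  have "(\<Sum>j<Suc n. \<psi> ((F ^^ j) x)) = \<psi> x + (\<Sum>j<n. \<psi> ((F ^^ j) (F x)))"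
    by (subst sum.lessThan_Suc_shift) (simp add: funpow_swap1)
  then show ?case using Suc[of "F x"] by simp
qed simp

lemma measurable_funpow:
  assumes "F \<in> M \<rightarrow>\<^sub>M M" shows "F ^^ n \<in> M \<rightarrow>\<^sub>M M"
  using assms by (induction n) (auto intro: measurable_comp)

text \<open>The maximal ergodic inequality. Where \<open>garsia_max F \<psi> N\<close> is positive, it is at most \<open>\<psi>\<close> plus its
  composition with \<open>F\<close>; integrating, and using invariance, \<open>\<psi>\<close> has nonnegative integral over that set.
  The sets increase to the whole space.\<close>

lemma integral_pos_of_positive_sums:
  fixes \<psi> :: "'a \<Rightarrow> real"
  assumes M: "prob_space M" and F: "invariant_measure F M"
    and [measurable]: "\<psi> \<in> borel_measurable M" and bd: "\<And>x. \<bar>\<psi> x\<bar> \<le> C"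
    and pos: "AE x in M. \<exists>n. 0 < (\<Sum>j<n. \<psi> ((F ^^ j) x))"
  shows "0 \<le> (\<integral>x. \<psi> x \<partial>M)"
proof -
  interpret prob_space M by fact
  have F_meas[measurable]: "F \<in> M \<rightarrow>\<^sub>M M" and F_inv: "distr M M F = M"
    using F by (auto simp: invariant_measure_def)
  define G where "G = garsia_max F \<psi>"
  have G_nonneg: "0 \<le> G N x" and G_mono: "G N x \<le> G (Suc N) x" for N x
    unfolding G_def by (rule garsia_max_nonneg, rule garsia_max_mono)
  have Gm[measurable]: "G N \<in> borel_measurable M" for N
    unfolding G_def by (induction N) simp_all
  have C: "0 \<le> C" using bd[of undefined] by linarith
  have Gb: "G N x \<le> real N * C" for N x
  proof (induction N arbitrary: x)
    case (Suc N)
    have "\<psi> x \<le> C" using bd[of x] by linarith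
    then show ?case using Suc[of "F x"] C by (simp add: G_def algebra_simps)
  qed (simp add: G_def)
  have iG: "integrable M (G N)" for N
    using Gb G_nonneg by (intro integrable_const_bound[where B = "real N * C"]) auto
  have iGF: "integrable M (\<lambda>x. G N (F x))" for N
    using Gb G_nonneg by (intro integrable_const_bound[where B = "real N * C"]) auto
  have eqGF: "(\<integral>x. G N (F x) \<partial>M) = (\<integral>x. G N x \<partial>M)" for N
    using integral_distr[of F M M "G N"] F_inv by simp
  define E where "E N = {x \<in> space M. 0 < G N x}" for N
  have [measurable]: "E N \<in> sets M" for N unfolding E_def by measurable
  have i\<psi>: "integrable M \<psi>" using bd by (intro integrable_const_bound[where B = C]) auto
  have i\<psi>E: "integrable M (\<lambda>x. \<psi> x * indicator (E N) x)" for N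
    using integrable_real_mult_indicator[OF _ i\<psi>, of "E N"] by simp
  have nonneg: "0 \<le> (\<integral>x. \<psi> x * indicator (E N) x \<partial>M)" for N
  proof -
    have "0 = (\<integral>x. G N x - G N (F x) \<partial>M)" using iG iGF eqGF by simp
    also have "\<dots> \<le> (\<integral>x. \<psi> x * indicator (E N) x \<partial>M)"
    proof (rule integral_mono)
      fix x assume x: "x \<in> space M"
      show "G N x - G N (F x) \<le> \<psi> x * indicator (E N) x"
      proof (cases "0 < G N x")
        case True
        then obtain N' where N: "N = Suc N'" by (cases N) (auto simp: G_def)
        with True have "G N x = \<psi> x + G N' (F x)" by (auto simp: G_def max_def split: if_splits)
        with True x G_mono[of N' "F x"] show ?thesis by (simp add: N E_def)
      next
        case False
        with x G_nonneg[of N "F x"] show ?thesis by (simp add: E_def)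
      qed
    qed (use iG iGF i\<psi>E in auto)
    finally show ?thesis .
  qed
  have "(\<lambda>N. \<integral>x. \<psi> x * indicator (E N) x \<partial>M) \<longlonglongrightarrow> (\<integral>x. \<psi> x \<partial>M)"
  proof (rule integral_dominated_convergence[where w = "\<lambda>_. C"])
    show "AE x in M. (\<lambda>N. \<psi> x * indicator (E N) x) \<longlonglongrightarrow> \<psi> x"
      using pos AE_space
    proof eventually_elim
      case (elim x)
      then obtain n where "0 < (\<Sum>j<n. \<psi> ((F ^^ j) x))" by blast
      also have "\<dots> \<le> G n x" unfolding G_def by (rule sum_le_garsia_max)
      finally have n: "0 < G n x" .
      have "x \<in> E N" if "n \<le> N" for N
        using lift_Suc_mono_le[of "\<lambda>N. G N x", OF G_mono that] n elim by (simp add: E_def)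
      then have "\<forall>\<^sub>F N in sequentially. \<psi> x * indicator (E N) x = \<psi> x"
        unfolding eventually_sequentially by (intro exI[of _ n]) auto
      then show ?case by (rule tendsto_eventually)
    qed
    show "AE x in M. norm (\<psi> x * indicator (E N) x) \<le> C" for N
      using bd C by (auto simp: indicator_def)
  qed auto
  then show ?thesis using nonneg by (intro LIMSEQ_le_const) auto
qed

definition birkhoff_average :: "('a \<Rightarrow> 'a) \<Rightarrow> ('a \<Rightarrow> real) \<Rightarrow> nat \<Rightarrow> 'a \<Rightarrow> real" where
  "birkhoff_average F \<phi> n z = (1 / real n) * (\<Sum>j<n. \<phi> ((F ^^ j) z))"

text \<open>What makes upper limits and basins invariant.\<close>

lemma birkhoff_average_step:
  assumes bd: "\<And>x. \<bar>\<phi> x\<bar> \<le> C"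
  shows "(\<lambda>n. birkhoff_average F \<phi> n (F z) - birkhoff_average F \<phi> (Suc n) z) \<longlonglongrightarrow> 0"
proof (rule Lim_null_comparison[where g = "\<lambda>n. 2 * C * inverse (real (Suc n))"])
  show "\<forall>\<^sub>F n in sequentially. norm (birkhoff_average F \<phi> n (F z) - birkhoff_average F \<phi> (Suc n) z)
      \<le> 2 * C * inverse (real (Suc n))"
  proof (rule eventually_sequentiallyI[of 1])
    fix n :: nat assume n: "1 \<le> n"
    define s where "s = (\<Sum>j<n. \<phi> ((F ^^ j) (F z)))"
    have "\<bar>s\<bar> \<le> (\<Sum>j<n. \<bar>\<phi> ((F ^^ j) (F z))\<bar>)" unfolding s_def by (rule sum_abs)
    also have "\<dots> \<le> real n * C" using sum_bounded_above[of "{..<n}" "\<lambda>j. \<bar>\<phi> ((F ^^ j) (F z))\<bar>" C] bd by simp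
    finally have s: "\<bar>s / n\<bar> \<le> C" using n by (simp add: field_simps)
    have "(\<Sum>j<Suc n. \<phi> ((F ^^ j) z)) = \<phi> z + s"
      unfolding s_def by (subst sum.lessThan_Suc_shift) (simp add: funpow_swap1)
    then have "birkhoff_average F \<phi> n (F z) - birkhoff_average F \<phi> (Suc n) z = s / n - (\<phi> z + s) / Suc n"
      by (simp add: birkhoff_average_def s_def)
    also have "\<dots> = (s / n - \<phi> z) / Suc n" using n by (simp add: field_simps)
    finally have "norm (birkhoff_average F \<phi> n (F z) - birkhoff_average F \<phi> (Suc n) z) = \<bar>s / n - \<phi> z\<bar> / Suc n"
      by simp
    also have "\<dots> \<le> (2 * C) / Suc n"
      using abs_triangle_ineq4[of "s / n" "\<phi> z"] s bd[of z] by (intro divide_right_mono) linarith+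
    finally show "norm (birkhoff_average F \<phi> n (F z) - birkhoff_average F \<phi> (Suc n) z)
      \<le> 2 * C * inverse (real (Suc n))" by (simp add: divide_inverse)
  qed
  show "(\<lambda>n. 2 * C * inverse (real (Suc n))) \<longlonglongrightarrow> 0"
    by (intro tendsto_mult_right_zero LIMSEQ_inverse_real_of_nat)
qed

lemma birkhoff_basin_invariant:
  assumes bd: "\<And>x. \<bar>\<phi> x\<bar> \<le> C"
  shows "F -` birkhoff_basin F \<mu> \<phi> = birkhoff_basin F \<mu> \<phi>"
proof -
  have "(\<lambda>n. birkhoff_average F \<phi> n (F z)) \<longlonglongrightarrow> c \<longleftrightarrow> (\<lambda>n. birkhoff_average F \<phi> n z) \<longlonglongrightarrow> c" for z c
  proof -
    have "(\<lambda>n. birkhoff_average F \<phi> n (F z)) \<longlonglongrightarrow> c \<longleftrightarrow> (\<lambda>n. birkhoff_average F \<phi> (Suc n) z) \<longlonglongrightarrow> c"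
      using Lim_transform[OF _ birkhoff_average_step[of \<phi> C F z, OF bd]]
        Lim_transform2[OF _ birkhoff_average_step[of \<phi> C F z, OF bd]] by blast
    then show ?thesis by (simp add: filterlim_sequentially_Suc[of "\<lambda>n. birkhoff_average F \<phi> n z"])
  qed
  then show ?thesis unfolding birkhoff_basin_def birkhoff_average_def by auto
qed

text \<open>The set where the upper limit is at least \<open>a\<close> is invariant, so its measure is 0 or 1. If it were 1,
  almost every orbit would at some time have an average above some \<open>b\<close> strictly between the integral
  and \<open>a\<close>, which contradicts the maximal ergodic inequality for \<open>\<phi> - b\<close>.\<close>

lemma ergodic_limsup_le:
  fixes \<phi> :: "'a \<Rightarrow> real"
  assumes erg: "ergodic_measure F M" and sp: "space M = UNIV"
    and [measurable]: "\<phi> \<in> borel_measurable M" and bd: "\<And>x. \<bar>\<phi> x\<bar> \<le> C"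
    and a: "(\<integral>x. \<phi> x \<partial>M) < a"
  shows "AE x in M. \<forall>\<^sub>F n in sequentially. birkhoff_average F \<phi> n x < a"
proof -
  have M: "prob_space M" and inv: "invariant_measure F M"
    and erg0: "\<And>A. A \<in> sets M \<Longrightarrow> F -` A = A \<Longrightarrow> emeasure M A = 0 \<or> emeasure M A = 1"
    using erg sp by (auto simp: ergodic_measure_def)
  interpret prob_space M by fact
  have F_meas[measurable]: "F \<in> M \<rightarrow>\<^sub>M M" using inv by (simp add: invariant_measure_def)
  note measurable_funpow[OF F_meas, measurable]
  have Am[measurable]: "birkhoff_average F \<phi> n \<in> borel_measurable M" for n
    unfolding birkhoff_average_def by measurable
  \<comment> \<open>the points whose upper Birkhoff limit is at least \<open>a\<close>\<close>
  define W where "W = {x \<in> space M. \<forall>k m. \<exists>n\<ge>m. a - 1 / real (Suc k) < birkhoff_average F \<phi> n x}"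
  have Wm[measurable]: "W \<in> sets M" unfolding W_def by measurable
  have W_iff: "x \<in> W \<longleftrightarrow> (\<forall>e>0. \<exists>\<^sub>F n in sequentially. a - e < birkhoff_average F \<phi> n x)" for x
  proof
    assume x: "x \<in> W"
    show "\<forall>e>0. \<exists>\<^sub>F n in sequentially. a - e < birkhoff_average F \<phi> n x"
    proof (intro allI impI)
      fix e :: real assume "0 < e"
      then obtain k where "inverse (real (Suc k)) < e" using reals_Archimedean by blast
      then have k: "1 / real (Suc k) < e" by (simp add: inverse_eq_divide)
      show "\<exists>\<^sub>F n in sequentially. a - e < birkhoff_average F \<phi> n x"
        unfolding frequently_sequentially
      proof
        fix m obtain n where "n \<ge> m" "a - 1 / real (Suc k) < birkhoff_average F \<phi> n x"
          using x unfolding W_def by blast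
        then show "\<exists>n\<ge>m. a - e < birkhoff_average F \<phi> n x" using k by (intro exI[of _ n]) linarith
      qed
    qed
  next
    assume "\<forall>e>0. \<exists>\<^sub>F n in sequentially. a - e < birkhoff_average F \<phi> n x"
    then show "x \<in> W" unfolding W_def frequently_sequentially using sp by simp
  qed
  have freq_close: "\<forall>e>0. \<exists>\<^sub>F n in sequentially. a - e < v n"
    if u: "\<forall>e>0. \<exists>\<^sub>F n in sequentially. a - e < u n" and uv: "(\<lambda>n. u n - v n) \<longlonglongrightarrow> 0" for u v :: "nat \<Rightarrow> real"
  proof (intro allI impI)
    fix e :: real assume e: "0 < e"
    then have "\<exists>\<^sub>F n in sequentially. a - e / 2 < u n" using u by simp
    moreover have "\<forall>\<^sub>F n in sequentially. u n - v n < e / 2" by (rule order_tendstoD(2)[OF uv]) (use e in simp)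
    ultimately have "\<exists>\<^sub>F n in sequentially. a - e / 2 < u n \<and> u n - v n < e / 2"
      by (subst conj_commute) (rule frequently_eventually_conj)
    then show "\<exists>\<^sub>F n in sequentially. a - e < v n"
      by (rule frequently_mono[rotated]) (auto simp: field_simps)
  qed
  have W_inv: "F -` W = W"
  proof -
    have "F x \<in> W \<longleftrightarrow> x \<in> W" for x
    proof -
      note st = birkhoff_average_step[of \<phi> C F x, OF bd]
      have st': "(\<lambda>n. birkhoff_average F \<phi> (Suc n) x - birkhoff_average F \<phi> n (F x)) \<longlonglongrightarrow> 0"
        using tendsto_minus[OF st] by simp
      have "F x \<in> W \<longleftrightarrow> (\<forall>e>0. \<exists>\<^sub>F n in sequentially. a - e < birkhoff_average F \<phi> (Suc n) x)"
        unfolding W_iff using freq_close[OF _ st] freq_close[OF _ st'] by blast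
      also have "\<dots> \<longleftrightarrow> x \<in> W"
        unfolding W_iff frequently_def
        using eventually_sequentially_Suc[of "\<lambda>n. \<not> a - _ < birkhoff_average F \<phi> n x"] by simp
      finally show ?thesis .
    qed
    then show ?thesis by auto
  qed
  have "emeasure M W \<noteq> 1"
  proof
    assume "emeasure M W = 1"
    then have AEW: "AE x in M. x \<in> W" using AE_in_set_eq_1[OF Wm] by (simp add: emeasure_eq_measure)
    \<comment> \<open>any value strictly between the integral and \<open>a\<close> would do\<close>
    define b where "b = ((\<integral>x. \<phi> x \<partial>M) + a) / 2"
    have b: "(\<integral>x. \<phi> x \<partial>M) < b" "b < a" using a by (auto simp: b_def)
    have "0 \<le> (\<integral>x. \<phi> x - b \<partial>M)"
    proof (rule integral_pos_of_positive_sums[OF M inv])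
      show "\<bar>\<phi> x - b\<bar> \<le> C + \<bar>b\<bar>" for x using bd[of x] by linarith
      show "AE x in M. \<exists>n. 0 < (\<Sum>j<n. \<phi> ((F ^^ j) x) - b)"
        using AEW
      proof eventually_elim
        case (elim x)
        have "\<exists>\<^sub>F n in sequentially. a - (a - b) < birkhoff_average F \<phi> n x"
          using elim[unfolded W_iff, rule_format, of "a - b"] b by simp
        then obtain n where n: "1 \<le> n" "b < birkhoff_average F \<phi> n x"
          unfolding frequently_sequentially by auto
        then have "real n * b < (\<Sum>j<n. \<phi> ((F ^^ j) x))"
          by (simp add: birkhoff_average_def field_simps)
        then show ?case by (intro exI[of _ n]) (simp add: sum_subtractf)
      qed
    qed measurable
    moreover have "integrable M \<phi>" using bd by (intro integrable_const_bound[where B = C]) auto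
    ultimately show False using b by (simp add: prob_space)
  qed
  then have "emeasure M W = 0" using erg0[OF Wm W_inv] by simp
  then have "AE x in M. x \<notin> W" by (intro AE_not_in) (auto intro: null_setsI)
  then show ?thesis
  proof eventually_elim
    case (elim x)
    then obtain e where e: "0 < e" "\<not> (\<exists>\<^sub>F n in sequentially. a - e < birkhoff_average F \<phi> n x)"
      unfolding W_iff by blast
    then have "\<forall>\<^sub>F n in sequentially. birkhoff_average F \<phi> n x \<le> a - e"
      by (simp add: frequently_def not_less)
    then show ?case by (rule eventually_mono) (use e in linarith)
  qed
qed

lemma birkhoff_ergodic:
  fixes \<phi> :: "'a \<Rightarrow> real"
  assumes erg: "ergodic_measure F M" and sp: "space M = UNIV"
    and \<phi>: "\<phi> \<in> borel_measurable M" and bd: "\<And>x. \<bar>\<phi> x\<bar> \<le> C"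
  shows "AE x in M. x \<in> birkhoff_basin F M \<phi>"
proof -
  define I where "I = (\<integral>x. \<phi> x \<partial>M)"
  have "AE x in M. \<forall>k. \<forall>\<^sub>F n in sequentially. birkhoff_average F \<phi> n x < I + inverse (real (Suc k))"
    unfolding AE_all_countable
    by (intro allI ergodic_limsup_le[OF erg sp \<phi> bd]) (simp add: I_def)
  moreover have "AE x in M. \<forall>k. \<forall>\<^sub>F n in sequentially.
      birkhoff_average F (\<lambda>x. - \<phi> x) n x < - I + inverse (real (Suc k))"
    unfolding AE_all_countable
    by (intro allI ergodic_limsup_le[OF erg sp, of _ C]) (use \<phi> bd in \<open>auto simp: I_def\<close>)
  ultimately show ?thesis
  proof eventually_elim
    case (elim x)
    have neg: "birkhoff_average F (\<lambda>x. - \<phi> x) n x = - birkhoff_average F \<phi> n x" for n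
      by (simp add: birkhoff_average_def sum_negf)
    have "(\<lambda>n. birkhoff_average F \<phi> n x) \<longlonglongrightarrow> I"
    proof (rule tendstoI)
      fix e :: real assume "0 < e"
      then obtain k where k: "inverse (real (Suc k)) < e" using reals_Archimedean by blast
      from elim(1)[rule_format, of k] elim(2)[rule_format, of k]
      show "\<forall>\<^sub>F n in sequentially. dist (birkhoff_average F \<phi> n x) I < e"
        by eventually_elim (use k in \<open>auto simp: neg dist_real_def abs_less_iff\<close>)
    qed
    then show ?case by (simp add: birkhoff_basin_def birkhoff_average_def I_def)
  qed
qed

definition invariant_sets :: "('a \<Rightarrow> 'a) \<Rightarrow> 'a measure \<Rightarrow> 'a set set" where
  "invariant_sets F M = {A \<in> sets M. F -` A \<inter> space M = A}"

lemma invariant_sets_Int: "A \<in> invariant_sets F M \<Longrightarrow> B \<in> invariant_sets F M \<Longrightarrow> A \<inter> B \<in> invariant_sets F M"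
  by (auto simp: invariant_sets_def)

lemma invariant_sets_Diff: "A \<in> invariant_sets F M \<Longrightarrow> B \<in> invariant_sets F M \<Longrightarrow> A - B \<in> invariant_sets F M"
  unfolding invariant_sets_def by blast

text \<open>Split \<open>D\<close> until no set can be split. Each piece loses at least \<open>v\<close> of the measure of its parent, so
  the splitting stops.\<close>

lemma finite_invariant_atoms:
  assumes M: "prob_space M"
    and v: "0 < v" "\<And>A. A \<in> invariant_sets F M \<Longrightarrow> measure M A = 0 \<or> v \<le> measure M A"
    and D: "D \<in> invariant_sets F M"
  shows "\<exists>\<A>. finite \<A> \<and> \<A> \<subseteq> invariant_sets F M \<and> measure M (D - \<Union>\<A>) = 0 \<and>
    (\<forall>A\<in>\<A>. 0 < measure M A \<and>
      (\<forall>B\<in>invariant_sets F M. measure M (A \<inter> B) = 0 \<or> measure M (A - B) = 0))"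
  using D
proof (induction "nat \<lfloor>measure M D / v\<rfloor>" arbitrary: D rule: less_induct)
  case (less D)
  interpret prob_space M by fact
  have sets: "A \<in> sets M" if "A \<in> invariant_sets F M" for A using that by (simp add: invariant_sets_def)
  consider "measure M D = 0" | "0 < measure M D" "\<forall>B\<in>invariant_sets F M. measure M (D \<inter> B) = 0 \<or> measure M (D - B) = 0"
    | B where "B \<in> invariant_sets F M" "measure M (D \<inter> B) \<noteq> 0" "measure M (D - B) \<noteq> 0"
    using zero_less_measure_iff by blast
  then show ?case
  proof cases
    case 1
    then show ?thesis by (intro exI[of _ "{}"]) auto
  next
    case 2
    then show ?thesis using less(2) by (intro exI[of _ "{D}"]) auto
  next
    case 3
    have I: "D \<inter> B \<in> invariant_sets F M" "D - B \<in> invariant_sets F M"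
      using less(2) 3 by (auto intro: invariant_sets_Int invariant_sets_Diff)
    have ge: "v \<le> measure M (D \<inter> B)" "v \<le> measure M (D - B)" using v(2) I 3 by auto
    have "measure M D = measure M (D \<inter> B) + measure M (D - B)"
      using finite_measure_Union[of "D \<inter> B" "D - B"] sets[OF I(1)] sets[OF I(2)]
      by (metis Diff_disjoint Int_Diff Int_Diff_Un inf_commute inf_bot_right)
    then have "measure M (D \<inter> B) / v + 1 \<le> measure M D / v" "measure M (D - B) / v + 1 \<le> measure M D / v"
      using ge v(1) by (auto simp: field_simps)
    moreover have "0 \<le> measure M (D \<inter> B) / v" "0 \<le> measure M (D - B) / v" using v(1) by auto
    ultimately have "nat \<lfloor>measure M (D \<inter> B) / v\<rfloor> < nat \<lfloor>measure M D / v\<rfloor>"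
      "nat \<lfloor>measure M (D - B) / v\<rfloor> < nat \<lfloor>measure M D / v\<rfloor>" by linarith+
    from less(1)[OF this(1) I(1)] less(1)[OF this(2) I(2)] obtain \<A> \<A>' where
      \<A>: "finite \<A>" "\<A> \<subseteq> invariant_sets F M" "measure M (D \<inter> B - \<Union>\<A>) = 0"
        "\<forall>A\<in>\<A>. 0 < measure M A \<and>
          (\<forall>B\<in>invariant_sets F M. measure M (A \<inter> B) = 0 \<or> measure M (A - B) = 0)" and
      \<A>': "finite \<A>'" "\<A>' \<subseteq> invariant_sets F M" "measure M (D - B - \<Union>\<A>') = 0"
        "\<forall>A\<in>\<A>'. 0 < measure M A \<and>
          (\<forall>B\<in>invariant_sets F M. measure M (A \<inter> B) = 0 \<or> measure M (A - B) = 0)"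
      by metis
    have S: "\<Union>\<A> \<in> sets M" "\<Union>\<A>' \<in> sets M"
      using \<A> \<A>' sets by (auto intro!: sets.finite_Union)
    have "measure M (D - \<Union>(\<A> \<union> \<A>')) \<le> measure M ((D \<inter> B - \<Union>\<A>) \<union> (D - B - \<Union>\<A>'))"
      using S sets[OF I(1)] sets[OF I(2)] by (intro finite_measure_mono) auto
    also have "\<dots> \<le> measure M (D \<inter> B - \<Union>\<A>) + measure M (D - B - \<Union>\<A>')"
      using S sets[OF I(1)] sets[OF I(2)] by (intro measure_Un_le) auto
    finally have "measure M (D - \<Union>(\<A> \<union> \<A>')) = 0" using \<A>(3) \<A>'(3)
      by (simp add: measure_le_0_iff)
    then show ?thesis using \<A> \<A>' by (intro exI[of _ "\<A> \<union> \<A>'"]) blast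
  qed
qed

section \<open>The Markov measure with a given first letter\<close>

abbreviation paths :: "(nat \<Rightarrow> 't::topological_space) measure" where
  "paths \<equiv> Pi\<^sub>M UNIV (\<lambda>_. borel)"

definition cylinders :: "(nat \<Rightarrow> 't::topological_space) set set" where
  "cylinders = {{\<omega>. \<forall>i<n. \<omega> i \<in> B i} | B n. \<forall>i. B i \<in> sets borel}"

lemma cylindersI: "(\<And>i. B i \<in> sets borel) \<Longrightarrow> {\<omega>. \<forall>i<n. \<omega> i \<in> B i} \<in> cylinders"
  unfolding cylinders_def by (intro CollectI exI[of _ B] exI[of _ n]) simp

lemma cylindersE:
  assumes "A \<in> cylinders"
  obtains B n where "\<And>i. B i \<in> sets borel" "A = {\<omega>. \<forall>i<n. \<omega> i \<in> B i}"
proof -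
  have "\<exists>B n. A = {\<omega>. \<forall>i<n. \<omega> i \<in> B i} \<and> (\<forall>i. B i \<in> sets borel)"
    using assms unfolding cylinders_def by (rule CollectD)
  then show ?thesis by (elim exE conjE) (erule that[rotated], elim spec)
qed

lemma space_paths: "space (paths :: (nat \<Rightarrow> 't::topological_space) measure) = UNIV"
  by (simp add: space_PiM)

lemma cylinder_sets:
  fixes B :: "nat \<Rightarrow> 't::topological_space set"
  assumes [measurable]: "\<And>i. B i \<in> sets borel"
  shows "{\<omega>. \<forall>i<n. \<omega> i \<in> B i} \<in> sets paths"
proof -
  have "{\<omega> \<in> space paths. \<forall>i\<in>{..<n}. \<omega> i \<in> B i} \<in> sets (paths :: (nat \<Rightarrow> 't) measure)"
    by measurable
  moreover have "{\<omega> \<in> space paths. \<forall>i\<in>{..<n}. \<omega> i \<in> B i} = {\<omega>. \<forall>i<n. \<omega> i \<in> B i}"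
    by (auto simp: space_paths)
  ultimately show ?thesis by simp
qed

lemma Int_stable_cylinders: "Int_stable cylinders"
proof (rule Int_stableI)
  fix a b :: "(nat \<Rightarrow> 'a) set" assume *: "a \<in> cylinders" "b \<in> cylinders"
  obtain B n where B: "\<And>i. B i \<in> sets borel" and a: "a = {\<omega>. \<forall>i<n. \<omega> i \<in> B i}"
    by (rule cylindersE[OF *(1)]) (rule that)
  obtain B' n' where B': "\<And>i. B' i \<in> sets borel" and b: "b = {\<omega>. \<forall>i<n'. \<omega> i \<in> B' i}"
    by (rule cylindersE[OF *(2)]) (rule that)
  define B'' where "B'' i = (if i < n then B i else UNIV) \<inter> (if i < n' then B' i else UNIV)" for i
  have "a \<inter> b = {\<omega>. \<forall>i<max n n'. \<omega> i \<in> B'' i}"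
    unfolding a b B''_def by (auto simp: less_max_iff_disj)
  moreover have "B'' i \<in> sets borel" for i using B B' by (auto simp: B''_def)
  ultimately show "a \<inter> b \<in> cylinders" by (simp add: cylindersI)
qed

lemma sets_paths_cylinders: "sets paths = sigma_sets UNIV cylinders"
proof
  show "sigma_sets UNIV cylinders \<subseteq> sets (paths :: (nat \<Rightarrow> 'a) measure)"
  proof -
    have "cylinders \<subseteq> sets (paths :: (nat \<Rightarrow> 'a) measure)"
      using cylinder_sets by (auto elim!: cylindersE)
    from sets.sigma_sets_subset[OF this] show ?thesis by (simp add: space_paths)
  qed
  have "{\<omega>. \<omega> i \<in> A} \<in> cylinders" if "A \<in> sets borel" for i and A :: "'a set"
  proof -
    have "{\<omega>. \<omega> i \<in> A} = {\<omega>. \<forall>j<Suc i. \<omega> j \<in> (if j = i then A else UNIV)}"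
      by auto
    also have "\<dots> \<in> cylinders" using that by (intro cylindersI) simp
    finally show ?thesis .
  qed
  then show "sets (paths :: (nat \<Rightarrow> 'a) measure) \<subseteq> sigma_sets UNIV cylinders"
    unfolding sets_PiM_single by (simp only: space_borel PiE_UNIV_domain) (auto intro!: sigma_sets_mono')
qed

lemma paths_measure_eqI:
  fixes M N :: "(nat \<Rightarrow> 't::topological_space) measure"
  assumes M: "M \<in> space (prob_algebra paths)" "N \<in> space (prob_algebra paths)"
    and eq: "\<And>B n. (\<And>i. B i \<in> sets borel) \<Longrightarrow>
      emeasure M {\<omega>. \<forall>i<n. \<omega> i \<in> B i} = emeasure N {\<omega>. \<forall>i<n. \<omega> i \<in> B i}"
  shows "M = N"
proof (rule measure_eqI_generator_eq[OF Int_stable_cylinders, of UNIV _ _ "\<lambda>_. UNIV"])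
  show "emeasure M X = emeasure N X" if "X \<in> cylinders" for X
    using that eq by (auto elim: cylindersE)
  show "sets M = sigma_sets UNIV cylinders" "sets N = sigma_sets UNIV cylinders"
    using M sets_paths_cylinders by (auto simp: space_prob_algebra)
  have "(UNIV :: (nat \<Rightarrow> 't) set) \<in> cylinders"
    using cylindersI[of "\<lambda>_. UNIV" 0] by simp
  then show "range (\<lambda>_::nat. UNIV) \<subseteq> (cylinders :: (nat \<Rightarrow> 't) set set)" by simp
  interpret prob_space M using M by (simp add: space_prob_algebra)
  show "emeasure M UNIV \<noteq> \<infinity>" by simp
qed simp_all

locale markov_kernel =
  fixes Q :: "'t::topological_space \<Rightarrow> 't measure"
  assumes Q[measurable]: "Q \<in> borel \<rightarrow>\<^sub>M prob_algebra borel"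
begin

lemma measurable_cylinder_integral:
  assumes "set As \<subseteq> sets borel"
  shows "cylinder_integral Q As \<in> borel_measurable (subprob_algebra borel)"
    and "(\<lambda>t. cylinder_integral Q As (Q t)) \<in> borel_measurable borel"
proof -
  show *: "cylinder_integral Q As \<in> borel_measurable (subprob_algebra borel)"
    using assms
  proof (induction As)
    case Nil
    have "cylinder_integral Q [] = (\<lambda>_. 1)" by auto
    then show ?case by simp
  next
    case (Cons A As)
    then have [measurable]: "cylinder_integral Q As \<in> borel_measurable (subprob_algebra borel)" "A \<in> sets borel"
      by auto
    have [measurable]: "(\<lambda>t. cylinder_integral Q As (Q t)) \<in> borel_measurable borel"
      by (rule measurable_compose[OF measurable_prob_algebraD[OF Q]]) simp
    have "(\<lambda>M. \<integral>\<^sup>+t. cylinder_integral Q As (Q t) * indicator A t \<partial>M) \<in> borel_measurable (subprob_algebra borel)"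
      by measurable
    moreover have "cylinder_integral Q (A # As) = (\<lambda>M. \<integral>\<^sup>+t. cylinder_integral Q As (Q t) * indicator A t \<partial>M)"
      by auto
    ultimately show ?case by simp
  qed
  show "(\<lambda>t. cylinder_integral Q As (Q t)) \<in> borel_measurable borel"
    by (rule measurable_compose[OF measurable_prob_algebraD[OF Q] *])
qed

text \<open>The theorem of Ionescu-Tulcea, for the kernels that ignore all but the last letter.
  Only its finite-dimensional formula needs translation: \<^const>\<open>cylinder_integral\<close> peels off the first
  letter, whereas the construction appends the last one.\<close>

lemma ex_path_measure:
  assumes M0: "M0 \<in> space (prob_algebra borel)"
  shows "\<exists>L. L \<in> space (prob_algebra paths) \<and> (\<forall>B n. (\<forall>i. B i \<in> sets borel) \<longrightarrow>
    emeasure L {\<omega>. \<forall>i<n. \<omega> i \<in> B i} = cylinder_integral Q (map B [0..<n]) M0)"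
proof -
  define P where "P = (\<lambda>i (\<omega> :: nat \<Rightarrow> 't). if i = (0::nat) then M0 else Q (\<omega> (i - 1)))"
  have Pm: "P i \<in> Pi\<^sub>M {0..<i} (\<lambda>_. borel) \<rightarrow>\<^sub>M prob_algebra borel" for i
  proof (cases i)
    case 0
    then show ?thesis using M0 by (simp add: P_def)
  next
    case (Suc j)
    then have "(\<lambda>\<omega>. Q (\<omega> j)) \<in> Pi\<^sub>M {0..<i} (\<lambda>_. borel) \<rightarrow>\<^sub>M prob_algebra borel"
      by (intro measurable_compose[OF measurable_component_singleton[of j] Q]) auto
    with Suc show ?thesis by (simp add: P_def)
  qed
  interpret IT: Ionescu_Tulcea P "\<lambda>_. borel"
    by (intro Ionescu_Tulcea.intro measurable_prob_algebraD[OF Pm] kernel_prob(1)[OF Pm])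
  have C: "emeasure (IT.C n l \<omega>) (Pi\<^sub>E {0..<n + l} B) =
      (if \<forall>i<n. \<omega> i \<in> B i then cylinder_integral Q (map B [n..<n + l]) (P n \<omega>) else 0)"
    if "\<And>i. B i \<in> sets borel" "\<omega> \<in> space (Pi\<^sub>M {0..<n} (\<lambda>_. borel))" for n l \<omega> and B :: "nat \<Rightarrow> 't set"
    using that
  proof (induction l arbitrary: n \<omega>)
    case 0
    have "Pi\<^sub>E {0..<n} B \<in> sets (Pi\<^sub>M {0..<n} (\<lambda>_. borel))" using 0 by (intro sets_PiM_I_finite) auto
    moreover have "\<omega> \<in> Pi\<^sub>E {0..<n} B \<longleftrightarrow> (\<forall>i<n. \<omega> i \<in> B i)"
      using 0(2) by (auto simp: space_PiM PiE_iff)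
    ultimately show ?case by (simp add: indicator_def)
  next
    case (Suc l)
    note \<omega> = Suc.prems(2)
    have Bs: "Pi\<^sub>E {0..<Suc n + l} B \<in> sets (Pi\<^sub>M {0..<Suc n + l} (\<lambda>_. borel))"
      using Suc by (intro sets_PiM_I_finite) auto
    have C1: "IT.C n 1 \<omega> = IT.eP n \<omega>"
      using \<omega> by (simp add: bind_return[OF IT.measurable_eP])
    have C_split: "IT.C n (Suc l) \<omega> = IT.eP n \<omega> \<bind> IT.C (Suc n) l"
      using IT.split_C[OF \<omega>, of 1 l] C1 by simp
    have upd: "fun_upd \<omega> n u \<in> space (Pi\<^sub>M {0..<Suc n} (\<lambda>_. borel))" for u
      using \<omega> by (auto simp: space_PiM PiE_iff extensional_def)
    have "emeasure (IT.C n (Suc l) \<omega>) (Pi\<^sub>E {0..<n + Suc l} B)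
        = (\<integral>\<^sup>+\<omega>'. emeasure (IT.C (Suc n) l \<omega>') (Pi\<^sub>E {0..<Suc n + l} B) \<partial>IT.eP n \<omega>)"
    proof -
      have ne: "space (IT.eP n \<omega>) \<noteq> {}" using prob_space.not_empty[OF IT.prob_space_eP[OF \<omega>]] .
      have meas: "IT.C (Suc n) l \<in> IT.eP n \<omega> \<rightarrow>\<^sub>M subprob_algebra (Pi\<^sub>M {0..<Suc n + l} (\<lambda>_. borel))"
        unfolding measurable_cong_sets[OF IT.sets_eP[OF \<omega>] refl] by (rule IT.measurable_C)
      have "n + Suc l = Suc n + l" by simp
      then show ?thesis unfolding C_split by (simp only: emeasure_bind[OF ne meas Bs])
    qed
    also have "\<dots> = (\<integral>\<^sup>+u. emeasure (IT.C (Suc n) l (fun_upd \<omega> n u)) (Pi\<^sub>E {0..<Suc n + l} B) \<partial>P n \<omega>)"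
      by (rule IT.nn_integral_eP[OF \<omega> measurable_compose[OF IT.measurable_C measurable_emeasure_subprob_algebra[OF Bs]]])
    also have "\<dots> = (\<integral>\<^sup>+u. (if \<forall>i<n. \<omega> i \<in> B i then
        cylinder_integral Q (map B [Suc n..<Suc n + l]) (Q u) * indicator (B n) u else 0) \<partial>P n \<omega>)"
    proof (rule nn_integral_cong)
      fix u
      have "P (Suc n) (fun_upd \<omega> n u) = Q u" by (simp add: P_def)
      moreover have "(\<forall>i<Suc n. fun_upd \<omega> n u i \<in> B i) \<longleftrightarrow> (\<forall>i<n. \<omega> i \<in> B i) \<and> u \<in> B n"
        by (auto simp: less_Suc_eq)
      ultimately show "emeasure (IT.C (Suc n) l (fun_upd \<omega> n u)) (Pi\<^sub>E {0..<Suc n + l} B) =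
          (if \<forall>i<n. \<omega> i \<in> B i then
            cylinder_integral Q (map B [Suc n..<Suc n + l]) (Q u) * indicator (B n) u else 0)"
        unfolding Suc.IH[OF Suc.prems(1) upd[of u]] by (auto simp del: upt_Suc fun_upd_apply)
    qed
    also have "\<dots> = (if \<forall>i<n. \<omega> i \<in> B i then cylinder_integral Q (map B [n..<n + Suc l]) (P n \<omega>) else 0)"
    proof -
      have "[n..<n + Suc l] = n # [Suc n..<Suc n + l]" by (simp add: upt_conv_Cons del: upt_Suc)
      then have "map B [n..<n + Suc l] = B n # map B [Suc n..<Suc n + l]" by (simp only: list.map)
      note eq = this
      show ?thesis
      proof (cases "\<forall>i<n. \<omega> i \<in> B i")
        case True
        show ?thesis unfolding eq if_P[OF True] cylinder_integral.simps ..
      next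
        case False
        show ?thesis unfolding if_not_P[OF False] by (simp only: nn_integral_const mult_zero_left)
      qed
    qed
    finally show ?case .
  qed
  define L where "L = IT.PF.lim"
  have cyl: "emeasure L {\<omega>. \<forall>i<n. \<omega> i \<in> B i} = cylinder_integral Q (map B [0..<n]) M0"
    if B: "\<forall>i. B i \<in> sets borel" for B n
  proof -
    have Bs: "Pi\<^sub>E {0..<n} B \<in> sets (Pi\<^sub>M {0..<n} (\<lambda>_. borel))"
      using B by (intro sets_PiM_I_finite) auto
    have "{\<omega>. \<forall>i<n. \<omega> i \<in> B i} = prod_emb UNIV (\<lambda>_. borel) {0..<n} (Pi\<^sub>E {0..<n} B)"
      by (auto simp: prod_emb_def space_PiM PiE_iff)
    then have "emeasure L {\<omega>. \<forall>i<n. \<omega> i \<in> B i} = emeasure (IT.CI {0..<n}) (Pi\<^sub>E {0..<n} B)"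
      unfolding L_def using IT.lim[OF _ Bs] by simp
    also have "\<dots> = emeasure (IT.C 0 n (\<lambda>_. undefined)) (Pi\<^sub>E {0..<n} B)"
    proof -
      have "prod_emb {0..<n} (\<lambda>_. borel) {0..<n} (Pi\<^sub>E {0..<n} B) = Pi\<^sub>E {0..<n} B"
        using sets.sets_into_space[OF Bs] by (intro prod_emb_id) (auto simp: space_PiM)
      then show ?thesis using IT.emeasure_CI[OF subset_refl Bs] by simp
    qed
    also have "\<dots> = cylinder_integral Q (map B [0..<n]) M0"
      using C[of B "\<lambda>_. undefined" 0 n] B by (simp add: P_def space_PiM)
    finally show ?thesis .
  qed
  have "emeasure L (space L) = 1"
    using cyl[of "\<lambda>_. UNIV" 0] by (simp add: L_def space_paths)
  then have "prob_space L" by (rule prob_spaceI)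
  moreover have "sets L = sets paths" unfolding L_def by (rule IT.PF.sets_lim)
  ultimately have "L \<in> space (prob_algebra paths)" by (simp add: space_prob_algebra)
  with cyl show ?thesis by (intro exI[of _ L]) simp
qed

definition path :: "'t \<Rightarrow> (nat \<Rightarrow> 't) measure" where
  "path t = (SOME L. L \<in> space (prob_algebra paths) \<and> (\<forall>B n. (\<forall>i. B i \<in> sets borel) \<longrightarrow>
    emeasure L {\<omega>. \<forall>i<n. \<omega> i \<in> B i} = cylinder_integral Q (map B [0..<n]) (return borel t)))"

lemma
  shows path_in_space: "path t \<in> space (prob_algebra paths)"
    and emeasure_path_cylinder: "(\<And>i. B i \<in> sets borel) \<Longrightarrow>
      emeasure (path t) {\<omega>. \<forall>i<n. \<omega> i \<in> B i} = cylinder_integral Q (map B [0..<n]) (return borel t)"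
proof -
  have "return borel t \<in> space (prob_algebra borel)"
    by (simp add: space_prob_algebra prob_space_return)
  from someI_ex[OF ex_path_measure[OF this], folded path_def]
  have *: "path t \<in> space (prob_algebra paths)"
    "\<forall>B n. (\<forall>i. B i \<in> sets borel) \<longrightarrow>
      emeasure (path t) {\<omega>. \<forall>i<n. \<omega> i \<in> B i} = cylinder_integral Q (map B [0..<n]) (return borel t)"
    by (rule conjunct1, rule conjunct2)
  show "path t \<in> space (prob_algebra paths)" by (rule *(1))
  show "emeasure (path t) {\<omega>. \<forall>i<n. \<omega> i \<in> B i} = cylinder_integral Q (map B [0..<n]) (return borel t)"
    if "\<And>i. B i \<in> sets borel"
    using *(2)[rule_format, of B n] that by simp
qed

lemma path_measurable[measurable]: "path \<in> borel \<rightarrow>\<^sub>M prob_algebra paths"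
proof (rule measurable_prob_algebra_generated[OF sets_paths_cylinders Int_stable_cylinders])
  show "prob_space (path t)" "sets (path t) = sets paths" for t
    using path_in_space[of t] by (auto simp: space_prob_algebra)
  show "cylinders \<subseteq> Pow UNIV" by simp
  fix A :: "(nat \<Rightarrow> 't) set" assume A: "A \<in> cylinders"
  obtain B n where B: "\<And>i. B i \<in> sets borel" and A: "A = {\<omega>. \<forall>i<n. \<omega> i \<in> B i}"
    by (rule cylindersE[OF A]) (rule that)
  show "(\<lambda>t. emeasure (path t) A) \<in> borel_measurable borel"
    unfolding A emeasure_path_cylinder[OF B]
    using B by (intro measurable_compose[OF return_measurable[of borel] measurable_cylinder_integral(1)[of "map B [0..<n]"]]) auto
qed

lemma cylinder_integral_mixture:
  assumes M: "M \<in> space (prob_algebra borel)" and As: "set As \<subseteq> sets borel"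
  shows "cylinder_integral Q As M = (\<integral>\<^sup>+t. cylinder_integral Q As (return borel t) \<partial>M)"
proof (cases As)
  case Nil
  interpret prob_space M using M by (simp add: space_prob_algebra)
  show ?thesis using Nil by (simp add: emeasure_space_1)
next
  case (Cons A As')
  have [measurable]: "(\<lambda>t. cylinder_integral Q As' (Q t)) \<in> borel_measurable borel" "A \<in> sets borel"
    using measurable_cylinder_integral(2)[of As'] As Cons by auto
  show ?thesis unfolding Cons by (simp add: nn_integral_return)
qed

lemma emeasure_bind_path_cylinder:
  assumes M: "M \<in> space (prob_algebra borel)" and B: "\<And>i. B i \<in> sets borel"
  shows "emeasure (M \<bind> path) {\<omega>. \<forall>i<n. \<omega> i \<in> B i} = cylinder_integral Q (map B [0..<n]) M"
proof -
  have "emeasure (M \<bind> path) {\<omega>. \<forall>i<n. \<omega> i \<in> B i}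
      = (\<integral>\<^sup>+t. cylinder_integral Q (map B [0..<n]) (return borel t) \<partial>M)"
    using B by (subst emeasure_bind_prob_algebra[OF M path_measurable cylinder_sets])
      (auto simp: emeasure_path_cylinder)
  also have "\<dots> = cylinder_integral Q (map B [0..<n]) M"
    using B by (intro cylinder_integral_mixture[symmetric] M) auto
  finally show ?thesis .
qed

lemma bind_path_in_space: "M \<in> space (prob_algebra borel) \<Longrightarrow> M \<bind> path \<in> space (prob_algebra paths)"
  using prob_space_bind'[OF _ path_measurable, of M] sets_bind'[OF _ path_measurable, of M]
  by (simp add: space_prob_algebra[of paths])

lemma markov_measure_eq_bind_path:
  assumes P: "markov_measure Q p \<P>" and p: "p \<in> space (prob_algebra borel)"
  shows "\<P> = p \<bind> path"
proof (rule paths_measure_eqI)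
  show "\<P> \<in> space (prob_algebra paths)" using P by (simp add: markov_measure_def space_prob_algebra)
  show "p \<bind> path \<in> space (prob_algebra paths)" by (rule bind_path_in_space[OF p])
  fix B and n :: nat assume B: "\<And>i::nat. B i \<in> sets (borel :: 't measure)"
  have "emeasure \<P> {\<omega>. \<forall>i<length (map B [0..<n]). \<omega> i \<in> map B [0..<n] ! i}
      = cylinder_integral Q (map B [0..<n]) p"
  proof -
    have "\<forall>As. set As \<subseteq> sets borel \<longrightarrow>
        emeasure \<P> {\<omega>. \<forall>i<length As. \<omega> i \<in> As ! i} = cylinder_integral Q As p"
      using P unfolding markov_measure_def by blast
    moreover have "set (map B [0..<n]) \<subseteq> sets borel" using B by auto
    ultimately show ?thesis by blast
  qed
  moreover have "{\<omega>. \<forall>i<length (map B [0..<n]). \<omega> i \<in> map B [0..<n] ! i} = {\<omega>. \<forall>i<n. \<omega> i \<in> B i}"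
    by auto
  ultimately show "emeasure \<P> {\<omega>. \<forall>i<n. \<omega> i \<in> B i} = emeasure (p \<bind> path) {\<omega>. \<forall>i<n. \<omega> i \<in> B i}"
    by (simp add: emeasure_bind_path_cylinder[OF p B])
qed

text \<open>The law of the letters that follow \<open>t\<close>, without \<open>t\<close> itself.\<close>

definition future :: "'t \<Rightarrow> (nat \<Rightarrow> 't) measure" where
  "future t = Q t \<bind> path"

lemma future_measurable[measurable]: "future \<in> borel \<rightarrow>\<^sub>M prob_algebra paths"
  unfolding future_def by (rule measurable_bind_prob_space[OF Q path_measurable])

lemma measurable_case_nat_paths: "case_nat t \<in> paths \<rightarrow>\<^sub>M (paths :: (nat \<Rightarrow> 't) measure)"
  by (rule measurable_case_nat'[of "\<lambda>_. t" paths borel "\<lambda>x. x"]) (rule measurable_const, simp, rule measurable_ident_sets, rule refl)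

lemma path_eq_distr_future: "path t = distr (future t) paths (case_nat t)"
proof (rule paths_measure_eqI[OF path_in_space])
  note fut = kernel_prob[OF future_measurable, of t, simplified]
  have Qt: "Q t \<in> space (prob_algebra borel)" using kernel_prob(4)[OF Q] by simp
  have fut_meas[measurable]: "case_nat t \<in> future t \<rightarrow>\<^sub>M paths"
    using fut(2) measurable_cong_sets[OF fut(2) refl] measurable_case_nat_paths by blast
  show distr_in: "distr (future t) paths (case_nat t) \<in> space (prob_algebra paths)"
    using prob_space.prob_space_distr[OF fut(1) fut_meas] by (simp add: space_prob_algebra)
  fix B and n :: nat assume B: "\<And>i::nat. B i \<in> sets (borel :: 't measure)"
  show "emeasure (path t) {\<omega>. \<forall>i<n. \<omega> i \<in> B i}
      = emeasure (distr (future t) paths (case_nat t)) {\<omega>. \<forall>i<n. \<omega> i \<in> B i}"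
  proof (cases n)
    case 0
    have "emeasure L UNIV = 1" if "L \<in> space (prob_algebra paths)" for L :: "(nat \<Rightarrow> 't) measure"
      using in_space_prob_algebra[OF that] by (simp add: space_paths)
    from this[OF path_in_space] this[OF distr_in] show ?thesis by (simp add: 0)
  next
    case (Suc k)
    have B': "(\<lambda>i. B (Suc i)) i \<in> sets borel" for i using B by simp
    have vim: "case_nat t -` {\<omega>. \<forall>i<n. \<omega> i \<in> B i} = (if t \<in> B 0 then {\<omega>. \<forall>i<k. \<omega> i \<in> B (Suc i)} else {})"
      by (auto simp: Suc less_Suc_eq_0_disj)
    have "emeasure (distr (future t) paths (case_nat t)) {\<omega>. \<forall>i<n. \<omega> i \<in> B i}
        = emeasure (future t) (case_nat t -` {\<omega>. \<forall>i<n. \<omega> i \<in> B i})"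
      using fut(3) by (subst emeasure_distr[OF fut_meas]) (auto simp: space_paths cylinder_sets B)
    also have "\<dots> = cylinder_integral Q (map (\<lambda>i. B (Suc i)) [0..<k]) (Q t) * indicator (B 0) t"
      unfolding vim future_def using emeasure_bind_path_cylinder[OF Qt B', of k] by simp
    also have "\<dots> = cylinder_integral Q (map B [0..<n]) (return borel t)"
    proof -
      have [measurable]: "(\<lambda>t. cylinder_integral Q (map (\<lambda>i. B (Suc i)) [0..<k]) (Q t)) \<in> borel_measurable borel"
        using B by (intro measurable_cylinder_integral(2)) auto
      have [measurable]: "B 0 \<in> sets borel" by (rule B)
      show ?thesis unfolding Suc map_upt_Suc by (simp add: nn_integral_return)
    qed
    finally show ?thesis by (simp add: emeasure_path_cylinder[OF B])
  qed
qed

end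

section \<open>The skew product and the chain on the product\<close>

lemma bind_in_space:
  assumes "M \<in> space (prob_algebra N)" "K \<in> N \<rightarrow>\<^sub>M prob_algebra L"
  shows "M \<bind> K \<in> space (prob_algebra L)"
  using prob_space_bind'[OF assms] sets_bind'[OF assms] by (simp add: space_prob_algebra[of L])

lemma measurable_prob_cong:
  assumes "M \<in> space (prob_algebra N)"
  shows "g \<in> M \<rightarrow>\<^sub>M L \<longleftrightarrow> g \<in> N \<rightarrow>\<^sub>M L"
  using assms measurable_cong_sets[of M N L L] by (simp add: space_prob_algebra)

lemma distr_in_space:
  assumes "M \<in> space (prob_algebra N)" "g \<in> N \<rightarrow>\<^sub>M L"
  shows "distr M L g \<in> space (prob_algebra L)"
  using assms prob_space.prob_space_distr[of M g L] measurable_prob_cong[OF assms(1), of g L]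
  by (simp add: space_prob_algebra)

lemma nn_integral_distr_prob:
  assumes "M \<in> space (prob_algebra N)" "g \<in> N \<rightarrow>\<^sub>M L" "h \<in> borel_measurable L"
  shows "(\<integral>\<^sup>+y. h y \<partial>distr M L g) = (\<integral>\<^sup>+x. h (g x) \<partial>M)"
  using assms measurable_prob_cong[OF assms(1), of g L] by (intro nn_integral_distr) auto

lemma nn_integral_bind_prob:
  assumes M: "M \<in> space (prob_algebra N)" and K: "K \<in> N \<rightarrow>\<^sub>M prob_algebra L"
    and g: "g \<in> borel_measurable L"
  shows "(\<integral>\<^sup>+y. g y \<partial>(M \<bind> K)) = (\<integral>\<^sup>+x. (\<integral>\<^sup>+y. g y \<partial>K x) \<partial>M)"
  using measurable_prob_algebraD[OF K] measurable_prob_cong[OF M, of K "subprob_algebra L"]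
  by (intro nn_integral_bind[OF g]) simp

lemma measurable_nn_integral_kernel:
  assumes "K \<in> N \<rightarrow>\<^sub>M prob_algebra L" "g \<in> borel_measurable L"
  shows "(\<lambda>z. \<integral>\<^sup>+y. g y \<partial>K z) \<in> borel_measurable N"
  using measurable_compose[OF measurable_prob_algebraD[OF assms(1)] nn_integral_measurable_subprob_algebra[OF assms(2)]] .

lemma prob_measure_eqI:
  assumes "M \<in> space (prob_algebra L)" "N \<in> space (prob_algebra L)"
    and "\<And>g. g \<in> borel_measurable L \<Longrightarrow> (\<integral>\<^sup>+y. g y \<partial>M) = (\<integral>\<^sup>+y. g y \<partial>N)"
  shows "M = N"
proof (rule measure_eqI)
  show "sets M = sets N" using assms by (simp add: space_prob_algebra)
  fix A assume "A \<in> sets M"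
  then have A: "A \<in> sets L" "A \<in> sets M" "A \<in> sets N" using assms by (auto simp: space_prob_algebra)
  then show "emeasure M A = emeasure N A"
    using assms(3)[of "indicator A"] by simp
qed

lemma measurable_shift: "shift \<in> paths \<rightarrow>\<^sub>M paths"
  unfolding shift_def
  by (rule measurable_PiM_single') (auto intro: measurable_component_singleton)

locale markov_random_map = markov_kernel Q
  for Q :: "'t::polish_space \<Rightarrow> 't measure" +
  fixes f :: "'t \<times> 'x::polish_space \<Rightarrow> 'x"
  assumes f_meas: "f \<in> borel \<Otimes>\<^sub>M borel \<rightarrow>\<^sub>M borel"
begin

abbreviation F :: "(nat \<Rightarrow> 't) \<times> 'x \<Rightarrow> (nat \<Rightarrow> 't) \<times> 'x" where "F \<equiv> skew_product f"
abbreviation E :: "((nat \<Rightarrow> 't) \<times> 'x) measure" where "E \<equiv> paths \<Otimes>\<^sub>M borel"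

lemma space_E: "space E = UNIV"
  by (simp add: space_pair_measure space_paths)

lemma f_borel[measurable]: "f \<in> borel \<rightarrow>\<^sub>M borel"
  using f_meas by (simp add: borel_prod)

lemma fst_0_measurable: "(\<lambda>w. fst w 0) \<in> E \<rightarrow>\<^sub>M borel"
  by (rule measurable_compose[OF measurable_fst measurable_component_singleton]) simp

lemma pair_0_measurable: "(\<lambda>w. (fst w 0, snd w)) \<in> E \<rightarrow>\<^sub>M borel"
  using measurable_Pair[OF fst_0_measurable measurable_snd] by (simp add: borel_prod)

lemma F_measurable: "F \<in> E \<rightarrow>\<^sub>M E"
proof -
  have "(\<lambda>w. (shift (fst w), f (fst w 0, snd w))) \<in> E \<rightarrow>\<^sub>M E"
    by (intro measurable_Pair measurable_compose[OF measurable_fst measurable_shift]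
        measurable_compose[OF pair_0_measurable f_borel])
  then show ?thesis by (simp add: skew_product_def split_beta')
qed

text \<open>If \<open>w = (\<omega>, x\<^sub>0)\<close>, this is the state \<open>(\<omega>\<^sub>0, x\<^sub>1)\<close> of the chain of pairs "last letter used,
  current point".\<close>

definition next_state :: "(nat \<Rightarrow> 't) \<times> 'x \<Rightarrow> 't \<times> 'x" where
  "next_state w = (fst w 0, f (fst w 0, snd w))"

lemma next_state_measurable: "next_state \<in> E \<rightarrow>\<^sub>M borel"
  using measurable_Pair[OF fst_0_measurable measurable_compose[OF pair_0_measurable f_borel]]
  unfolding next_state_def by (simp add: borel_prod)

lemma F_cons: "F (case_nat u \<omega>, x) = (\<omega>, f (u, x))"
  by (simp add: skew_product_def shift_def)

lemma next_state_cons: "next_state (case_nat u \<omega>, x) = (u, f (u, x))"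
  by (simp add: next_state_def)

text \<open>The law of \<open>(\<omega>, x)\<close> when \<open>t\<close> is the letter that precedes \<open>\<omega>\<close>.
  Conditioning on the letter before \<open>\<omega>\<close>, and not on \<open>\<omega>\<^sub>0\<close>, is what makes the chain of the next states
  have the kernel \<^term>\<open>phat Q f\<close>.\<close>

definition K :: "'t \<times> 'x \<Rightarrow> ((nat \<Rightarrow> 't) \<times> 'x) measure" where
  "K z = distr (future (fst z)) E (\<lambda>\<omega>. (\<omega>, snd z))"

lemma future_in_space: "future t \<in> space (prob_algebra paths)"
  by (rule kernel_prob(4)[OF future_measurable]) simp

lemma Q_in_space: "Q t \<in> space (prob_algebra borel)"
  by (rule kernel_prob(4)[OF Q]) simp

lemma K_measurable: "K \<in> borel \<rightarrow>\<^sub>M prob_algebra E"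
proof -
  have "(\<lambda>z. distr (future (fst z)) E ((\<lambda>z \<omega>. (\<omega>, snd z)) z)) \<in> borel \<Otimes>\<^sub>M borel \<rightarrow>\<^sub>M prob_algebra E"
  proof (rule measurable_distr_prob_space2)
    show "(\<lambda>z. future (fst z)) \<in> borel \<Otimes>\<^sub>M (borel :: 'x measure) \<rightarrow>\<^sub>M prob_algebra paths"
      by (rule measurable_compose[OF measurable_fst future_measurable])
    show "(\<lambda>(z, \<omega>). (\<omega>, snd z)) \<in> (borel \<Otimes>\<^sub>M borel) \<Otimes>\<^sub>M paths \<rightarrow>\<^sub>M E"
      unfolding split_beta' by (intro measurable_Pair measurable_snd measurable_compose[OF measurable_fst measurable_snd])
  qed
  then show ?thesis by (simp add: K_def[abs_def] borel_prod)
qed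

lemma K_in_space: "K z \<in> space (prob_algebra E)"
  by (rule kernel_prob(4)[OF K_measurable]) simp

lemma nn_integral_K:
  assumes "g \<in> borel_measurable E"
  shows "(\<integral>\<^sup>+w. g w \<partial>K z) = (\<integral>\<^sup>+\<omega>. g (\<omega>, snd z) \<partial>future (fst z))"
  unfolding K_def
  by (rule nn_integral_distr_prob[OF future_in_space _ assms]) (intro measurable_Pair measurable_ident measurable_const, simp_all)

lemma nn_integral_future:
  assumes g: "g \<in> borel_measurable paths"
  shows "(\<integral>\<^sup>+\<omega>. g \<omega> \<partial>future t) = (\<integral>\<^sup>+u. (\<integral>\<^sup>+\<omega>. g (case_nat u \<omega>) \<partial>future u) \<partial>Q t)"
proof -
  have "(\<integral>\<^sup>+\<omega>. g \<omega> \<partial>future t) = (\<integral>\<^sup>+u. (\<integral>\<^sup>+\<omega>. g \<omega> \<partial>path u) \<partial>Q t)"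
    by (subst future_def) (rule nn_integral_bind_prob[OF Q_in_space path_measurable g])
  also have "\<dots> = (\<integral>\<^sup>+u. (\<integral>\<^sup>+\<omega>. g (case_nat u \<omega>) \<partial>future u) \<partial>Q t)"
    unfolding path_eq_distr_future
    by (intro nn_integral_cong nn_integral_distr_prob[OF future_in_space measurable_case_nat_paths g])
  finally show ?thesis .
qed

text \<open>Conditioning on the first letter \<open>u\<close>: the skew product drops \<open>u\<close> and moves \<open>x\<close> to \<open>f (u, x)\<close>, and
  what remains has the law \<^term>\<open>K (u, f (u, x))\<close>. This recursion is the source of the
  Markov property.\<close>

lemma nn_integral_K_step:
  assumes A: "A \<in> borel_measurable E" and h: "h \<in> borel_measurable E"
  shows "(\<integral>\<^sup>+w. A w * h (F w) \<partial>K (t, x))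
    = (\<integral>\<^sup>+u. (\<integral>\<^sup>+w. A (case_nat u (fst w), x) * h w \<partial>K (u, f (u, x))) \<partial>Q t)"
proof -
  have Ah: "(\<lambda>w. A w * h (F w)) \<in> borel_measurable E"
    by (intro borel_measurable_times_ennreal A measurable_compose[OF F_measurable h])
  have sect: "(\<lambda>\<omega>. (\<omega>, x)) \<in> paths \<rightarrow>\<^sub>M E"
    by (intro measurable_Pair measurable_ident measurable_const) simp_all
  have "(\<integral>\<^sup>+w. A w * h (F w) \<partial>K (t, x)) = (\<integral>\<^sup>+\<omega>. A (\<omega>, x) * h (F (\<omega>, x)) \<partial>future t)"
    using nn_integral_K[OF Ah, of "(t, x)"] by simp
  also have "\<dots> = (\<integral>\<^sup>+u. (\<integral>\<^sup>+\<omega>. A (case_nat u \<omega>, x) * h (\<omega>, f (u, x)) \<partial>future u) \<partial>Q t)"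
    by (subst nn_integral_future) (auto intro: measurable_compose[OF sect Ah] simp: F_cons)
  also have "\<dots> = (\<integral>\<^sup>+u. (\<integral>\<^sup>+w. A (case_nat u (fst w), x) * h w \<partial>K (u, f (u, x))) \<partial>Q t)"
  proof (rule nn_integral_cong)
    fix u
    have "(\<lambda>w. (case_nat u (fst w), x)) \<in> E \<rightarrow>\<^sub>M E"
      by (intro measurable_Pair measurable_const measurable_compose[OF measurable_fst measurable_case_nat_paths]) simp
    then have "(\<lambda>w. A (case_nat u (fst w), x) * h w) \<in> borel_measurable E"
      by (intro borel_measurable_times_ennreal h measurable_compose[OF _ A])
    then show "(\<integral>\<^sup>+\<omega>. A (case_nat u \<omega>, x) * h (\<omega>, f (u, x)) \<partial>future u)
        = (\<integral>\<^sup>+w. A (case_nat u (fst w), x) * h w \<partial>K (u, f (u, x)))"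
      by (subst nn_integral_K) auto
  qed
  finally show ?thesis .
qed

abbreviation ph :: "'t \<times> 'x \<Rightarrow> ('t \<times> 'x) measure" where "ph \<equiv> phat Q f"

lemma graph_measurable: "(\<lambda>u. (u, f (u, x))) \<in> borel \<rightarrow>\<^sub>M borel"
  using measurable_Pair[OF measurable_ident measurable_compose[OF measurable_Pair[OF measurable_ident measurable_const] f_meas]]
  by (simp add: borel_prod)

lemma phat_eq: "ph z = distr (Q (fst z)) borel (\<lambda>u. (u, f (u, snd z)))"
  by (simp add: phat_def split_beta' borel_prod)

lemma phat_measurable: "ph \<in> borel \<rightarrow>\<^sub>M prob_algebra borel"
proof -
  have "(\<lambda>z. distr (Q (fst z)) borel ((\<lambda>z u. (u, f (u, snd z))) z)) \<in> borel \<Otimes>\<^sub>M borel \<rightarrow>\<^sub>M prob_algebra borel"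
  proof (rule measurable_distr_prob_space2)
    show "(\<lambda>z. Q (fst z)) \<in> borel \<Otimes>\<^sub>M (borel :: 'x measure) \<rightarrow>\<^sub>M prob_algebra borel"
      by (rule measurable_compose[OF measurable_fst Q])
    have "(\<lambda>a. (snd a, f (snd a, snd (fst a)))) \<in> (borel \<Otimes>\<^sub>M borel) \<Otimes>\<^sub>M borel \<rightarrow>\<^sub>M borel \<Otimes>\<^sub>M borel"
      by (intro measurable_Pair measurable_compose[OF _ f_meas] measurable_snd
          measurable_compose[OF measurable_fst measurable_snd])
    then show "(\<lambda>(z, u). (u, f (u, snd z))) \<in> (borel \<Otimes>\<^sub>M borel) \<Otimes>\<^sub>M borel \<rightarrow>\<^sub>M borel"
      unfolding split_beta' by (simp add: borel_prod)
  qed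
  then show ?thesis unfolding phat_eq[abs_def] by (simp add: borel_prod)
qed

lemma phat_in_space: "ph z \<in> space (prob_algebra borel)"
  by (rule kernel_prob(4)[OF phat_measurable]) simp

lemma nn_integral_phat:
  assumes "h \<in> borel_measurable borel"
  shows "(\<integral>\<^sup>+y. h y \<partial>ph z) = (\<integral>\<^sup>+u. h (u, f (u, snd z)) \<partial>Q (fst z))"
  unfolding phat_eq by (rule nn_integral_distr_prob[OF Q_in_space graph_measurable assms])

lemma distr_K_F: "distr (K z) E F = ph z \<bind> K"
proof (rule prob_measure_eqI)
  show "distr (K z) E F \<in> space (prob_algebra E)" by (rule distr_in_space[OF K_in_space F_measurable])
  show "ph z \<bind> K \<in> space (prob_algebra E)" by (rule bind_in_space[OF phat_in_space K_measurable])
  fix h :: "_ \<Rightarrow> ennreal" assume h: "h \<in> borel_measurable E"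
  have "(\<integral>\<^sup>+w. h w \<partial>distr (K z) E F) = (\<integral>\<^sup>+w. 1 * h (F w) \<partial>K (fst z, snd z))"
    using nn_integral_distr_prob[OF K_in_space F_measurable h] by simp
  also have "\<dots> = (\<integral>\<^sup>+u. (\<integral>\<^sup>+w. h w \<partial>K (u, f (u, snd z))) \<partial>Q (fst z))"
    by (subst nn_integral_K_step) (auto intro: h)
  also have "\<dots> = (\<integral>\<^sup>+y. (\<integral>\<^sup>+w. h w \<partial>K y) \<partial>ph z)"
    using nn_integral_phat[OF measurable_nn_integral_kernel[OF K_measurable h]] by simp
  also have "\<dots> = (\<integral>\<^sup>+w. h w \<partial>(ph z \<bind> K))"
    by (rule nn_integral_bind_prob[OF phat_in_space K_measurable h, symmetric])
  finally show "(\<integral>\<^sup>+w. h w \<partial>distr (K z) E F) = (\<integral>\<^sup>+w. h w \<partial>(ph z \<bind> K))" .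
qed

text \<open>Events about the first \<open>n\<close> letters and the initial point.\<close>

definition history :: "(nat \<Rightarrow> 't set) \<Rightarrow> nat \<Rightarrow> 'x set \<Rightarrow> ((nat \<Rightarrow> 't) \<times> 'x) set" where
  "history B n X = {w. (\<forall>i<n. fst w i \<in> B i) \<and> snd w \<in> X}"

lemma history_sets:
  assumes "\<And>i. B i \<in> sets borel" "X \<in> sets borel" shows "history B n X \<in> sets E"
proof -
  have "history B n X = {\<omega>. \<forall>i<n. \<omega> i \<in> B i} \<times> X" by (auto simp: history_def)
  then show ?thesis using cylinder_sets[of B n] assms by simp
qed

text \<open>Given the first \<open>Suc n\<close> letters, the orbit after time \<open>Suc n\<close> has the law \<^term>\<open>K\<close> at the state
  reached then. The induction conditions on one more letter at the front.\<close>

lemma markov_property_K: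
  assumes B: "\<And>i. B i \<in> sets borel" and X: "X \<in> sets borel" and h: "h \<in> borel_measurable E"
  shows "(\<integral>\<^sup>+w. indicator (history B (Suc n) X) w * h ((F ^^ Suc n) w) \<partial>K z)
    = (\<integral>\<^sup>+w. indicator (history B (Suc n) X) w * (\<integral>\<^sup>+w'. h w' \<partial>K (next_state ((F ^^ n) w))) \<partial>K z)"
  using B X
proof (induction n arbitrary: z B X)
  case (0 z B X)
  note K1 = measurable_compose[OF next_state_measurable measurable_nn_integral_kernel[OF K_measurable h]]
  have ind: "(indicator (history B (Suc 0) X) :: _ \<Rightarrow> ennreal) \<in> borel_measurable E"
    using 0 by (intro borel_measurable_indicator history_sets)
  obtain t x where z: "z = (t, x)" by (cases z)
  define c :: "'t \<Rightarrow> ennreal" where "c u = indicator (B 0) u * indicator X x" for u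
  have ind_cons: "indicator (history B (Suc 0) X) (case_nat u \<omega>, x) = c u" for u \<omega>
    by (auto simp: history_def c_def indicator_def)
  have "(\<integral>\<^sup>+w. indicator (history B (Suc 0) X) w * h ((F ^^ Suc 0) w) \<partial>K z)
      = (\<integral>\<^sup>+u. (\<integral>\<^sup>+w. c u * h w \<partial>K (u, f (u, x))) \<partial>Q t)"
    using nn_integral_K_step[OF ind h, of t x] by (simp add: z ind_cons)
  also have "\<dots> = (\<integral>\<^sup>+u. c u * (\<integral>\<^sup>+w. h w \<partial>K (u, f (u, x))) \<partial>Q t)"
  proof (rule nn_integral_cong, rule nn_integral_cmult)
    fix u show "h \<in> borel_measurable (K (u, f (u, x)))" using h measurable_prob_cong[OF K_in_space] by blast
  qed
  also have "\<dots> = (\<integral>\<^sup>+u. (\<integral>\<^sup>+w'. c u * (\<integral>\<^sup>+w. h w \<partial>K (u, f (u, x))) * 1 \<partial>K (u, f (u, x))) \<partial>Q t)"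
  proof (rule nn_integral_cong)
    fix u
    interpret prob_space "K (u, f (u, x))" using K_in_space by (simp add: space_prob_algebra)
    show "c u * (\<integral>\<^sup>+w. h w \<partial>K (u, f (u, x))) = (\<integral>\<^sup>+w'. c u * (\<integral>\<^sup>+w. h w \<partial>K (u, f (u, x))) * 1 \<partial>K (u, f (u, x)))"
      by (simp add: emeasure_space_1)
  qed
  also have "\<dots> = (\<integral>\<^sup>+w. indicator (history B (Suc 0) X) w * (\<integral>\<^sup>+w'. h w' \<partial>K (next_state w)) * 1 \<partial>K z)"
    using nn_integral_K_step[OF borel_measurable_times_ennreal[OF ind K1], of "\<lambda>_. 1" t x]
    by (simp add: z ind_cons next_state_cons)
  finally show ?case by simp
next
  case (Suc n z B X)
  obtain t x where z: "z = (t, x)" by (cases z)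
  define c :: "'t \<Rightarrow> ennreal" where "c u = indicator (B 0) u * indicator X x" for u
  define I where "I = (indicator (history (\<lambda>i. B (Suc i)) (Suc n) UNIV) :: _ \<Rightarrow> ennreal)"
  have ind: "(indicator (history B (Suc (Suc n)) X) :: _ \<Rightarrow> ennreal) \<in> borel_measurable E"
    using Suc.prems by (intro borel_measurable_indicator history_sets)
  have I: "I \<in> borel_measurable E"
    unfolding I_def using Suc.prems by (intro borel_measurable_indicator history_sets) auto
  have ind_cons: "indicator (history B (Suc (Suc n)) X) (case_nat u (fst w), x) = c u * I w" for u w
    unfolding I_def c_def history_def indicator_def by (auto simp: All_less_Suc2)
  have step: "(\<integral>\<^sup>+w. indicator (history B (Suc (Suc n)) X) w * g (F w) \<partial>K z)
      = (\<integral>\<^sup>+u. c u * (\<integral>\<^sup>+w. I w * g w \<partial>K (u, f (u, x))) \<partial>Q t)"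
    if g: "g \<in> borel_measurable E" for g
  proof -
    have "(\<integral>\<^sup>+w. indicator (history B (Suc (Suc n)) X) w * g (F w) \<partial>K z)
        = (\<integral>\<^sup>+u. (\<integral>\<^sup>+w. c u * (I w * g w) \<partial>K (u, f (u, x))) \<partial>Q t)"
      using nn_integral_K_step[OF ind g, of t x] by (simp only: z ind_cons mult.assoc)
    also have "\<dots> = (\<integral>\<^sup>+u. c u * (\<integral>\<^sup>+w. I w * g w \<partial>K (u, f (u, x))) \<partial>Q t)"
    proof (rule nn_integral_cong, rule nn_integral_cmult)
      fix u show "(\<lambda>w. I w * g w) \<in> borel_measurable (K (u, f (u, x)))"
        using borel_measurable_times_ennreal[OF I g] measurable_prob_cong[OF K_in_space] by blast
    qed
    finally show ?thesis .
  qed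
  have Fn: "F ^^ k \<in> E \<rightarrow>\<^sub>M E" for k by (rule measurable_funpow[OF F_measurable])
  note K1 = measurable_compose[OF measurable_compose[OF Fn next_state_measurable] measurable_nn_integral_kernel[OF K_measurable h]]
  have "(\<integral>\<^sup>+w. indicator (history B (Suc (Suc n)) X) w * h ((F ^^ Suc (Suc n)) w) \<partial>K z)
      = (\<integral>\<^sup>+u. c u * (\<integral>\<^sup>+w. I w * h ((F ^^ Suc n) w) \<partial>K (u, f (u, x))) \<partial>Q t)"
    using step[OF measurable_compose[OF Fn[of "Suc n"] h]] by (simp add: funpow_swap1)
  also have "\<dots> = (\<integral>\<^sup>+u. c u * (\<integral>\<^sup>+w. I w * (\<integral>\<^sup>+w'. h w' \<partial>K (next_state ((F ^^ n) w))) \<partial>K (u, f (u, x))) \<partial>Q t)"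
    unfolding I_def using Suc.prems
    by (intro nn_integral_cong arg_cong2[where f = "(*)"] refl Suc.IH) auto
  also have "\<dots> = (\<integral>\<^sup>+w. indicator (history B (Suc (Suc n)) X) w * (\<integral>\<^sup>+w'. h w' \<partial>K (next_state ((F ^^ Suc n) w))) \<partial>K z)"
    using step[OF K1] by (simp add: funpow_swap1)
  finally show ?case .
qed

end

section \<open>A stationary law for the chain\<close>

text \<open>Domination by a finite measure lets the limit pass through the sum (Tannery's theorem); this is the
  union step of a Dynkin argument for the convergence of measures.\<close>

lemma tendsto_measure_disjoint_Union:
  fixes N :: "nat \<Rightarrow> 'a measure" and M :: "'a measure" and A :: "nat \<Rightarrow> 'a set"
  assumes fin: "\<And>n. finite_measure (N n)" "finite_measure M" "finite_measure D"
    and sets: "\<And>n. sets (N n) = sets D" "sets M = sets D"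
    and A: "range A \<subseteq> sets D" "disjoint_family A"
    and dom: "\<And>n i. measure (N n) (A i) \<le> measure D (A i)"
    and lim: "\<And>i. (\<lambda>n. measure (N n) (A i)) \<longlonglongrightarrow> measure M (A i)"
  shows "(\<lambda>n. measure (N n) (\<Union>i. A i)) \<longlonglongrightarrow> measure M (\<Union>i. A i)"
proof -
  have sums: "(\<lambda>i. measure L (A i)) sums measure L (\<Union>i. A i)" if "finite_measure L" "sets L = sets D" for L
    using finite_measure.finite_measure_UNION[OF that(1) _ A(2)] A(1) that(2) by simp
  have "((\<lambda>n. suminf (\<lambda>k. measure (N n) (A k))) \<longlonglongrightarrow> suminf (\<lambda>k. measure M (A k)))"
  proof (rule tannerys_theorem[THEN conjunct2, THEN conjunct2])
    show "summable (\<lambda>k. measure D (A k))" using sums[OF fin(3) refl] by (rule sums_summable)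
    show "\<forall>\<^sub>F (k, n) in at_top \<times>\<^sub>F sequentially. norm (measure (N n) (A k)) \<le> measure D (A k)"
      using dom by (intro always_eventually) auto
  qed (use lim in auto)
  then show ?thesis
    using sums_unique[OF sums[OF fin(1) sets(1)]] sums_unique[OF sums[OF fin(2) sets(2)]] by simp
qed

text \<open>By Tychonoff's theorem the set functions \<open>\<nu> n\<close> have a cluster point in \<open>[0,1]\<close> to the power of all
  sets. It is reached along a filter and not along a subsequence, since this power is not metrizable.
  Finite additivity passes to the limit; the uniform smallness on sequences that decrease to the empty
  set gives countable additivity.\<close>

lemma setwise_cluster_point:
  fixes \<nu> :: "nat \<Rightarrow> 'a measure"
  assumes \<nu>: "\<And>n. \<nu> n \<in> space (prob_algebra N)"
    and unif: "\<And>A e. range A \<subseteq> sets N \<Longrightarrow> decseq A \<Longrightarrow> (\<Inter>i::nat. A i) = {} \<Longrightarrow> 0 < (e::real) \<Longrightarrow>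
      \<exists>i. \<forall>n. measure (\<nu> n) (A i) < e"
  obtains H :: "nat filter" and \<rho> where "H \<noteq> bot" "H \<le> sequentially" "\<rho> \<in> space (prob_algebra N)"
    "\<And>A. A \<in> sets N \<Longrightarrow> ((\<lambda>n. measure (\<nu> n) A) \<longlongrightarrow> measure \<rho> A) H"
proof -
  have pr: "prob_space (\<nu> n)" and s: "sets (\<nu> n) = sets N" for n
    using \<nu>[of n] by (auto simp: space_prob_algebra)
  have sp: "space (\<nu> n) = space N" for n by (rule sets_eq_imp_space_eq[OF s])
  define c where "c n = (\<lambda>A. measure (\<nu> n) A)" for n
  define U where "U = Pi\<^sub>E (UNIV :: 'a set set) (\<lambda>_. {0..1::real})"
  have "compactin (product_topology (\<lambda>_. euclidean) UNIV) U"
    unfolding U_def compactin_PiE by simp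
  then have "compact U" by (simp add: euclidean_product_topology)
  moreover have "c n \<in> U" for n
    using prob_space.prob_le_1[OF pr] by (auto simp: U_def c_def)
  then have "eventually (\<lambda>x. x \<in> U) (filtermap c sequentially)"
    by (simp add: eventually_filtermap)
  moreover have "filtermap c sequentially \<noteq> bot" by (simp add: filtermap_bot_iff)
  ultimately obtain L where L: "inf (nhds L) (filtermap c sequentially) \<noteq> bot"
    unfolding compact_filter by blast
  \<comment> \<open>the coarsest filter finer than \<open>sequentially\<close> along which \<open>c\<close> tends to \<open>L\<close>\<close>
  define H where "H = inf sequentially (filtercomap c (nhds L))"
  have H_seq: "H \<le> sequentially" unfolding H_def by simp
  have H_bot: "H \<noteq> bot"
  proof
    assume "H = bot"
    then have "eventually (\<lambda>_. False) (inf sequentially (filtercomap c (nhds L)))" by (simp add: H_def)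
    then obtain P R where P: "eventually P sequentially"
      and R: "eventually R (nhds L)" and PR: "\<And>n. P n \<Longrightarrow> R (c n) \<Longrightarrow> False"
      unfolding eventually_inf eventually_filtercomap by blast
    from PR have "\<And>n. P n \<Longrightarrow> \<not> R (c n)" by blast
    with P have "eventually (\<lambda>x. \<not> R x) (filtermap c sequentially)"
      unfolding eventually_filtermap by (rule eventually_mono)
    with R have "eventually (\<lambda>_. False) (inf (nhds L) (filtermap c sequentially))"
      unfolding eventually_inf by blast
    with L show False by (simp add: eventually_False)
  qed
  have "filterlim c (nhds L) H"
    by (rule filterlim_mono[OF filterlim_filtercomap order_refl]) (simp add: H_def)
  then have lim: "((\<lambda>n. measure (\<nu> n) A) \<longlongrightarrow> L A) H" for A
    using continuous_on_tendsto_compose[OF continuous_on_product_coordinates[where i = A], of c L H]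
    unfolding c_def by simp
  have L_nonneg: "0 \<le> L A" for A
    by (rule tendsto_lowerbound[OF lim]) (auto simp: H_bot)
  have L_mono_bound: "L A \<le> e" if "\<And>n. measure (\<nu> n) A < e" for A e
    using tendsto_upperbound[OF lim _ H_bot, of A e] that by (simp add: less_imp_le)
  have L_space: "L (space N) = 1"
  proof (rule tendsto_unique[OF H_bot lim])
    have "measure (\<nu> n) (space N) = 1" for n using prob_space.prob_space[OF pr, of n] by (simp add: sp)
    then show "((\<lambda>n. measure (\<nu> n) (space N)) \<longlongrightarrow> 1) H" by simp
  qed
  have L_add: "L (A \<union> B) = L A + L B" if "A \<in> sets N" "B \<in> sets N" "A \<inter> B = {}" for A B
  proof (rule tendsto_unique[OF H_bot lim])
    have "measure (\<nu> n) (A \<union> B) = measure (\<nu> n) A + measure (\<nu> n) B" for n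
      using that finite_measure.finite_measure_Union[OF prob_space.finite_measure[OF pr]] by (simp add: s)
    then show "((\<lambda>n. measure (\<nu> n) (A \<union> B)) \<longlongrightarrow> L A + L B) H" by (simp add: tendsto_add lim)
  qed
  have L_empty: "L {} = 0" using L_add[of "{}" "{}"] by simp
  define \<rho> where "\<rho> = measure_of (space N) (sets N) (\<lambda>A. ennreal (L A))"
  have em: "emeasure \<rho> A = ennreal (L A)" if "A \<in> sets N" for A
  proof (rule emeasure_measure_of[OF \<rho>_def])
    show "sets N \<subseteq> Pow (space N)" by (rule sets.space_closed)
    show "A \<in> sets \<rho>" using that by (simp add: \<rho>_def)
    have pos: "positive (sets N) (\<lambda>A. ennreal (L A))" by (simp add: positive_def L_empty)
    then show "positive (sets \<rho>) (\<lambda>A. ennreal (L A))" by (simp add: \<rho>_def)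
    have "countably_additive (sets N) (\<lambda>A. ennreal (L A))"
    proof (rule sets.empty_continuous_imp_countably_additive[OF pos])
      show "additive (sets N) (\<lambda>A. ennreal (L A))"
        unfolding additive_def using L_add L_nonneg by (simp add: ennreal_plus)
      fix A :: "nat \<Rightarrow> 'a set" assume A: "range A \<subseteq> sets N" "decseq A" "(\<Inter>i. A i) = {}"
      have "(\<lambda>i. L (A i)) \<longlonglongrightarrow> 0"
      proof (rule LIMSEQ_I)
        fix e :: real assume e: "0 < e"
        obtain i where i: "\<And>n. measure (\<nu> n) (A i) < e / 2" using unif[OF A, of "e / 2"] e by auto
        have "norm (L (A j) - 0) < e" if "i \<le> j" for j
        proof -
          have "measure (\<nu> n) (A j) < e / 2" for n
            using finite_measure.finite_measure_mono[OF prob_space.finite_measure[OF pr], of "A j" "A i" n]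
              decseqD[OF A(2) that] A(1) i[of n] by (auto simp: s)
          from L_mono_bound[OF this] show ?thesis using e L_nonneg[of "A j"] by simp
        qed
        then show "\<exists>i. \<forall>j\<ge>i. norm (L (A j) - 0) < e" by blast
      qed
      then show "(\<lambda>i. ennreal (L (A i))) \<longlonglongrightarrow> 0"
        using tendsto_ennrealI[of "\<lambda>i. L (A i)" 0 sequentially] by simp
    qed simp
    then show "countably_additive (sets \<rho>) (\<lambda>A. ennreal (L A))" by (simp add: \<rho>_def)
  qed
  have sets_\<rho>: "sets \<rho> = sets N" by (simp add: \<rho>_def)
  have "emeasure \<rho> (space \<rho>) = 1"
    using em[of "space N"] L_space sets_eq_imp_space_eq[OF sets_\<rho>] by simp
  then have "prob_space \<rho>" by (rule prob_spaceI)
  then have \<rho>: "\<rho> \<in> space (prob_algebra N)" using sets_\<rho> by (simp add: space_prob_algebra)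
  have "measure \<rho> A = L A" if "A \<in> sets N" for A
    using em[OF that] L_nonneg[of A] by (simp add: measure_def)
  then show ?thesis using that[OF H_bot H_seq \<rho>] lim by simp
qed

lemma measure_bind_prob:
  assumes M: "M \<in> space (prob_algebra N)" and K: "K \<in> N \<rightarrow>\<^sub>M prob_algebra L" and A: "A \<in> sets L"
  shows "measure (M \<bind> K) A = (\<integral>x. measure (K x) A \<partial>M)"
proof -
  interpret prob_space M using M by (simp add: space_prob_algebra)
  show ?thesis using measurable_prob_algebraD[OF K] measurable_prob_cong[OF M, of K "subprob_algebra L"]
    by (intro measure_bind[OF _ A]) simp
qed

lemma bind_assoc_prob:
  assumes M: "M \<in> space (prob_algebra N)" and K: "K \<in> N \<rightarrow>\<^sub>M prob_algebra L" and K': "K' \<in> L \<rightarrow>\<^sub>M prob_algebra R"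
  shows "(M \<bind> K) \<bind> K' = M \<bind> (\<lambda>x. K x \<bind> K')"
  using measurable_prob_algebraD[OF K] measurable_prob_cong[OF M, of K "subprob_algebra L"]
  by (intro bind_assoc[OF _ measurable_prob_algebraD[OF K']]) simp

lemma kernel_pow_measurable:
  assumes "K \<in> N \<rightarrow>\<^sub>M prob_algebra N"
  shows "kernel_pow K N n \<in> N \<rightarrow>\<^sub>M prob_algebra N"
proof (induction n)
  case 0
  have "kernel_pow K N 0 = return N" by auto
  then show ?case by simp
next
  case (Suc n)
  have "kernel_pow K N (Suc n) = (\<lambda>z. K z \<bind> kernel_pow K N n)" by auto
  then show ?case using measurable_bind_prob_space[OF assms Suc] by simp
qed

lemma kernel_pow_add:
  assumes K: "K \<in> N \<rightarrow>\<^sub>M prob_algebra N" and z: "z \<in> space N"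
  shows "kernel_pow K N (m + n) z = kernel_pow K N m z \<bind> kernel_pow K N n"
  using z
proof (induction m arbitrary: z)
  case 0
  then show ?case
    using bind_return[OF measurable_prob_algebraD[OF kernel_pow_measurable[OF K]]] by simp
next
  case (Suc m)
  have "kernel_pow K N (Suc m + n) z = K z \<bind> (\<lambda>y. kernel_pow K N m y \<bind> kernel_pow K N n)"
    using Suc.IH kernel_prob(3)[OF K Suc.prems] by (auto intro!: bind_cong)
  also have "\<dots> = (K z \<bind> kernel_pow K N m) \<bind> kernel_pow K N n"
    by (rule bind_assoc_prob[OF kernel_prob(4)[OF K Suc.prems] kernel_pow_measurable[OF K] kernel_pow_measurable[OF K], symmetric])
  finally show ?case by simp
qed

lemma kernel_pow_Suc_right:
  assumes K: "K \<in> N \<rightarrow>\<^sub>M prob_algebra N" and z: "z \<in> space N"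
  shows "kernel_pow K N (Suc n) z = kernel_pow K N n z \<bind> K"
proof -
  have "kernel_pow K N (Suc 0) y = K y" if "y \<in> space N" for y
    using bind_return''[of "K y" N] kernel_prob(2)[OF K that]
    by (simp add: kernel_pow.simps[abs_def])
  then have "kernel_pow K N n z \<bind> kernel_pow K N (Suc 0) = kernel_pow K N n z \<bind> K"
    using kernel_prob(3)[OF kernel_pow_measurable[OF K] z] by (intro bind_cong) (auto simp del: kernel_pow.simps)
  then show ?thesis using kernel_pow_add[OF K z, of n 1] by simp
qed

context markov_random_map
begin

abbreviation pow :: "nat \<Rightarrow> 't \<times> 'x \<Rightarrow> ('t \<times> 'x) measure" where "pow \<equiv> kernel_pow ph borel"

lemmas pow_measurable = kernel_pow_measurable[OF phat_measurable]

lemma pow_in_space: "pow n z \<in> space (prob_algebra borel)"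
  by (rule kernel_prob(4)[OF pow_measurable]) simp

lemma pow_Suc_right: "pow (Suc n) z = pow n z \<bind> ph"
  by (rule kernel_pow_Suc_right[OF phat_measurable]) simp

lemma pow_add: "pow (m + n) z = pow m z \<bind> pow n"
  by (rule kernel_pow_add[OF phat_measurable]) simp

lemma distr_bind_K_F:
  assumes "\<rho> \<in> space (prob_algebra borel)"
  shows "distr (\<rho> \<bind> K) E F = (\<rho> \<bind> ph) \<bind> K"
proof -
  have ne: "space \<rho> \<noteq> {}" using assms prob_space.not_empty[of \<rho>] by (simp add: space_prob_algebra)
  have "K \<in> \<rho> \<rightarrow>\<^sub>M subprob_algebra E"
    using measurable_prob_algebraD[OF K_measurable] measurable_prob_cong[OF assms, of K "subprob_algebra E"] by simp
  from distr_bind[OF this ne F_measurable]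
  have "distr (\<rho> \<bind> K) E F = \<rho> \<bind> (\<lambda>z. distr (K z) E F)" .
  also have "\<dots> = \<rho> \<bind> (\<lambda>z. ph z \<bind> K)" by (simp add: distr_K_F)
  also have "\<dots> = (\<rho> \<bind> ph) \<bind> K"
    by (rule bind_assoc_prob[OF assms phat_measurable K_measurable, symmetric])
  finally show ?thesis .
qed

lemma distr_bind_K_funpow:
  assumes "\<rho> \<in> space (prob_algebra borel)"
  shows "distr (\<rho> \<bind> K) E (F ^^ n) = (\<rho> \<bind> pow n) \<bind> K"
proof (induction n)
  case 0
  have "sets (\<rho> \<bind> K) = sets E" using bind_in_space[OF assms K_measurable] by (simp add: space_prob_algebra)
  moreover have "\<rho> \<bind> pow 0 = \<rho>"
    using bind_return''[of \<rho> borel] assms by (simp add: space_prob_algebra kernel_pow.simps[abs_def])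
  moreover have "distr (\<rho> \<bind> K) E (F ^^ 0) = \<rho> \<bind> K"
    using distr_id2[of E "\<rho> \<bind> K"] calculation(1) by (simp add: id_def)
  ultimately show ?case by (simp only:)
next
  case (Suc n)
  have FE: "F \<in> E \<rightarrow>\<^sub>M E" "F ^^ n \<in> (\<rho> \<bind> K) \<rightarrow>\<^sub>M E"
    using F_measurable measurable_funpow[OF F_measurable]
      measurable_prob_cong[OF bind_in_space[OF assms K_measurable]] by blast+
  have "distr (\<rho> \<bind> K) E (F ^^ Suc n) = distr (distr (\<rho> \<bind> K) E (F ^^ n)) E F"
    using distr_distr[OF FE] by simp
  also have "\<dots> = distr ((\<rho> \<bind> pow n) \<bind> K) E F" by (simp add: Suc)
  also have "\<dots> = ((\<rho> \<bind> pow n) \<bind> ph) \<bind> K"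
    by (rule distr_bind_K_F[OF bind_in_space[OF assms pow_measurable]])
  also have "(\<rho> \<bind> pow n) \<bind> ph = \<rho> \<bind> pow (Suc n)"
    unfolding bind_assoc_prob[OF assms pow_measurable phat_measurable] by (simp only: pow_Suc_right[symmetric])
  finally show ?case .
qed

definition strictly_invariant :: "((nat \<Rightarrow> 't) \<times> 'x) set \<Rightarrow> bool" where
  "strictly_invariant C \<longleftrightarrow> C \<in> sets E \<and> F -` C = C"

lemma strictly_invariantD:
  assumes "strictly_invariant C"
  shows "C \<in> sets E" "F -` C = C" "(F ^^ n) -` C = C" "F w \<in> C \<longleftrightarrow> w \<in> C" "(F ^^ n) w \<in> C \<longleftrightarrow> w \<in> C"
proof -
  show C: "C \<in> sets E" "F -` C = C" using assms by (auto simp: strictly_invariant_def)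
  then show 1: "F w \<in> C \<longleftrightarrow> w \<in> C" for w by blast
  show "(F ^^ n) w \<in> C \<longleftrightarrow> w \<in> C" for w by (induction n) (simp_all add: 1)
  then show "(F ^^ n) -` C = C" by blast
qed

lemma strictly_invariant_Diff: "strictly_invariant A \<Longrightarrow> strictly_invariant B \<Longrightarrow> strictly_invariant (A - B)"
  unfolding strictly_invariant_def by (simp add: vimage_Diff sets.Diff)

lemma strictly_invariant_UNIV: "strictly_invariant UNIV"
  unfolding strictly_invariant_def using sets.top[of E] by (simp add: space_E)

lemma emeasure_invariant_bind_pow:
  assumes \<rho>: "\<rho> \<in> space (prob_algebra borel)" and C: "strictly_invariant C"
  shows "emeasure ((\<rho> \<bind> pow n) \<bind> K) C = emeasure (\<rho> \<bind> K) C"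
proof -
  note sp = bind_in_space[OF \<rho> K_measurable]
  have "F ^^ n \<in> (\<rho> \<bind> K) \<rightarrow>\<^sub>M E"
    using measurable_funpow[OF F_measurable] measurable_prob_cong[OF sp] by blast
  moreover have "space (\<rho> \<bind> K) = UNIV"
    using sp sets_eq_imp_space_eq[of "\<rho> \<bind> K" E] by (simp add: space_prob_algebra space_E)
  ultimately show ?thesis
    unfolding distr_bind_K_funpow[OF \<rho>, symmetric] using strictly_invariantD[OF C]
    by (simp add: emeasure_distr)
qed

text \<open>For invariant \<open>C\<close>, the conditional probability of \<open>C\<close> given the current state of the chain.\<close>

definition prob_in :: "((nat \<Rightarrow> 't) \<times> 'x) set \<Rightarrow> 't \<times> 'x \<Rightarrow> real" where
  "prob_in C z = measure (K z) C"

lemma prob_in_bounds: "0 \<le> prob_in C z" "prob_in C z \<le> 1" "\<bar>prob_in C z\<bar> \<le> 1"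
  using prob_space.prob_le_1[of "K z" C] K_in_space[of z] by (auto simp: prob_in_def space_prob_algebra)

lemma prob_in_measurable: "C \<in> sets E \<Longrightarrow> prob_in C \<in> borel_measurable borel"
  unfolding prob_in_def[abs_def]
  by (rule measurable_compose[OF K_measurable measurable_measure_prob_algebra])

text \<open>The law of \<open>F\<^sup>n\<close> under \<^term>\<open>K z\<close> is the average of \<open>K\<close> over the \<open>n\<close>-th power of the kernel at \<open>z\<close>,
  and an invariant set contains \<open>F\<^sup>n w\<close> exactly when it contains \<open>w\<close>.\<close>

lemma prob_in_harmonic:
  assumes C: "strictly_invariant C"
  shows "(\<integral>y. prob_in C y \<partial>pow n z) = prob_in C z"
proof -
  define d where "d = return (borel :: ('t \<times> 'x) measure) z"
  have d: "d \<in> space (prob_algebra borel)" unfolding d_def by (simp add: space_prob_algebra prob_space_return)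
  have "d \<bind> pow n = pow n z" "d \<bind> K = K z"
    unfolding d_def by (simp_all add: bind_return[OF measurable_prob_algebraD[OF pow_measurable]]
        bind_return[OF measurable_prob_algebraD[OF K_measurable]])
  with emeasure_invariant_bind_pow[OF d C, of n]
  have "measure (pow n z \<bind> K) C = measure (K z) C" by (simp add: measure_def)
  then show ?thesis
    unfolding prob_in_def measure_bind_prob[OF pow_in_space K_measurable strictly_invariantD(1)[OF C]] .
qed

lemma compact_state_space:
  assumes "compact (UNIV :: 't set)" "compact (UNIV :: 'x set)"
  shows "compact (UNIV :: ('t \<times> 'x) set)"
  using compact_Times[OF assms] by simp

text \<open>Average the laws of the chain started from \<open>lam\<close> over the times \<open>n0, \<dots>, n0 + n\<close>. After
  time \<open>n0\<close> the mass of a set \<open>A\<close> is at most the supremum over \<open>z\<close> of \<open>pow n0 z A\<close>, and by Dini's theorem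
  this tends to 0 when \<open>A\<close> decreases to the empty set, so a cluster point exists. It is stationary because
  shifting the average changes it by \<open>O(1/n)\<close>. Invariant sets have the same mass under all terms of the
  average, since their conditional probabilities are harmonic.\<close>

lemma stationary_limit:
  assumes comp: "compact (UNIV :: ('t \<times> 'x) set)"
    and sf: "strong_feller (pow n0) borel"
    and lam: "lam \<in> space (prob_algebra borel)"
    and ac: "\<And>A. A \<in> sets borel \<Longrightarrow> emeasure lam A = 0 \<Longrightarrow> emeasure (lam \<bind> ph) A = 0"
  obtains \<rho> where "\<rho> \<in> space (prob_algebra borel)" "\<rho> \<bind> ph = \<rho>"
    "absolutely_continuous lam \<rho>"
    "\<And>C. strictly_invariant C \<Longrightarrow> measure (\<rho> \<bind> K) C = measure (lam \<bind> K) C"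
proof -
  define \<theta> where "\<theta> k = lam \<bind> pow k" for k
  have \<theta>: "\<theta> k \<in> space (prob_algebra borel)" for k
    unfolding \<theta>_def by (rule bind_in_space[OF lam pow_measurable])
  have \<theta>_Suc: "\<theta> k \<bind> ph = \<theta> (Suc k)" for k
    unfolding \<theta>_def bind_assoc_prob[OF lam pow_measurable phat_measurable] by (simp only: pow_Suc_right[symmetric])
  have \<theta>_add: "\<theta> (k + n0) = \<theta> k \<bind> pow n0" for k
    unfolding \<theta>_def bind_assoc_prob[OF lam pow_measurable pow_measurable] by (simp only: pow_add[symmetric])
  have \<theta>_null: "emeasure (\<theta> k) A = 0" if A: "A \<in> sets borel" "emeasure lam A = 0" for k A
    using A
  proof (induction k arbitrary: A)
    case 0
    have "\<theta> 0 = lam"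
      using bind_return''[of lam borel] lam by (simp add: \<theta>_def space_prob_algebra kernel_pow.simps[abs_def])
    with 0 show ?case by simp
  next
    case (Suc k)
    have pm: "(\<lambda>z. emeasure (ph z) A) \<in> borel_measurable borel"
      by (rule measurable_compose[OF measurable_prob_algebraD[OF phat_measurable] measurable_emeasure_subprob_algebra[OF Suc.prems(1)]])
    define Z where "Z = {z. emeasure (ph z) A \<noteq> 0}"
    have Z: "Z \<in> sets borel" unfolding Z_def using borel_measurable_neq[OF pm borel_measurable_const[of 0]] by simp
    have AE_iff: "emeasure M Z = 0 \<longleftrightarrow> (\<integral>\<^sup>+z. emeasure (ph z) A \<partial>M) = 0"
      if M: "M \<in> space (prob_algebra borel)" for M
    proof -
      have "(\<lambda>z. emeasure (ph z) A) \<in> borel_measurable M" using pm measurable_prob_cong[OF M] by blast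
      moreover have "space M = UNIV" using M sets_eq_imp_space_eq[of M borel] by (simp add: space_prob_algebra)
      ultimately show ?thesis using nn_integral_0_iff[of "\<lambda>z. emeasure (ph z) A" M] by (simp add: Z_def)
    qed
    have "emeasure lam Z = 0"
      unfolding AE_iff[OF lam] using ac[OF Suc.prems] emeasure_bind_prob_algebra[OF lam phat_measurable Suc.prems(1)] by simp
    from Suc.IH[OF Z this]
    have "(\<integral>\<^sup>+z. emeasure (ph z) A \<partial>\<theta> k) = 0" unfolding AE_iff[OF \<theta>] .
    then show ?case
      unfolding \<theta>_Suc[symmetric] using emeasure_bind_prob_algebra[OF \<theta> phat_measurable Suc.prems(1)] by simp
  qed
  define \<nu> where "\<nu> n = measure_pmf (pmf_of_set {..n}) \<bind> (\<lambda>k. \<theta> (k + n0))" for n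
  have pm: "measure_pmf (pmf_of_set {..n::nat}) \<in> space (prob_algebra (count_space UNIV))" for n
    by (simp add: space_prob_algebra measure_pmf.prob_space_axioms)
  have \<theta>m: "(\<lambda>k. \<theta> (k + n0)) \<in> count_space UNIV \<rightarrow>\<^sub>M prob_algebra borel"
    using \<theta> by simp
  have \<nu>: "\<nu> n \<in> space (prob_algebra borel)" for n
    unfolding \<nu>_def by (rule bind_in_space[OF pm \<theta>m])
  have \<nu>_avg: "measure (\<nu> n) A = (\<Sum>k\<le>n. measure (\<theta> (k + n0)) A) / real (Suc n)" if "A \<in> sets borel" for n A
    unfolding \<nu>_def measure_bind_prob[OF pm \<theta>m that] by (subst integral_pmf_of_set) auto
  have \<nu>_bind_avg: "measure (\<nu> n \<bind> T) A = (\<Sum>k\<le>n. measure (\<theta> (k + n0) \<bind> T) A) / real (Suc n)"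
    if T: "T \<in> borel \<rightarrow>\<^sub>M prob_algebra L" and A: "A \<in> sets L" for n A L and T :: "'t \<times> 'x \<Rightarrow> 'c measure"
  proof -
    have Tm: "(\<lambda>k. \<theta> (k + n0) \<bind> T) \<in> count_space UNIV \<rightarrow>\<^sub>M prob_algebra L"
      using bind_in_space[OF \<theta> T] by simp
    show ?thesis
      unfolding \<nu>_def bind_assoc_prob[OF pm \<theta>m T] measure_bind_prob[OF pm Tm A]
      by (subst integral_pmf_of_set) auto
  qed
  have unif: "\<exists>i. \<forall>n. measure (\<nu> n) (A i) < e"
    if A: "range A \<subseteq> sets borel" "decseq A" "(\<Inter>i::nat. A i) = {}" and e: "0 < (e::real)" for A e
  proof -
    have Ai: "A i \<in> sets borel" for i using A(1) by auto
    have pr: "prob_space (pow n0 z)" "sets (pow n0 z) = sets borel" for z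
      using pow_in_space[of n0 z] by (auto simp: space_prob_algebra)
    obtain i where i: "\<And>k z. i \<le> k \<Longrightarrow> measure (pow n0 z) (A k) < e / 2"
    proof -
      have "\<exists>i. \<forall>k\<ge>i. \<forall>z. measure (pow n0 z) (A k) < e / 2"
      proof (rule dini[OF comp])
        show "continuous_on UNIV (\<lambda>z. measure (pow n0 z) (A i))" for i
          using sf Ai unfolding strong_feller_def by blast
        show "measure (pow n0 z) (A (Suc i)) \<le> measure (pow n0 z) (A i)" for i z
          using decseq_SucD[OF A(2), of i] Ai pr
          by (intro finite_measure.finite_measure_mono prob_space.finite_measure) auto
        show "(\<lambda>i. measure (pow n0 z) (A i)) \<longlonglongrightarrow> 0" for z
          using finite_measure.finite_Lim_measure_decseq[OF prob_space.finite_measure[OF pr(1)], of A z] A pr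
          by simp
      qed (use e in simp)
      then show ?thesis using that by blast
    qed
    have "measure (\<theta> (k + n0)) (A i) \<le> e / 2" for k
    proof -
      have "\<bar>\<integral>z. measure (pow n0 z) (A i) \<partial>\<theta> k\<bar> \<le> e / 2"
      proof (rule abs_integral_le[OF \<theta>])
        show "(\<lambda>z. measure (pow n0 z) (A i)) \<in> borel_measurable borel"
          by (rule measurable_compose[OF pow_measurable measurable_measure_prob_algebra[OF Ai]])
        show "\<bar>measure (pow n0 z) (A i)\<bar> \<le> e / 2" for z using i[of i z] by simp
      qed
      then show ?thesis unfolding \<theta>_add measure_bind_prob[OF \<theta> pow_measurable Ai] by linarith
    qed
    then have "(\<Sum>k\<le>n. measure (\<theta> (k + n0)) (A i)) \<le> real (card {..n}) * (e / 2)" for n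
      by (intro sum_bounded_above) auto
    then have small: "measure (\<nu> n) (A i) \<le> e / 2" for n
      unfolding \<nu>_avg[OF Ai] by (simp add: divide_le_eq mult.commute)
    have "measure (\<nu> n) (A i) < e" for n using small[of n] e by linarith
    then show ?thesis by blast
  qed
  obtain H \<rho> where H: "H \<noteq> bot" "H \<le> sequentially" and \<rho>: "\<rho> \<in> space (prob_algebra borel)"
    and lim: "\<And>A. A \<in> sets borel \<Longrightarrow> ((\<lambda>n. measure (\<nu> n) A) \<longlongrightarrow> measure \<rho> A) H"
    using setwise_cluster_point[of \<nu> borel, OF \<nu> unif] by blast
  have lim_bind: "((\<lambda>n. measure (\<nu> n \<bind> T) A) \<longlongrightarrow> measure (\<rho> \<bind> T) A) H"
    if T: "T \<in> borel \<rightarrow>\<^sub>M prob_algebra L" and A: "A \<in> sets L" for A L and T :: "'t \<times> 'x \<Rightarrow> 'c measure"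
    unfolding measure_bind_prob[OF \<nu> T A] measure_bind_prob[OF \<rho> T A]
  proof (rule tendsto_integral_setwise[OF \<nu> \<rho> lim])
    show "(\<lambda>x. measure (T x) A) \<in> borel_measurable borel"
      by (rule measurable_compose[OF T measurable_measure_prob_algebra[OF A]])
    show "\<bar>measure (T x) A\<bar> \<le> 1" for x
      using prob_space.prob_le_1[OF kernel_prob(1)[OF T]] by simp
  qed auto
  have "\<rho> \<bind> ph = \<rho>"
  proof (rule measure_eqI)
    have \<rho>ph: "\<rho> \<bind> ph \<in> space (prob_algebra borel)" by (rule bind_in_space[OF \<rho> phat_measurable])
    show "sets (\<rho> \<bind> ph) = sets \<rho>" using \<rho> \<rho>ph by (simp add: space_prob_algebra)
    fix A assume "A \<in> sets (\<rho> \<bind> ph)"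
    then have A: "A \<in> sets borel" using \<rho>ph by (simp add: space_prob_algebra)
    define m where "m k = measure (\<theta> (k + n0)) A" for k
    have m: "0 \<le> m k" "m k \<le> 1" for k
      using \<theta>[of "k + n0"] prob_space.prob_le_1[of "\<theta> (k + n0)" A] by (auto simp: m_def space_prob_algebra)
    have tele: "(\<Sum>k\<le>n. m (Suc k)) = (\<Sum>k\<le>n. m k) + m (Suc n) - m 0" for n
      by (induction n) auto
    have diff: "measure (\<nu> n \<bind> ph) A - measure (\<nu> n) A = (m (Suc n) - m 0) / real (Suc n)" for n
    proof -
      have "measure (\<nu> n \<bind> ph) A = (\<Sum>k\<le>n. m (Suc k)) / real (Suc n)"
        unfolding \<nu>_bind_avg[OF phat_measurable A] by (simp add: \<theta>_Suc m_def)
      moreover have "measure (\<nu> n) A = (\<Sum>k\<le>n. m k) / real (Suc n)"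
        unfolding \<nu>_avg[OF A] m_def ..
      ultimately show ?thesis unfolding tele by (simp add: diff_divide_distrib add_divide_distrib)
    qed
    have "(\<lambda>n. (m (Suc n) - m 0) / real (Suc n)) \<longlonglongrightarrow> 0"
    proof (rule Lim_null_comparison[OF _ LIMSEQ_inverse_real_of_nat])
      show "\<forall>\<^sub>F n in sequentially. norm ((m (Suc n) - m 0) / real (Suc n)) \<le> inverse (real (Suc n))"
      proof (rule always_eventually, rule allI)
        fix n
        have "\<bar>m (Suc n) - m 0\<bar> \<le> 1" using m[of "Suc n"] m[of 0] by linarith
        then show "norm ((m (Suc n) - m 0) / real (Suc n)) \<le> inverse (real (Suc n))"
          by (simp add: divide_inverse abs_mult mult_left_le_one_le)
      qed
    qed
    then have "((\<lambda>n. measure (\<nu> n \<bind> ph) A - measure (\<nu> n) A) \<longlongrightarrow> 0) H"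
      unfolding diff by (rule tendsto_mono[OF H(2)])
    from tendsto_add[OF this lim[OF A]]
    have "((\<lambda>n. measure (\<nu> n \<bind> ph) A) \<longlongrightarrow> measure \<rho> A) H" by simp
    then have "measure (\<rho> \<bind> ph) A = measure \<rho> A"
      by (rule tendsto_unique[OF H(1) lim_bind[OF phat_measurable A]])
    then show "emeasure (\<rho> \<bind> ph) A = emeasure \<rho> A"
      using \<rho> \<rho>ph finite_measure.emeasure_eq_measure[OF prob_space.finite_measure, of \<rho> A]
        finite_measure.emeasure_eq_measure[OF prob_space.finite_measure, of "\<rho> \<bind> ph" A]
      by (simp add: space_prob_algebra)
  qed
  moreover have "absolutely_continuous lam \<rho>"
    unfolding absolutely_continuous_def
  proof
    fix A assume "A \<in> null_sets lam"
    then have A: "A \<in> sets borel" "emeasure lam A = 0" using lam by (auto simp: space_prob_algebra)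
    have "measure (\<nu> n) A = 0" for n
      unfolding \<nu>_avg[OF A(1)] using \<theta>_null[OF A] by (simp add: measure_def)
    then have "measure \<rho> A = 0" using tendsto_unique[OF H(1) lim[OF A(1)], of 0] by simp
    then have "emeasure \<rho> A = 0"
      using \<rho> finite_measure.emeasure_eq_measure[OF prob_space.finite_measure, of \<rho> A] by (simp add: space_prob_algebra)
    then show "A \<in> null_sets \<rho>" using A \<rho> by (auto simp: space_prob_algebra)
  qed
  moreover have "measure (\<rho> \<bind> K) C = measure (lam \<bind> K) C" if C: "strictly_invariant C" for C
  proof (rule tendsto_unique[OF H(1) lim_bind[OF K_measurable strictly_invariantD(1)[OF C]]])
    have "measure (\<theta> k \<bind> K) C = measure (lam \<bind> K) C" for k
      using emeasure_invariant_bind_pow[OF lam C] by (simp add: \<theta>_def measure_def)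
    then have "measure (\<nu> n \<bind> K) C = measure (lam \<bind> K) C" for n
      unfolding \<nu>_bind_avg[OF K_measurable strictly_invariantD(1)[OF C]] by simp
    then show "((\<lambda>n. measure (\<nu> n \<bind> K) C) \<longlongrightarrow> measure (lam \<bind> K) C) H" by simp
  qed
  ultimately show ?thesis using that \<rho> by blast
qed

section \<open>Zero-one law and smallness gap for invariant sets\<close>

definition histories :: "((nat \<Rightarrow> 't) \<times> 'x) set set" where
  "histories = {a \<times> b | a b. a \<in> cylinders \<and> b \<in> sets borel}"

lemma sets_E_histories: "sets E = sigma_sets UNIV histories"
proof -
  have univ: "(UNIV :: (nat \<Rightarrow> 't) set) \<in> cylinders" using cylindersI[of "\<lambda>_. UNIV" 0] by simp
  have "sets E = sets (sigma (space (paths :: (nat \<Rightarrow> 't) measure) \<times> space (borel :: 'x measure)) histories)"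
    unfolding histories_def
  proof (rule sets_pair_eq)
    show "cylinders \<subseteq> Pow (space (paths :: (nat \<Rightarrow> 't) measure))" by (simp add: space_paths)
    show "sets paths = sigma_sets (space (paths :: (nat \<Rightarrow> 't) measure)) cylinders"
      by (simp add: space_paths sets_paths_cylinders)
    show "countable {UNIV :: (nat \<Rightarrow> 't) set}" "countable {UNIV :: 'x set}" by simp_all
    show "{UNIV :: (nat \<Rightarrow> 't) set} \<subseteq> cylinders" using univ by simp
    show "\<Union> {UNIV} = space (paths :: (nat \<Rightarrow> 't) measure)" by (simp add: space_paths)
    show "sets borel \<subseteq> Pow (space (borel :: 'x measure))" by simp
    show "sets borel = sigma_sets (space (borel :: 'x measure)) (sets borel)"
      using sets.sigma_sets_eq[of "borel :: 'x measure"] by simp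
    show "{UNIV :: 'x set} \<subseteq> sets borel" "\<Union> {UNIV} = space (borel :: 'x measure)" by simp_all
  qed
  then show ?thesis by (simp add: space_paths sets_measure_of)
qed

lemma Int_stable_histories: "Int_stable histories"
proof (rule Int_stableI)
  fix A B assume "A \<in> histories" "B \<in> histories"
  then obtain a b a' b' where *: "a \<in> cylinders" "b \<in> sets borel" "a' \<in> cylinders" "b' \<in> sets borel"
    and AB: "A = a \<times> b" "B = a' \<times> b'"
    unfolding histories_def by blast
  have "a \<inter> a' \<in> cylinders" using Int_stableD[OF Int_stable_cylinders *(1,3)] .
  moreover have "b \<inter> b' \<in> sets borel" using * by auto
  moreover have "A \<inter> B = (a \<inter> a') \<times> (b \<inter> b')" unfolding AB by auto
  ultimately show "A \<inter> B \<in> histories" unfolding histories_def by blast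
qed

text \<open>Let \<open>g\<close> be the conditional probability of \<open>C\<close> given the next state. By the Markov property and the
  invariance of \<open>C\<close>, the integral of \<open>g \<circ> F\<^sup>n\<close> over a history \<open>A\<close> equals the measure of \<open>A \<inter> C\<close> as soon as \<open>n\<close>
  is large; by a Dynkin argument the integrals converge to this value for every measurable \<open>A\<close>. For
  \<open>A = C\<close> and for the complement of \<open>C\<close> they do not depend on \<open>n\<close>, because the measure and \<open>A\<close> are
  invariant. So \<open>g\<close> integrates to the full measure over \<open>C\<close> and to 0 over its complement.\<close>

lemma prob_in_next_state_eq_indicator:
  assumes \<rho>: "\<rho> \<in> space (prob_algebra borel)" and stat: "\<rho> \<bind> ph = \<rho>"
    and C: "strictly_invariant C"
  shows "AE w in \<rho> \<bind> K. prob_in C (next_state w) = indicator C w"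
proof -
  define \<mu> where "\<mu> = \<rho> \<bind> K"
  have \<mu>: "\<mu> \<in> space (prob_algebra E)" unfolding \<mu>_def by (rule bind_in_space[OF \<rho> K_measurable])
  interpret \<mu>: prob_space \<mu> using \<mu> by (simp add: space_prob_algebra)
  have s: "sets \<mu> = sets E" using \<mu> by (simp add: space_prob_algebra)
  have sp: "space \<mu> = UNIV" using sets_eq_imp_space_eq[OF s] by (simp add: space_E)
  note CD = strictly_invariantD[OF C]
  have Fn: "F ^^ n \<in> E \<rightarrow>\<^sub>M E" for n by (rule measurable_funpow[OF F_measurable])
  have F_inv: "distr \<mu> E (F ^^ n) = \<mu>" for n
  proof -
    have "\<rho> \<bind> pow n = \<rho>"
    proof (induction n)
      case 0
      show ?case using bind_return''[of \<rho> borel] \<rho> by (simp add: space_prob_algebra kernel_pow.simps[abs_def])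
    next
      case (Suc n)
      have "\<rho> \<bind> pow (Suc n) = (\<rho> \<bind> pow n) \<bind> ph"
        unfolding bind_assoc_prob[OF \<rho> pow_measurable phat_measurable] by (simp only: pow_Suc_right[symmetric])
      with Suc stat show ?case by (simp only:)
    qed
    then show ?thesis unfolding \<mu>_def distr_bind_K_funpow[OF \<rho>] by simp
  qed
  define g where "g w = ennreal (prob_in C (next_state w))" for w
  have g: "g \<in> borel_measurable E"
    unfolding g_def using measurable_compose[OF next_state_measurable prob_in_measurable[OF CD(1)]] by simp
  have gF: "(\<lambda>w. g ((F ^^ n) w)) \<in> borel_measurable E" for n by (rule measurable_compose[OF Fn g])
  have g1: "g w \<le> 1" for w using prob_in_bounds by (simp add: g_def)
  define N where "N n = density \<mu> (\<lambda>w. g ((F ^^ n) w))" for n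
  define M where "M = density \<mu> (indicator C)"
  have gF\<mu>: "(\<lambda>w. g ((F ^^ n) w)) \<in> borel_measurable \<mu>" for n using gF measurable_prob_cong[OF \<mu>] by blast
  have C\<mu>: "C \<in> sets \<mu>" using CD(1) s by simp
  have em_N: "emeasure (N n) A = (\<integral>\<^sup>+w. indicator A w * g ((F ^^ n) w) \<partial>\<mu>)" if "A \<in> sets E" for n A
    unfolding N_def using that s gF\<mu> by (subst emeasure_density) (auto simp: mult.commute)
  have em_M: "emeasure M A = emeasure \<mu> (A \<inter> C)" if "A \<in> sets E" for A
    unfolding M_def using that s C\<mu> by (subst emeasure_density) (auto simp: indicator_inter_arith[symmetric] Int_commute)
  have N_le: "emeasure (N n) A \<le> emeasure \<mu> A" if "A \<in> sets E" for n A
  proof -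
    have "emeasure (N n) A \<le> (\<integral>\<^sup>+w. indicator A w \<partial>\<mu>)"
      unfolding em_N[OF that] using g1 by (intro nn_integral_mono) (auto simp: indicator_def)
    then show ?thesis using that s by simp
  qed
  have fin_N: "finite_measure (N n)" for n
  proof (rule finite_measureI)
    have "emeasure (N n) UNIV \<le> emeasure \<mu> UNIV" using N_le[of UNIV n] sets.top[of E] by (simp add: space_E)
    then show "emeasure (N n) (space (N n)) \<noteq> \<infinity>" by (auto simp: N_def sp top_unique)
  qed
  have fin_M: "finite_measure M"
  proof (rule finite_measureI)
    show "emeasure M (space M) \<noteq> \<infinity>" using em_M[of UNIV] sets.top[of E] by (simp add: M_def sp space_E)
  qed
  have sets_NM: "sets (N n) = sets \<mu>" "sets M = sets \<mu>" for n by (simp_all add: N_def M_def)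
  \<comment> \<open>the Markov property: on histories the two densities have the same integral from some time on\<close>
  have hist: "emeasure (N n) A = emeasure M A"
    if B: "\<And>i. B i \<in> sets borel" and X: "X \<in> sets borel" and A: "A = {\<omega>. \<forall>i<k. \<omega> i \<in> B i} \<times> X" and n: "k \<le> Suc n"
    for n A k B X
  proof -
    define B' where "B' i = (if i < k then B i else UNIV)" for i
    have B': "B' i \<in> sets borel" for i using B by (simp add: B'_def)
    have A': "A = history B' (Suc n) X"
      unfolding A history_def B'_def using n by (auto simp: mem_Times_iff)
    have AE: "A \<in> sets E" unfolding A' by (rule history_sets[OF B' X])
    have hK: "(\<integral>\<^sup>+w'. indicator C w' \<partial>K z) = ennreal (prob_in C z)" for z
      using K_in_space[of z] CD(1) finite_measure.emeasure_eq_measure[OF prob_space.finite_measure, of "K z" C]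
      by (simp add: prob_in_def space_prob_algebra)
    have i1: "(\<lambda>w. indicator A w * indicator C ((F ^^ Suc n) w) :: ennreal) \<in> borel_measurable E"
      using measurable_compose[OF Fn[of "Suc n"] borel_measurable_indicator[OF CD(1)]] AE
      by (intro borel_measurable_times_ennreal borel_measurable_indicator) auto
    have i2: "(\<lambda>w. indicator A w * g ((F ^^ n) w)) \<in> borel_measurable E"
      using gF AE by (intro borel_measurable_times_ennreal borel_measurable_indicator) auto
    have "emeasure M A = (\<integral>\<^sup>+w. indicator A w * indicator C ((F ^^ Suc n) w) \<partial>\<mu>)"
    proof -
      have "emeasure M A = (\<integral>\<^sup>+w. indicator (A \<inter> C) w \<partial>\<mu>)" using em_M[OF AE] AE C\<mu> s by simp
      also have "\<dots> = (\<integral>\<^sup>+w. indicator A w * indicator C ((F ^^ Suc n) w) \<partial>\<mu>)"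
        using CD(5)[of "Suc n"] by (intro nn_integral_cong) (auto simp: indicator_def)
      finally show ?thesis .
    qed
    also have "\<dots> = (\<integral>\<^sup>+z. (\<integral>\<^sup>+w. indicator A w * indicator C ((F ^^ Suc n) w) \<partial>K z) \<partial>\<rho>)"
      unfolding \<mu>_def by (rule nn_integral_bind_prob[OF \<rho> K_measurable i1])
    also have "\<dots> = (\<integral>\<^sup>+z. (\<integral>\<^sup>+w. indicator A w * g ((F ^^ n) w) \<partial>K z) \<partial>\<rho>)"
      unfolding A' g_def using markov_property_K[OF B' X borel_measurable_indicator[OF CD(1)], where n = n]
      by (simp only: hK)
    also have "\<dots> = (\<integral>\<^sup>+w. indicator A w * g ((F ^^ n) w) \<partial>\<mu>)"
      unfolding \<mu>_def by (rule nn_integral_bind_prob[OF \<rho> K_measurable i2, symmetric])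
    also have "\<dots> = emeasure (N n) A" by (rule em_N[OF AE, symmetric])
    finally show ?thesis by simp
  qed
  have N_univ: "measure (N n) UNIV = measure M UNIV" for n
  proof -
    have "emeasure (N n) ({\<omega>. \<forall>i<0. \<omega> i \<in> (\<lambda>_. UNIV) i} \<times> UNIV) = emeasure M ({\<omega>. \<forall>i<0. \<omega> i \<in> (\<lambda>_. UNIV) i} \<times> UNIV)"
      by (rule hist[OF _ _ refl le0]) simp_all
    then show ?thesis by (simp add: measure_def)
  qed
  have hist_Pow: "histories \<subseteq> Pow UNIV" by simp
  have lim: "(\<lambda>n. measure (N n) A) \<longlonglongrightarrow> measure M A" if "A \<in> sets E" for A
    using Int_stable_histories hist_Pow that[unfolded sets_E_histories]
  proof (induction rule: sigma_sets_induct_disjoint)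
    case (basic A)
    then obtain a b where ab: "a \<in> cylinders" "b \<in> sets borel" and A: "A = a \<times> b"
      unfolding histories_def by blast
    obtain B k where B: "\<And>i. B i \<in> sets borel" and a: "a = {\<omega>. \<forall>i<k. \<omega> i \<in> B i}"
      by (rule cylindersE[OF ab(1)]) (rule that)
    have "measure (N n) A = measure M A" if "k \<le> n" for n
    proof -
      have "k \<le> Suc n" using that by simp
      from hist[OF B ab(2) refl this] show ?thesis by (simp add: A a measure_def)
    qed
    then have "\<forall>\<^sub>F n in sequentially. measure (N n) A = measure M A"
      by (auto simp: eventually_sequentially)
    then show ?case by (rule tendsto_eventually)
  next
    case empty
    show ?case by simp
  next
    case (compl A)
    then have AE: "A \<in> sets E" by (simp add: sets_E_histories)
    have "measure L (UNIV - A) = measure L UNIV - measure L A" if "finite_measure L" "sets L = sets \<mu>" for L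
      using finite_measure.finite_measure_compl[OF that(1), of A] AE that(2) s sets_eq_imp_space_eq[OF that(2)] by (simp add: sp)
    then show ?case
      using fin_N fin_M sets_NM compl(2) N_univ by (simp add: tendsto_diff)
  next
    case (union A)
    show ?case
    proof (rule tendsto_measure_disjoint_Union[OF fin_N fin_M, of \<mu>])
      show "range A \<subseteq> sets \<mu>" using union(2) by (simp add: s sets_E_histories)
      show "measure (N n) (A i) \<le> measure \<mu> (A i)" for n i
      proof -
        have "A i \<in> sets E" using union(2) by (auto simp: sets_E_histories)
        from N_le[OF this, of n]
        have "ennreal (measure (N n) (A i)) \<le> ennreal (measure \<mu> (A i))"
          unfolding finite_measure.emeasure_eq_measure[OF fin_N] \<mu>.emeasure_eq_measure .
        then show ?thesis by simp
      qed
    qed (use union sets_NM \<mu>.finite_measure_axioms in auto)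
  qed
  have N_const: "emeasure (N n) A = emeasure (N 0) A" if A: "strictly_invariant A" for n A
  proof -
    note AD = strictly_invariantD[OF A]
    have Ag: "(\<lambda>w. indicator A w * g w) \<in> borel_measurable E"
      using g AD(1) by (intro borel_measurable_times_ennreal borel_measurable_indicator) auto
    have "emeasure (N n) A = (\<integral>\<^sup>+w. indicator A ((F ^^ n) w) * g ((F ^^ n) w) \<partial>\<mu>)"
      unfolding em_N[OF AD(1)] using AD(5)[of n] by (intro nn_integral_cong) (auto simp: indicator_def)
    also have "\<dots> = (\<integral>\<^sup>+w. indicator A w * g w \<partial>distr \<mu> E (F ^^ n))"
      by (rule nn_integral_distr_prob[OF \<mu> Fn Ag, symmetric])
    also have "\<dots> = emeasure (N 0) A" unfolding F_inv em_N[OF AD(1)] by simp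
    finally show ?thesis .
  qed
  have N0: "measure (N 0) A = measure \<mu> (A \<inter> C)" if A: "strictly_invariant A" for A
  proof -
    have "(\<lambda>n. measure (N n) A) = (\<lambda>_. measure (N 0) A)"
      unfolding measure_def by (rule ext, subst N_const[OF A], rule refl)
    then have "(\<lambda>n. measure (N n) A) \<longlonglongrightarrow> measure (N 0) A" by (simp only: tendsto_const)
    from LIMSEQ_unique[OF this lim] strictly_invariantD(1)[OF A] show ?thesis
      using em_M by (simp add: measure_def)
  qed
  have C': "strictly_invariant (UNIV - C)" by (rule strictly_invariant_Diff[OF strictly_invariant_UNIV C])
  have gm: "g \<in> borel_measurable \<mu>" using g measurable_prob_cong[OF \<mu>] by blast
  have "AE w in \<mu>. w \<in> C \<longrightarrow> prob_in C (next_state w) = 1"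
  proof -
    have eq: "(\<integral>\<^sup>+w. indicator C w * g w \<partial>\<mu>) = emeasure \<mu> C"
      using N0[OF C] em_N[OF CD(1), of 0] finite_measure.emeasure_eq_measure[OF fin_N, of 0 C] \<mu>.emeasure_eq_measure by simp
    have "(\<integral>\<^sup>+w. indicator C w - indicator C w * g w \<partial>\<mu>) = (\<integral>\<^sup>+w. indicator C w \<partial>\<mu>) - (\<integral>\<^sup>+w. indicator C w * g w \<partial>\<mu>)"
    proof (rule nn_integral_diff)
      show "indicator C \<in> borel_measurable \<mu>" using C\<mu> by simp
      show "(\<lambda>w. indicator C w * g w) \<in> borel_measurable \<mu>"
        using C\<mu> gm by (intro borel_measurable_times_ennreal borel_measurable_indicator) auto
      show "(\<integral>\<^sup>+w. indicator C w * g w \<partial>\<mu>) \<noteq> \<infinity>" unfolding eq by simp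
      show "AE w in \<mu>. indicator C w * g w \<le> indicator C w" using g1 by (auto simp: indicator_def)
    qed
    also have "\<dots> = 0" unfolding eq using C\<mu> by simp
    finally have "AE w in \<mu>. indicator C w - indicator C w * g w = 0"
      using C\<mu> gm by (subst (asm) nn_integral_0_iff_AE) (auto intro!: borel_measurable_minus_ennreal borel_measurable_times_ennreal borel_measurable_indicator)
    then show ?thesis
    proof eventually_elim
      case (elim w)
      show ?case
      proof
        assume "w \<in> C"
        with elim have "1 \<le> g w" by (simp add: diff_eq_0_iff_ennreal)
        then have "1 \<le> prob_in C (next_state w)" unfolding g_def by simp
        then show "prob_in C (next_state w) = 1" using prob_in_bounds(2)[of C "next_state w"] by linarith
      qed
    qed
  qed
  moreover have "AE w in \<mu>. w \<notin> C \<longrightarrow> prob_in C (next_state w) = 0"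
  proof -
    have "(\<integral>\<^sup>+w. indicator (UNIV - C) w * g w \<partial>\<mu>) = 0"
      using N0[OF C'] em_N[OF strictly_invariantD(1)[OF C'], of 0] finite_measure.emeasure_eq_measure[OF fin_N, of 0 "UNIV - C"]
      by (simp add: Diff_Int_distrib2)
    moreover have "UNIV - C \<in> sets \<mu>" using strictly_invariantD(1)[OF C'] s by simp
    ultimately have "AE w in \<mu>. indicator (UNIV - C) w * g w = 0"
      using gm by (subst (asm) nn_integral_0_iff_AE) (auto intro!: borel_measurable_times_ennreal borel_measurable_indicator)
    then show ?thesis
    proof eventually_elim
      case (elim w)
      then show ?case using prob_in_bounds(1)[of C "next_state w"] by (auto simp: g_def)
    qed
  qed
  ultimately show ?thesis unfolding \<mu>_def[symmetric] by eventually_elim (auto simp: indicator_def)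
qed

text \<open>Otherwise there are invariant sets of positive measure tending to 0. Their conditional probabilities
  are harmonic, so a subsequence of them converges uniformly. But if \<open>A\<close> has larger measure than \<open>B\<close>,
  the zero-one law for \<open>A - B\<close> gives a state at which the conditional probability of \<open>A\<close> is 1 and that
  of \<open>B\<close> is 0, so the subsequence is not uniformly Cauchy.\<close>

lemma invariant_measure_gap:
  assumes comp: "compact (UNIV :: ('t \<times> 'x) set)"
    and sf: "strong_feller (pow n0) borel"
    and \<rho>: "\<rho> \<in> space (prob_algebra borel)" and stat: "\<rho> \<bind> ph = \<rho>"
  obtains v where "0 < v"
    "\<And>C. strictly_invariant C \<Longrightarrow> measure (\<rho> \<bind> K) C = 0 \<or> v \<le> measure (\<rho> \<bind> K) C"
proof -
  define \<mu> where "\<mu> = \<rho> \<bind> K"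
  have \<mu>: "\<mu> \<in> space (prob_algebra E)" unfolding \<mu>_def by (rule bind_in_space[OF \<rho> K_measurable])
  interpret \<mu>: prob_space \<mu> using \<mu> by (simp add: space_prob_algebra)
  have s: "sets \<mu> = sets E" using \<mu> by (simp add: space_prob_algebra)
  have "\<exists>v>0. \<forall>C. strictly_invariant C \<longrightarrow> measure \<mu> C = 0 \<or> v \<le> measure \<mu> C"
  proof (rule ccontr)
    assume "\<not> ?thesis"
    then have "\<exists>C. strictly_invariant C \<and> measure \<mu> C \<noteq> 0 \<and> measure \<mu> C < v" if "0 < v" for v
      using that by (meson not_less)
    then have "\<forall>n. \<exists>C. strictly_invariant C \<and> measure \<mu> C \<noteq> 0 \<and> measure \<mu> C < inverse (real (Suc n))"
      by simp
    then obtain C where C: "\<And>n. strictly_invariant (C n)" "\<And>n. measure \<mu> (C n) \<noteq> 0"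
      "\<And>n. measure \<mu> (C n) < inverse (real (Suc n))" by metis
    obtain r :: "nat \<Rightarrow> nat" and \<psi> where r: "strict_mono r" and
      ul: "uniform_limit UNIV (\<lambda>n z. \<integral>y. (\<integral>x. prob_in (C (r n)) x \<partial>pow n0 y) \<partial>pow n0 z)
        (\<lambda>z. \<integral>y. \<psi> y \<partial>pow n0 z) sequentially"
      using strong_feller_comp_uniform_subsequence[OF comp pow_measurable sf pow_measurable sf, of "\<lambda>n. prob_in (C n)" 1]
        prob_in_measurable strictly_invariantD(1)[OF C(1)] prob_in_bounds(3) by metis
    then have "uniform_limit UNIV (\<lambda>n. prob_in (C (r n))) (\<lambda>z. \<integral>y. \<psi> y \<partial>pow n0 z) sequentially"
      by (simp add: prob_in_harmonic[OF C(1)])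
    from uniform_limitD[OF this, of "1/2"] obtain k where
      k: "\<And>n z. k \<le> n \<Longrightarrow> dist (prob_in (C (r n)) z) (\<integral>y. \<psi> y \<partial>pow n0 z) < 1/2"
      by (auto simp: eventually_sequentially)
    define A where "A = C (r k)"
    have "0 < measure \<mu> A" using C(2)[of "r k"] zero_less_measure_iff[of \<mu> A] by (simp add: A_def)
    then obtain n where n: "inverse (real (Suc n)) < measure \<mu> A" using reals_Archimedean by blast
    define B where "B = C (r (max k n))"
    have "measure \<mu> B < inverse (real (Suc (r (max k n))))" unfolding B_def by (rule C(3))
    also have "\<dots> \<le> inverse (real (Suc n))"
      using seq_suble[OF r, of "max k n"] by (intro le_imp_inverse_le) auto
    finally have BA: "measure \<mu> B < measure \<mu> A" using n by simp
    have AB: "strictly_invariant A" "strictly_invariant B" using C(1) by (auto simp: A_def B_def)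
    have D: "strictly_invariant (A - B)" by (rule strictly_invariant_Diff[OF AB])
    have AB_sets: "A \<in> sets E" "B \<in> sets E" "A - B \<in> sets E" using strictly_invariantD(1) AB D by auto
    have "measure \<mu> (A - B) \<noteq> 0"
    proof
      assume "measure \<mu> (A - B) = 0"
      moreover have "measure \<mu> A \<le> measure \<mu> (A - B) + measure \<mu> B"
        using \<mu>.finite_measure_mono[of A "(A - B) \<union> B"] measure_Un_le[of "A - B" \<mu> B] AB_sets s by fastforce
      ultimately show False using BA by simp
    qed
    then have pos: "emeasure \<mu> (A - B) \<noteq> 0" by (simp add: \<mu>.emeasure_eq_measure)
    have "\<exists>w\<in>A - B. prob_in (A - B) (next_state w) = 1"
    proof (rule ccontr)
      assume "\<not> ?thesis"
      then have not: "w \<notin> A - B" if "prob_in (A - B) (next_state w) = indicator (A - B) w" for w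
        using that by (metis indicator_simps(1))
      from prob_in_next_state_eq_indicator[OF \<rho> stat D] have "AE w in \<mu>. w \<notin> A - B"
        unfolding \<mu>_def by eventually_elim (rule not)
      then have "emeasure \<mu> (A - B) = 0" using AB_sets s AE_iff_measurable[of "A - B" \<mu> "\<lambda>w. w \<notin> A - B"]
        sets.sets_into_space[of "A - B" \<mu>] by (metis (mono_tags, lifting) Collect_cong Int_absorb1 Int_def mem_Collect_eq not_not)
      with pos show False by simp
    qed
    then obtain z where z: "prob_in (A - B) z = 1" by blast
    interpret Kz: prob_space "K z" using K_in_space by (simp add: space_prob_algebra)
    have Ks: "sets (K z) = sets E" using K_in_space by (simp add: space_prob_algebra)
    have "prob_in A z = 1"
      using z Kz.finite_measure_mono[of "A - B" A] AB_sets Ks Kz.prob_le_1[of A] by (simp add: prob_in_def)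
    moreover have "prob_in B z = 0"
    proof -
      have "measure (K z) (A - B) + measure (K z) B = measure (K z) ((A - B) \<union> B)"
        using AB_sets Ks by (intro Kz.finite_measure_Union[symmetric]) auto
      then have "measure (K z) B \<le> 0"
        using z[unfolded prob_in_def] Kz.prob_le_1[of "(A - B) \<union> B"] by linarith
      then show ?thesis by (simp add: prob_in_def measure_le_0_iff)
    qed
    ultimately have "dist (prob_in A z) (prob_in B z) = 1" by simp
    moreover have "dist (prob_in A z) (prob_in B z) < 1/2 + 1/2"
      unfolding A_def B_def by (rule dist_triangle_less_add[OF k[of k] k]) auto
    ultimately show False by simp
  qed
  then show ?thesis using that unfolding \<mu>_def by blast
qed

section \<open>Nonsingularity and the reference measure\<close>

definition start :: "(nat \<Rightarrow> 't) \<times> 'x \<Rightarrow> 't \<times> 'x" where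
  "start w = (fst w 0, snd w)"

lemma start_measurable: "start \<in> E \<rightarrow>\<^sub>M borel"
  using pair_0_measurable by (simp add: start_def[abs_def])

text \<open>In contrast to \<^term>\<open>K\<close>, the law of \<open>(\<omega>, x)\<close> when \<open>t\<close> is the letter \<open>\<omega>\<^sub>0\<close> itself.
  Disintegrations over \<open>\<omega>\<^sub>0\<close> are read off from it.\<close>

definition J :: "'t \<times> 'x \<Rightarrow> ((nat \<Rightarrow> 't) \<times> 'x) measure" where
  "J z = distr (path (fst z)) E (\<lambda>\<omega>. (\<omega>, snd z))"

lemma J_measurable: "J \<in> borel \<rightarrow>\<^sub>M prob_algebra E"
proof -
  have "(\<lambda>z. distr (path (fst z)) E ((\<lambda>z \<omega>. (\<omega>, snd z)) z)) \<in> borel \<Otimes>\<^sub>M borel \<rightarrow>\<^sub>M prob_algebra E"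
  proof (rule measurable_distr_prob_space2)
    show "(\<lambda>z. path (fst z)) \<in> borel \<Otimes>\<^sub>M (borel :: 'x measure) \<rightarrow>\<^sub>M prob_algebra paths"
      by (rule measurable_compose[OF measurable_fst path_measurable])
    show "(\<lambda>(z, \<omega>). (\<omega>, snd z)) \<in> (borel \<Otimes>\<^sub>M borel) \<Otimes>\<^sub>M paths \<rightarrow>\<^sub>M E"
      unfolding split_beta' by (intro measurable_Pair measurable_snd measurable_compose[OF measurable_fst measurable_snd])
  qed
  then show ?thesis by (simp add: J_def[abs_def] borel_prod)
qed

lemma section_measurable: "(\<lambda>\<omega>. (\<omega>, x)) \<in> paths \<rightarrow>\<^sub>M E"
  by (intro measurable_Pair measurable_ident measurable_const) simp_all

lemma nn_integral_J:
  assumes "g \<in> borel_measurable E"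
  shows "(\<integral>\<^sup>+w. g w \<partial>J z) = (\<integral>\<^sup>+\<omega>. g (\<omega>, snd z) \<partial>path (fst z))"
  unfolding J_def by (rule nn_integral_distr_prob[OF path_in_space section_measurable assms])

lemma nn_integral_path:
  assumes "g \<in> borel_measurable paths"
  shows "(\<integral>\<^sup>+\<omega>. g \<omega> \<partial>path t) = (\<integral>\<^sup>+\<omega>. g (case_nat t \<omega>) \<partial>future t)"
  unfolding path_eq_distr_future by (rule nn_integral_distr_prob[OF future_in_space measurable_case_nat_paths assms])

lemma nn_integral_J_start:
  assumes g: "g \<in> borel_measurable E" and \<phi>: "\<phi> \<in> borel_measurable borel"
  shows "(\<integral>\<^sup>+w. g w * \<phi> (start w) \<partial>J z) = (\<integral>\<^sup>+w. g w \<partial>J z) * \<phi> z"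
proof -
  have m: "(\<lambda>w. g w * \<phi> (start w)) \<in> borel_measurable E"
    by (intro borel_measurable_times_ennreal g measurable_compose[OF start_measurable \<phi>])
  have gs: "(\<lambda>\<omega>. g (\<omega>, snd z)) \<in> borel_measurable paths"
    by (rule measurable_compose[OF section_measurable g])
  have gsc: "(\<lambda>\<omega>. g (case_nat (fst z) \<omega>, snd z)) \<in> borel_measurable (future (fst z))"
    using measurable_compose[OF measurable_case_nat_paths gs] measurable_prob_cong[OF future_in_space] by blast
  have "(\<integral>\<^sup>+w. g w * \<phi> (start w) \<partial>J z)
      = (\<integral>\<^sup>+\<omega>. g (case_nat (fst z) \<omega>, snd z) * \<phi> (start (case_nat (fst z) \<omega>, snd z)) \<partial>future (fst z))"
    unfolding nn_integral_J[OF m] by (rule nn_integral_path[OF measurable_compose[OF section_measurable m]])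
  also have "\<dots> = (\<integral>\<^sup>+\<omega>. g (case_nat (fst z) \<omega>, snd z) * \<phi> z \<partial>future (fst z))"
    by (simp add: start_def)
  also have "\<dots> = (\<integral>\<^sup>+\<omega>. g (case_nat (fst z) \<omega>, snd z) \<partial>future (fst z)) * \<phi> z"
    by (rule nn_integral_multc[OF gsc])
  also have "\<dots> = (\<integral>\<^sup>+w. g w \<partial>J z) * \<phi> z"
    unfolding nn_integral_J[OF g] nn_integral_path[OF gs] ..
  finally show ?thesis .
qed

lemma nn_integral_J_of_start:
  assumes \<phi>: "\<phi> \<in> borel_measurable borel"
  shows "(\<integral>\<^sup>+w. \<phi> (start w) \<partial>J z) = \<phi> z"
proof -
  interpret prob_space "J z" using kernel_prob(1)[OF J_measurable] by simp
  show ?thesis using nn_integral_J_start[of "\<lambda>_. 1" \<phi> z, OF _ \<phi>] by (simp add: emeasure_space_1)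
qed

lemma nn_integral_K_eq_J:
  assumes g: "g \<in> borel_measurable E"
  shows "(\<integral>\<^sup>+w. g w \<partial>K z) = (\<integral>\<^sup>+u. (\<integral>\<^sup>+w. g w \<partial>J (u, snd z)) \<partial>Q (fst z))"
proof -
  have gs: "(\<lambda>\<omega>. g (\<omega>, snd z)) \<in> borel_measurable paths"
    by (rule measurable_compose[OF section_measurable g])
  have "(\<integral>\<^sup>+w. g w \<partial>K z) = (\<integral>\<^sup>+u. (\<integral>\<^sup>+\<omega>. g (\<omega>, snd z) \<partial>path u) \<partial>Q (fst z))"
    unfolding nn_integral_K[OF g] future_def by (rule nn_integral_bind_prob[OF Q_in_space path_measurable gs])
  then show ?thesis by (simp add: nn_integral_J[OF g])
qed

lemma Jg_measurable: "g \<in> borel_measurable E \<Longrightarrow> (\<lambda>z. \<integral>\<^sup>+w. g w \<partial>J z) \<in> borel_measurable borel"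
  by (rule measurable_nn_integral_kernel[OF J_measurable])

text \<open>An average of \<open>K\<close> is also an average of \<open>J\<close>, over the law of \<open>(\<omega>\<^sub>0, x)\<close>: given \<open>\<omega>\<^sub>0\<close>, the later letters
  do not depend on \<open>x\<close>.\<close>

lemma nn_integral_bind_K_start:
  assumes \<rho>: "\<rho> \<in> space (prob_algebra borel)" and g: "g \<in> borel_measurable E"
  shows "(\<integral>\<^sup>+w. g w \<partial>(\<rho> \<bind> K)) = (\<integral>\<^sup>+z. (\<integral>\<^sup>+w. g w \<partial>J z) \<partial>distr (\<rho> \<bind> K) borel start)"
proof -
  have "(\<integral>\<^sup>+z. (\<integral>\<^sup>+w. g w \<partial>J z) \<partial>distr (\<rho> \<bind> K) borel start)
      = (\<integral>\<^sup>+w. (\<integral>\<^sup>+w'. g w' \<partial>J (start w)) \<partial>(\<rho> \<bind> K))"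
    by (rule nn_integral_distr_prob[OF bind_in_space[OF \<rho> K_measurable] start_measurable Jg_measurable[OF g]])
  also have "\<dots> = (\<integral>\<^sup>+z. (\<integral>\<^sup>+w. (\<integral>\<^sup>+w'. g w' \<partial>J (start w)) \<partial>K z) \<partial>\<rho>)"
    by (rule nn_integral_bind_prob[OF \<rho> K_measurable measurable_compose[OF start_measurable Jg_measurable[OF g]]])
  also have "\<dots> = (\<integral>\<^sup>+z. (\<integral>\<^sup>+u. (\<integral>\<^sup>+w'. g w' \<partial>J (u, snd z)) \<partial>Q (fst z)) \<partial>\<rho>)"
    unfolding nn_integral_K_eq_J[OF measurable_compose[OF start_measurable Jg_measurable[OF g]]]
      nn_integral_J_of_start[OF Jg_measurable[OF g]] ..
  also have "\<dots> = (\<integral>\<^sup>+w. g w \<partial>(\<rho> \<bind> K))"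
    unfolding nn_integral_bind_prob[OF \<rho> K_measurable g] nn_integral_K_eq_J[OF g] ..
  finally show ?thesis by (rule sym)
qed

end

locale nonsingular_random_map = markov_random_map Q f
  for Q :: "'t::polish_space \<Rightarrow> 't measure" and f :: "'t \<times> 'x::polish_space \<Rightarrow> 'x" +
  fixes p :: "'t measure" and m :: "'x measure"
  assumes p: "p \<in> space (prob_algebra borel)" and m: "m \<in> space (prob_algebra borel)"
    and p_stationary: "p \<bind> Q = p"
    and nonsingular: "fibered_nonsingular f p m"
begin

sublocale p: prob_space p using p by (simp add: space_prob_algebra)
sublocale m: prob_space m using m by (simp add: space_prob_algebra)
sublocale pm: pair_prob_space p m ..

abbreviation lam :: "('t \<times> 'x) measure" where "lam \<equiv> p \<Otimes>\<^sub>M m"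

lemma sets_p: "sets p = sets borel" and sets_m: "sets m = sets borel"
  using p m by (auto simp: space_prob_algebra)

lemma sets_lam: "sets lam = sets borel"
  using sets_pair_measure_cong[OF sets_p sets_m] unfolding borel_prod .

lemma lam: "lam \<in> space (prob_algebra borel)"
  using sets_lam pm.prob_space_axioms by (simp add: space_prob_algebra)

lemma nn_integral_lam:
  assumes "g \<in> borel_measurable borel"
  shows "(\<integral>\<^sup>+z. g z \<partial>lam) = (\<integral>\<^sup>+x. (\<integral>\<^sup>+t. g (t, x) \<partial>p) \<partial>m)"
    and "(\<integral>\<^sup>+z. g z \<partial>lam) = (\<integral>\<^sup>+t. (\<integral>\<^sup>+x. g (t, x) \<partial>m) \<partial>p)"
proof -
  have "g \<in> borel_measurable lam" using assms measurable_prob_cong[OF lam] by blast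
  then show "(\<integral>\<^sup>+z. g z \<partial>lam) = (\<integral>\<^sup>+x. (\<integral>\<^sup>+t. g (t, x) \<partial>p) \<partial>m)"
    and "(\<integral>\<^sup>+z. g z \<partial>lam) = (\<integral>\<^sup>+t. (\<integral>\<^sup>+x. g (t, x) \<partial>m) \<partial>p)"
    using pm.nn_integral_snd[of g] m.nn_integral_fst[of g p] by (simp_all add: split_beta')
qed

lemma section_borel: "g \<in> borel_measurable borel \<Longrightarrow> (\<lambda>u. g (u, x :: 'x)) \<in> borel_measurable (borel :: 't measure)"
  by (rule measurable_compose[OF _, of "\<lambda>u. (u, x)" borel "borel \<Otimes>\<^sub>M borel"]) (auto simp: borel_prod[symmetric])

lemma nn_integral_lam_transition:
  assumes g: "g \<in> borel_measurable borel"
  shows "(\<integral>\<^sup>+z. (\<integral>\<^sup>+u. g (u, snd z) \<partial>Q (fst z)) \<partial>lam) = (\<integral>\<^sup>+z. g z \<partial>lam)"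
proof -
  have qm: "(\<lambda>z. \<integral>\<^sup>+u. g (u, snd z) \<partial>Q (fst z)) \<in> borel_measurable borel"
  proof -
    have "(\<lambda>z. \<integral>\<^sup>+u. (\<lambda>z u. g (u, snd z)) z u \<partial>Q (fst z)) \<in> borel_measurable (borel \<Otimes>\<^sub>M borel)"
    proof (rule nn_integral_measurable_subprob_algebra2)
      have "(\<lambda>a. g (snd a, snd (fst a))) \<in> borel_measurable ((borel \<Otimes>\<^sub>M borel) \<Otimes>\<^sub>M borel)"
        by (rule measurable_compose[OF _, where g = g, of "\<lambda>a. (snd a, snd (fst a))" _ "borel \<Otimes>\<^sub>M borel"])
          (use g in \<open>auto simp: borel_prod\<close>)
      then show "(\<lambda>(z, u). g (u, snd z)) \<in> borel_measurable ((borel \<Otimes>\<^sub>M borel) \<Otimes>\<^sub>M borel)"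
        by (simp add: split_beta')
      show "(\<lambda>z. Q (fst z)) \<in> borel \<Otimes>\<^sub>M (borel :: 'x measure) \<rightarrow>\<^sub>M subprob_algebra borel"
        by (rule measurable_compose[OF measurable_fst measurable_prob_algebraD[OF Q]])
    qed
    then show ?thesis by (simp add: borel_prod)
  qed
  have "(\<integral>\<^sup>+z. (\<integral>\<^sup>+u. g (u, snd z) \<partial>Q (fst z)) \<partial>lam) = (\<integral>\<^sup>+x. (\<integral>\<^sup>+t. (\<integral>\<^sup>+u. g (u, x) \<partial>Q t) \<partial>p) \<partial>m)"
    by (subst nn_integral_lam(1)[OF qm]) simp
  also have "\<dots> = (\<integral>\<^sup>+x. (\<integral>\<^sup>+u. g (u, x) \<partial>(p \<bind> Q)) \<partial>m)"
    by (simp only: nn_integral_bind_prob[OF p Q section_borel[OF g]])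
  also have "\<dots> = (\<integral>\<^sup>+z. g z \<partial>lam)" unfolding p_stationary nn_integral_lam(1)[OF g] ..
  finally show ?thesis .
qed

text \<open>By stationarity the letter used in one step has law \<open>p\<close> and is independent of \<open>x\<close>, so the
  mass of \<open>A\<close> is the \<open>p\<close>-average over \<open>t\<close> of the \<open>m\<close>-measure of the preimage under \<open>f\<^sub>t\<close> of the section
  of \<open>A\<close> at \<open>t\<close>. Almost every section is null.\<close>

lemma phat_null:
  assumes A: "A \<in> sets borel" and null: "emeasure lam A = 0"
  shows "emeasure (lam \<bind> ph) A = 0"
proof -
  define g :: "'t \<times> 'x \<Rightarrow> ennreal" where "g z = indicator A (fst z, f z)" for z
  have gr: "(\<lambda>z. (fst z, f z)) \<in> borel \<rightarrow>\<^sub>M borel"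
    using measurable_Pair[OF measurable_fst f_meas] by (simp add: borel_prod)
  have g: "g \<in> borel_measurable borel"
    unfolding g_def by (rule measurable_compose[OF gr borel_measurable_indicator[OF A]])
  have "emeasure (lam \<bind> ph) A = (\<integral>\<^sup>+y. indicator A y \<partial>(lam \<bind> ph))"
    using A bind_in_space[OF lam phat_measurable] by (simp add: space_prob_algebra)
  also have "\<dots> = (\<integral>\<^sup>+z. (\<integral>\<^sup>+u. g (u, snd z) \<partial>Q (fst z)) \<partial>lam)"
    unfolding nn_integral_bind_prob[OF lam phat_measurable borel_measurable_indicator[OF A]]
      nn_integral_phat[OF borel_measurable_indicator[OF A]] by (simp add: g_def)
  also have "\<dots> = (\<integral>\<^sup>+t. (\<integral>\<^sup>+x. g (t, x) \<partial>m) \<partial>p)"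
    unfolding nn_integral_lam_transition[OF g] by (rule nn_integral_lam(2)[OF g])
  also have "\<dots> = 0"
  proof -
    have A': "A \<in> sets lam" using A sets_lam by simp
    have "(\<integral>\<^sup>+t. emeasure m (Pair t -` A) \<partial>p) = 0"
      using null m.emeasure_pair_measure_alt[OF A'] by simp
    then have "AE t in p. emeasure m (Pair t -` A) = 0"
      using m.measurable_emeasure_Pair[OF A'] by (simp add: nn_integral_0_iff_AE)
    with nonsingular[unfolded fibered_nonsingular_def]
    have "AE t in p. (\<integral>\<^sup>+x. g (t, x) \<partial>m) = 0"
    proof eventually_elim
      case (elim t)
      have "Pair t -` A \<in> null_sets m" using elim(2) sets_Pair1[OF A'] by auto
      with elim(1) have N: "(\<lambda>x. f (t, x)) -` (Pair t -` A) \<inter> space m \<in> null_sets m" by blast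
      have "(\<integral>\<^sup>+x. g (t, x) \<partial>m) = (\<integral>\<^sup>+x. indicator ((\<lambda>x. f (t, x)) -` (Pair t -` A) \<inter> space m) x \<partial>m)"
        by (intro nn_integral_cong) (auto simp: g_def indicator_def)
      moreover have "\<dots> = 0" using null_setsD1[OF N] null_setsD2[OF N] by simp
      ultimately show ?case by simp
    qed
    then have "(\<integral>\<^sup>+t. (\<integral>\<^sup>+x. g (t, x) \<partial>m) \<partial>p) = (\<integral>\<^sup>+t. 0 \<partial>p)" by (rule nn_integral_cong_AE)
    then show ?thesis by simp
  qed
  finally show ?thesis .
qed

lemma start_lam: "distr (lam \<bind> K) borel start = lam"
proof (rule prob_measure_eqI)
  show "distr (lam \<bind> K) borel start \<in> space (prob_algebra borel)"
    by (rule distr_in_space[OF bind_in_space[OF lam K_measurable] start_measurable])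
  show "lam \<in> space (prob_algebra borel)" by (rule lam)
  fix g :: "'t \<times> 'x \<Rightarrow> ennreal" assume g: "g \<in> borel_measurable borel"
  note gst = measurable_compose[OF start_measurable g]
  have "(\<integral>\<^sup>+y. g y \<partial>distr (lam \<bind> K) borel start) = (\<integral>\<^sup>+z. (\<integral>\<^sup>+w. g (start w) \<partial>K z) \<partial>lam)"
    unfolding nn_integral_distr_prob[OF bind_in_space[OF lam K_measurable] start_measurable g]
    by (rule nn_integral_bind_prob[OF lam K_measurable gst])
  also have "\<dots> = (\<integral>\<^sup>+z. g z \<partial>lam)"
    unfolding nn_integral_K_eq_J[OF gst] nn_integral_J_of_start[OF g] by (rule nn_integral_lam_transition[OF g])
  finally show "(\<integral>\<^sup>+y. g y \<partial>distr (lam \<bind> K) borel start) = (\<integral>\<^sup>+z. g z \<partial>lam)" .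
qed

text \<open>Both sides are the average of \<open>J\<close> over \<open>lam\<close>: on the left because \<open>\<P>\<close> is the average of \<open>path\<close> over
  \<open>p\<close>, on the right because \<open>(\<omega>\<^sub>0, x)\<close> again has law \<open>lam\<close>.\<close>

lemma pair_markov_measure:
  assumes P: "markov_measure Q p \<P>"
  shows "\<P> \<Otimes>\<^sub>M m = lam \<bind> K" "sets (\<P> \<Otimes>\<^sub>M m) = sets E"
proof -
  have P_eq: "\<P> = p \<bind> path" by (rule markov_measure_eq_bind_path[OF P p])
  have Psp: "\<P> \<in> space (prob_algebra paths)" unfolding P_eq by (rule bind_path_in_space[OF p])
  interpret P: prob_space \<P> using Psp by (simp add: space_prob_algebra)
  interpret Pm: pair_prob_space \<P> m ..
  have sP: "sets \<P> = sets paths" using Psp by (simp add: space_prob_algebra)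
  show s: "sets (\<P> \<Otimes>\<^sub>M m) = sets E" by (rule sets_pair_measure_cong[OF sP sets_m])
  then have Pmsp: "\<P> \<Otimes>\<^sub>M m \<in> space (prob_algebra E)" using Pm.prob_space_axioms by (simp add: space_prob_algebra)
  show "\<P> \<Otimes>\<^sub>M m = lam \<bind> K"
  proof (rule prob_measure_eqI[OF Pmsp bind_in_space[OF lam K_measurable]])
    fix g :: "(nat \<Rightarrow> 't) \<times> 'x \<Rightarrow> ennreal" assume g: "g \<in> borel_measurable E"
    have "g \<in> borel_measurable (\<P> \<Otimes>\<^sub>M m)" using g measurable_prob_cong[OF Pmsp] by blast
    then have "(\<integral>\<^sup>+w. g w \<partial>(\<P> \<Otimes>\<^sub>M m)) = (\<integral>\<^sup>+x. (\<integral>\<^sup>+\<omega>. g (\<omega>, x) \<partial>\<P>) \<partial>m)"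
      using Pm.nn_integral_snd[of g] by (simp add: split_beta')
    also have "\<dots> = (\<integral>\<^sup>+x. (\<integral>\<^sup>+t. (\<integral>\<^sup>+w. g w \<partial>J (t, x)) \<partial>p) \<partial>m)"
      unfolding P_eq nn_integral_J[OF g]
      by (simp add: nn_integral_bind_prob[OF p path_measurable measurable_compose[OF section_measurable g]])
    also have "\<dots> = (\<integral>\<^sup>+z. (\<integral>\<^sup>+w. g w \<partial>J z) \<partial>lam)"
      by (rule nn_integral_lam(1)[OF Jg_measurable[OF g], symmetric])
    also have "\<dots> = (\<integral>\<^sup>+w. g w \<partial>(lam \<bind> K))"
      using nn_integral_bind_K_start[OF lam g] by (simp only: start_lam)
    finally show "(\<integral>\<^sup>+w. g w \<partial>(\<P> \<Otimes>\<^sub>M m)) = (\<integral>\<^sup>+w. g w \<partial>(lam \<bind> K))" .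
  qed
qed

end

section \<open>The ergodic components are Markovian physical measures\<close>

text \<open>Countably many conditions, which makes the basins measurable.\<close>

lemma LIMSEQ_countable:
  fixes X :: "nat \<Rightarrow> real"
  shows "X \<longlonglongrightarrow> c \<longleftrightarrow> (\<forall>k::nat. \<exists>N::nat. \<forall>n\<ge>N. dist (X n) c < inverse (real (Suc k)))"
proof
  assume "X \<longlonglongrightarrow> c"
  then show "\<forall>k::nat. \<exists>N::nat. \<forall>n\<ge>N. dist (X n) c < inverse (real (Suc k))"
    by (simp add: lim_sequentially)
next
  assume *: "\<forall>k::nat. \<exists>N::nat. \<forall>n\<ge>N. dist (X n) c < inverse (real (Suc k))"
  show "X \<longlonglongrightarrow> c"
  proof (rule metric_LIMSEQ_I)
    fix e :: real assume "0 < e"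
    then obtain k where "inverse (real (Suc k)) < e" using reals_Archimedean by blast
    with * show "\<exists>N. \<forall>n\<ge>N. dist (X n) c < e" by (meson less_trans)
  qed
qed

lemma birkhoff_basin_sets:
  assumes F: "F \<in> M \<rightarrow>\<^sub>M M" and \<phi>: "\<phi> \<in> borel_measurable M" and sp: "space M = UNIV"
  shows "birkhoff_basin F \<mu> \<phi> \<in> sets M"
proof -
  have m: "(\<lambda>z. (1 / real n) * (\<Sum>j<n. \<phi> ((F ^^ j) z))) \<in> borel_measurable M" for n
    by (intro borel_measurable_times borel_measurable_const borel_measurable_sum measurable_compose[OF measurable_funpow[OF F] \<phi>])
  have "{z \<in> space M. \<forall>k::nat. \<exists>N::nat. \<forall>n\<ge>N.
      dist ((1 / real n) * (\<Sum>j<n. \<phi> ((F ^^ j) z))) (\<integral>w. \<phi> w \<partial>\<mu>) < inverse (real (Suc k))} \<in> sets M"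
    using m by measurable
  then show ?thesis unfolding birkhoff_basin_def LIMSEQ_countable sp by simp
qed

text \<open>A stationary law as \<open>stationary_limit\<close> provides it.\<close>

locale stationary_random_map = nonsingular_random_map Q f p m
  for Q :: "'t::polish_space \<Rightarrow> 't measure" and f :: "'t \<times> 'x::polish_space \<Rightarrow> 'x"
    and p :: "'t measure" and m :: "'x measure" +
  fixes \<rho> :: "('t \<times> 'x) measure"
  assumes unique: "\<And>q. stationary Q q \<Longrightarrow> q = p"
    and \<rho>: "\<rho> \<in> space (prob_algebra borel)" and \<rho>_stationary: "\<rho> \<bind> ph = \<rho>"
    and \<rho>_ac: "absolutely_continuous lam \<rho>"
begin

definition \<mu> :: "((nat \<Rightarrow> 't) \<times> 'x) measure" where "\<mu> = \<rho> \<bind> K"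

lemma \<mu>_in_space: "\<mu> \<in> space (prob_algebra E)"
  unfolding \<mu>_def by (rule bind_in_space[OF \<rho> K_measurable])

sublocale \<mu>: prob_space \<mu> using \<mu>_in_space by (simp add: space_prob_algebra)

lemma sets_\<mu>: "sets \<mu> = sets E" using \<mu>_in_space by (simp add: space_prob_algebra)

lemma space_\<mu>: "space \<mu> = UNIV" using sets_eq_imp_space_eq[OF sets_\<mu>] by (simp add: space_E)

lemma distr_\<mu>_F: "distr \<mu> E F = \<mu>"
  unfolding \<mu>_def distr_bind_K_F[OF \<rho>] \<rho>_stationary ..

definition \<nu> :: "('t \<times> 'x) measure" where "\<nu> = distr \<mu> borel start"

lemma \<nu>_in_space: "\<nu> \<in> space (prob_algebra borel)"
  unfolding \<nu>_def by (rule distr_in_space[OF \<mu>_in_space start_measurable])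

lemma AE_lam_imp_AE_\<rho>:
  assumes "AE z in lam. P z" shows "AE z in \<rho>. P z"
  using absolutely_continuous_AE[OF _ \<rho>_ac assms] \<rho> sets_lam by (simp add: space_prob_algebra)

lemma \<mu>_ac: "absolutely_continuous (lam \<bind> K) \<mu>"
  unfolding absolutely_continuous_def
proof
  fix D assume "D \<in> null_sets (lam \<bind> K)"
  then have D: "D \<in> sets E" "emeasure (lam \<bind> K) D = 0"
    using bind_in_space[OF lam K_measurable] by (auto simp: space_prob_algebra)
  have mD: "(\<lambda>z. emeasure (K z) D) \<in> borel_measurable borel"
    by (rule measurable_compose[OF measurable_prob_algebraD[OF K_measurable] measurable_emeasure_subprob_algebra[OF D(1)]])
  have "AE z in lam. emeasure (K z) D = 0"
    using D(2) mD measurable_prob_cong[OF lam] unfolding emeasure_bind_prob_algebra[OF lam K_measurable D(1)]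
    by (subst (asm) nn_integral_0_iff_AE) auto
  from AE_lam_imp_AE_\<rho>[OF this] have "emeasure \<mu> D = (\<integral>\<^sup>+z. 0 \<partial>\<rho>)"
    unfolding \<mu>_def emeasure_bind_prob_algebra[OF \<rho> K_measurable D(1)] by (rule nn_integral_cong_AE)
  then show "D \<in> null_sets \<mu>" using D(1) sets_\<mu> by auto
qed

lemma \<nu>_ac: "absolutely_continuous lam \<nu>"
  unfolding absolutely_continuous_def
proof
  fix A assume "A \<in> null_sets lam"
  then have A: "A \<in> sets borel" "emeasure lam A = 0" using sets_lam by auto
  have st: "start -` A \<in> sets E" using measurable_sets[OF start_measurable A(1)] by (simp add: space_E)
  have "emeasure (lam \<bind> K) (start -` A) = emeasure (distr (lam \<bind> K) borel start) A"
    using start_measurable measurable_prob_cong[OF bind_in_space[OF lam K_measurable]] A(1)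
      bind_in_space[OF lam K_measurable] sets_eq_imp_space_eq[of "lam \<bind> K" E]
    by (subst emeasure_distr) (auto simp: space_prob_algebra space_E)
  then have "start -` A \<in> null_sets (lam \<bind> K)"
    using A(2) st bind_in_space[OF lam K_measurable] by (auto simp: start_lam space_prob_algebra)
  then have "start -` A \<in> null_sets \<mu>" using \<mu>_ac by (auto simp: absolutely_continuous_def)
  then have "emeasure \<nu> A = 0"
    unfolding \<nu>_def using start_measurable measurable_prob_cong[OF \<mu>_in_space] A(1)
    by (subst emeasure_distr) (auto simp: space_\<mu>)
  then show "A \<in> null_sets \<nu>" using A(1) by (auto simp: \<nu>_def)
qed

definition dens :: "'t \<times> 'x \<Rightarrow> ennreal" where "dens = RN_deriv lam \<nu>"

lemma dens_measurable: "dens \<in> borel_measurable borel"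
  unfolding dens_def using borel_measurable_RN_deriv[of lam \<nu>] measurable_prob_cong[OF lam] by blast

lemma nn_integral_\<nu>:
  assumes "g \<in> borel_measurable borel"
  shows "(\<integral>\<^sup>+z. g z \<partial>\<nu>) = (\<integral>\<^sup>+z. dens z * g z \<partial>lam)"
proof -
  have "sets \<nu> = sets lam" using \<nu>_in_space sets_lam by (simp add: space_prob_algebra)
  then have "density lam dens = \<nu>" unfolding dens_def by (rule pm.density_RN_deriv[OF \<nu>_ac])
  then have "(\<integral>\<^sup>+z. g z \<partial>\<nu>) = (\<integral>\<^sup>+z. g z \<partial>density lam dens)" by simp
  also have "\<dots> = (\<integral>\<^sup>+z. dens z * g z \<partial>lam)"
    using assms dens_measurable measurable_prob_cong[OF lam] by (intro nn_integral_density) blast+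
  finally show ?thesis .
qed

lemma nn_integral_\<mu>:
  assumes "g \<in> borel_measurable E"
  shows "(\<integral>\<^sup>+w. g w \<partial>\<mu>) = (\<integral>\<^sup>+z. (\<integral>\<^sup>+w. g w \<partial>J z) \<partial>\<nu>)"
  unfolding \<nu>_def \<mu>_def by (rule nn_integral_bind_K_start[OF \<rho> assms])

text \<open>The density of the conditional measure \<open>\<mu>(\<cdot> | C)\<close>, as a function of \<open>(\<omega>\<^sub>0, x)\<close>. By the zero-one law
  the indicator of \<open>C\<close> may be replaced by the conditional probability at the next state
  \<open>(\<omega>\<^sub>0, f (\<omega>\<^sub>0, x))\<close>.\<close>

definition cond_dens :: "((nat \<Rightarrow> 't) \<times> 'x) set \<Rightarrow> 't \<times> 'x \<Rightarrow> ennreal" where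
  "cond_dens C z = dens z * (ennreal (prob_in C (fst z, f z)) / emeasure \<mu> C)"

lemma graph_f_measurable: "(\<lambda>z. (fst z, f z)) \<in> borel \<rightarrow>\<^sub>M borel"
  using measurable_Pair[OF measurable_fst f_meas] by (simp add: borel_prod)

lemma prob_in_graph_measurable:
  assumes "C \<in> sets E"
  shows "(\<lambda>z. ennreal (prob_in C (fst z, f z)) / emeasure \<mu> C) \<in> borel_measurable borel"
  using measurable_compose[OF graph_f_measurable prob_in_measurable[OF assms]]
  by (intro borel_measurable_divide_ennreal) auto

lemma cond_dens_measurable:
  assumes "C \<in> sets E" shows "cond_dens C \<in> borel_measurable borel"
  unfolding cond_dens_def[abs_def]
  by (rule borel_measurable_times_ennreal[OF dens_measurable prob_in_graph_measurable[OF assms]])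

context
  fixes C assumes C: "strictly_invariant C" and C_pos: "emeasure \<mu> C \<noteq> 0"
begin

abbreviation "\<mu>C \<equiv> uniform_measure \<mu> C"

lemma C_sets: "C \<in> sets E" "C \<in> sets \<mu>"
  using strictly_invariantD(1)[OF C] sets_\<mu> by auto

lemma \<mu>C_in_space: "\<mu>C \<in> space (prob_algebra E)"
  using prob_space_uniform_measure[OF C_pos] sets_\<mu> by (simp add: space_prob_algebra \<mu>.emeasure_eq_measure)

lemma nn_integral_\<mu>C:
  assumes g: "g \<in> borel_measurable E"
  shows "(\<integral>\<^sup>+w. g w \<partial>\<mu>C) = (\<integral>\<^sup>+z. (\<integral>\<^sup>+w. g w \<partial>J z) * cond_dens C z \<partial>lam)"
proof -
  define \<phi> where "\<phi> z = ennreal (prob_in C (fst z, f z)) / emeasure \<mu> C" for z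
  have \<phi>: "\<phi> \<in> borel_measurable borel" unfolding \<phi>_def by (rule prob_in_graph_measurable[OF C_sets(1)])
  have gm: "g \<in> borel_measurable \<mu>" using g measurable_prob_cong[OF \<mu>_in_space] by blast
  have "(\<integral>\<^sup>+w. g w \<partial>\<mu>C) = (\<integral>\<^sup>+w. indicator C w / emeasure \<mu> C * g w \<partial>\<mu>)"
    unfolding uniform_measure_def using C_sets(2) gm
    by (intro nn_integral_density borel_measurable_divide_ennreal) auto
  also have "\<dots> = (\<integral>\<^sup>+w. g w * \<phi> (start w) \<partial>\<mu>)"
    using prob_in_next_state_eq_indicator[OF \<rho> \<rho>_stationary C, folded \<mu>_def]
  proof (intro nn_integral_cong_AE, eventually_elim)
    case (elim w)
    have "prob_in C (fst (start w), f (start w)) = indicator C w"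
      using elim by (simp add: start_def next_state_def)
    then show ?case by (simp add: \<phi>_def mult.commute indicator_def)
  qed
  also have "\<dots> = (\<integral>\<^sup>+z. (\<integral>\<^sup>+w. g w \<partial>J z) * \<phi> z \<partial>\<nu>)"
  proof -
    have "(\<lambda>w. g w * \<phi> (start w)) \<in> borel_measurable E"
      by (intro borel_measurable_times_ennreal g measurable_compose[OF start_measurable \<phi>])
    then show ?thesis by (simp only: nn_integral_\<mu> nn_integral_J_start[OF g \<phi>])
  qed
  also have "\<dots> = (\<integral>\<^sup>+z. dens z * ((\<integral>\<^sup>+w. g w \<partial>J z) * \<phi> z) \<partial>lam)"
    by (intro nn_integral_\<nu> borel_measurable_times_ennreal Jg_measurable g \<phi>)
  also have "\<dots> = (\<integral>\<^sup>+z. (\<integral>\<^sup>+w. g w \<partial>J z) * cond_dens C z \<partial>lam)"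
    by (simp add: cond_dens_def \<phi>_def mult_ac)
  finally show ?thesis .
qed

lemma nn_integral_\<mu>C_start:
  assumes \<phi>: "\<phi> \<in> borel_measurable borel"
  shows "(\<integral>\<^sup>+w. \<phi> (start w) \<partial>\<mu>C) = (\<integral>\<^sup>+z. \<phi> z * cond_dens C z \<partial>lam)"
  unfolding nn_integral_\<mu>C[OF measurable_compose[OF start_measurable \<phi>]] nn_integral_J_of_start[OF \<phi>] ..

lemma emeasure_\<mu>C:
  assumes D: "D \<in> sets E"
  shows "emeasure \<mu>C D = (\<integral>\<^sup>+w. indicator D w * cond_dens C (start w) \<partial>(lam \<bind> K))"
proof -
  have i: "(indicator D :: _ \<Rightarrow> ennreal) \<in> borel_measurable E" using D by simp
  note cd = cond_dens_measurable[OF C_sets(1)]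
  have i': "(\<lambda>w. indicator D w * cond_dens C (start w)) \<in> borel_measurable E"
    by (intro borel_measurable_times_ennreal i measurable_compose[OF start_measurable cd])
  have "emeasure \<mu>C D = (\<integral>\<^sup>+w. indicator D w \<partial>\<mu>C)" using D sets_\<mu> by simp
  then show ?thesis
    unfolding nn_integral_\<mu>C[OF i] nn_integral_bind_K_start[OF lam i'] start_lam nn_integral_J_start[OF i cd] .
qed

lemma distr_\<mu>C_F: "distr \<mu>C E F = \<mu>C"
proof (rule measure_eqI)
  show "sets (distr \<mu>C E F) = sets \<mu>C" using sets_\<mu> by simp
  fix A assume "A \<in> sets (distr \<mu>C E F)"
  then have A: "A \<in> sets E" by simp
  have FA: "F -` A \<in> sets E" using measurable_sets[OF F_measurable A] by (simp add: space_E)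
  have F\<mu>: "F \<in> \<mu> \<rightarrow>\<^sub>M E" using F_measurable measurable_prob_cong[OF \<mu>_in_space] by blast
  have "emeasure \<mu> (C \<inter> F -` A) = emeasure \<mu> (F -` (C \<inter> A))" using strictly_invariantD(2)[OF C] by simp
  also have "\<dots> = emeasure (distr \<mu> E F) (C \<inter> A)"
    using F\<mu> A C_sets(1) by (simp add: emeasure_distr space_\<mu>)
  finally have "emeasure \<mu> (C \<inter> F -` A) = emeasure \<mu> (C \<inter> A)" by (simp add: distr_\<mu>_F)
  then show "emeasure (distr \<mu>C E F) A = emeasure \<mu>C A"
    using F_measurable A FA C_sets(2) sets_\<mu> measurable_prob_cong[OF \<mu>C_in_space]
    by (simp add: emeasure_distr space_\<mu>)
qed

lemma nn_integral_path_0: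
  assumes \<phi>: "\<phi> \<in> borel_measurable borel"
  shows "(\<integral>\<^sup>+\<omega>. \<phi> (\<omega> 0) \<partial>path t) = \<phi> t"
proof -
  interpret prob_space "future t" using future_in_space by (simp add: space_prob_algebra)
  have "(\<lambda>\<omega>. \<phi> (\<omega> 0)) \<in> borel_measurable paths"
    by (rule measurable_compose[OF measurable_component_singleton[of 0] \<phi>]) simp
  then show ?thesis by (simp add: nn_integral_path emeasure_space_1)
qed

lemma nn_integral_fst_\<mu>C:
  assumes \<psi>: "\<psi> \<in> borel_measurable paths"
  shows "(\<integral>\<^sup>+w. \<psi> (fst w) \<partial>\<mu>C) = (\<integral>\<^sup>+w. (\<integral>\<^sup>+\<omega>. \<psi> \<omega> \<partial>path (fst w 0)) \<partial>\<mu>C)"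
proof -
  have pm: "(\<lambda>t. \<integral>\<^sup>+\<omega>. \<psi> \<omega> \<partial>path t) \<in> borel_measurable borel"
    by (rule measurable_nn_integral_kernel[OF path_measurable \<psi>])
  have pm': "(\<lambda>z :: 't \<times> 'x. \<integral>\<^sup>+\<omega>. \<psi> \<omega> \<partial>path (fst z)) \<in> borel_measurable borel"
    using measurable_compose[OF measurable_fst pm] by (simp add: borel_prod[symmetric])
  show ?thesis
    unfolding nn_integral_\<mu>C[OF measurable_compose[OF measurable_fst \<psi>]] nn_integral_J[OF measurable_compose[OF measurable_fst \<psi>]]
    using nn_integral_\<mu>C_start[OF pm'] by (simp add: start_def)
qed

text \<open>This is where uniqueness of the stationary measure enters. By invariance the law of \<open>\<omega>\<^sub>0\<close> is also that
  of \<open>\<omega>\<^sub>1\<close>, which is its image under \<open>Q\<close>, because \<open>\<mu>C\<close> is an average of the laws \<open>J\<close>.\<close>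

lemma distr_\<mu>C_fst_0: "distr \<mu>C borel (\<lambda>w. fst w 0) = p"
proof (rule unique)
  define q where "q = distr \<mu>C borel (\<lambda>w. fst w 0)"
  have q: "q \<in> space (prob_algebra borel)"
    unfolding q_def by (rule distr_in_space[OF \<mu>C_in_space fst_0_measurable])
  have "q = q \<bind> Q"
  proof (rule prob_measure_eqI[OF q bind_in_space[OF q Q]])
    fix \<phi> :: "'t \<Rightarrow> ennreal" assume \<phi>: "\<phi> \<in> borel_measurable borel"
    have \<phi>0: "(\<lambda>\<omega>. \<phi> (\<omega> 0)) \<in> borel_measurable paths"
      by (rule measurable_compose[OF measurable_component_singleton[of 0] \<phi>]) simp
    have "(\<integral>\<^sup>+t. \<phi> t \<partial>q) = (\<integral>\<^sup>+w. \<phi> (fst w 0) \<partial>\<mu>C)"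
      unfolding q_def by (rule nn_integral_distr_prob[OF \<mu>C_in_space fst_0_measurable \<phi>])
    also have "\<dots> = (\<integral>\<^sup>+w. \<phi> (fst w 0) \<partial>distr \<mu>C E F)" by (simp only: distr_\<mu>C_F)
    also have "\<dots> = (\<integral>\<^sup>+w. \<phi> (fst (F w) 0) \<partial>\<mu>C)"
      by (rule nn_integral_distr_prob[OF \<mu>C_in_space F_measurable measurable_compose[OF fst_0_measurable \<phi>]])
    also have "\<dots> = (\<integral>\<^sup>+w. \<phi> (shift (fst w) 0) \<partial>\<mu>C)" by (simp add: skew_product_def split_beta)
    also have "\<dots> = (\<integral>\<^sup>+w. (\<integral>\<^sup>+\<omega>. \<phi> (shift \<omega> 0) \<partial>path (fst w 0)) \<partial>\<mu>C)"
      by (rule nn_integral_fst_\<mu>C[OF measurable_compose[OF measurable_shift \<phi>0]])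
    also have "\<dots> = (\<integral>\<^sup>+w. (\<integral>\<^sup>+u. \<phi> u \<partial>Q (fst w 0)) \<partial>\<mu>C)"
    proof (rule nn_integral_cong)
      fix w :: "(nat \<Rightarrow> 't) \<times> 'x"
      have "(\<integral>\<^sup>+\<omega>. \<phi> (shift \<omega> 0) \<partial>path (fst w 0)) = (\<integral>\<^sup>+\<omega>. \<phi> (\<omega> 0) \<partial>future (fst w 0))"
        unfolding nn_integral_path[OF measurable_compose[OF measurable_shift \<phi>0]] by (simp add: shift_def)
      also have "\<dots> = (\<integral>\<^sup>+u. \<phi> u \<partial>Q (fst w 0))"
        unfolding future_def nn_integral_bind_prob[OF Q_in_space path_measurable \<phi>0] nn_integral_path_0[OF \<phi>] ..
      finally show "(\<integral>\<^sup>+\<omega>. \<phi> (shift \<omega> 0) \<partial>path (fst w 0)) = (\<integral>\<^sup>+u. \<phi> u \<partial>Q (fst w 0))" .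
    qed
    also have "\<dots> = (\<integral>\<^sup>+t. (\<integral>\<^sup>+u. \<phi> u \<partial>Q t) \<partial>q)"
      unfolding q_def
      by (rule nn_integral_distr_prob[OF \<mu>C_in_space fst_0_measurable measurable_nn_integral_kernel[OF Q \<phi>], symmetric])
    also have "\<dots> = (\<integral>\<^sup>+u. \<phi> u \<partial>(q \<bind> Q))" by (rule nn_integral_bind_prob[OF q Q \<phi>, symmetric])
    finally show "(\<integral>\<^sup>+t. \<phi> t \<partial>q) = (\<integral>\<^sup>+u. \<phi> u \<partial>(q \<bind> Q))" .
  qed
  with q show "stationary Q (distr \<mu>C borel (\<lambda>w. fst w 0))"
    unfolding stationary_def q_def[symmetric] by (simp add: space_prob_algebra)
qed

lemma distr_\<mu>C_fst: "distr \<mu>C paths fst = p \<bind> path"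
proof (rule prob_measure_eqI)
  show "distr \<mu>C paths fst \<in> space (prob_algebra paths)" by (rule distr_in_space[OF \<mu>C_in_space measurable_fst])
  show "p \<bind> path \<in> space (prob_algebra paths)" by (rule bind_path_in_space[OF p])
  fix \<psi> :: "(nat \<Rightarrow> 't) \<Rightarrow> ennreal" assume \<psi>: "\<psi> \<in> borel_measurable paths"
  have "(\<integral>\<^sup>+\<omega>. \<psi> \<omega> \<partial>distr \<mu>C paths fst) = (\<integral>\<^sup>+w. (\<integral>\<^sup>+\<omega>. \<psi> \<omega> \<partial>path (fst w 0)) \<partial>\<mu>C)"
    unfolding nn_integral_distr_prob[OF \<mu>C_in_space measurable_fst \<psi>] by (rule nn_integral_fst_\<mu>C[OF \<psi>])
  also have "\<dots> = (\<integral>\<^sup>+t. (\<integral>\<^sup>+\<omega>. \<psi> \<omega> \<partial>path t) \<partial>distr \<mu>C borel (\<lambda>w. fst w 0))"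
    by (rule nn_integral_distr_prob[OF \<mu>C_in_space fst_0_measurable measurable_nn_integral_kernel[OF path_measurable \<psi>], symmetric])
  also have "\<dots> = (\<integral>\<^sup>+\<omega>. \<psi> \<omega> \<partial>(p \<bind> path))"
    unfolding distr_\<mu>C_fst_0 by (rule nn_integral_bind_prob[OF p path_measurable \<psi>, symmetric])
  finally show "(\<integral>\<^sup>+\<omega>. \<psi> \<omega> \<partial>distr \<mu>C paths fst) = (\<integral>\<^sup>+\<omega>. \<psi> \<omega> \<partial>(p \<bind> path))" .
qed

definition fibre_mass :: "'t \<Rightarrow> ennreal" where "fibre_mass t = (\<integral>\<^sup>+x. cond_dens C (t, x) \<partial>m)"

lemma cond_dens_pair: "cond_dens C \<in> borel_measurable (borel \<Otimes>\<^sub>M m)"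
proof -
  have "sets (borel \<Otimes>\<^sub>M m) = sets (borel :: ('t \<times> 'x) measure)"
    using sets_pair_measure_cong[OF refl[of "sets (borel :: 't measure)"] sets_m] unfolding borel_prod .
  then show ?thesis using cond_dens_measurable[OF C_sets(1)] measurable_cong_sets by blast
qed

lemma fibre_mass_measurable: "fibre_mass \<in> borel_measurable borel"
  unfolding fibre_mass_def[abs_def] using m.borel_measurable_nn_integral_fst[OF cond_dens_pair] .

text \<open>The law of \<open>\<omega>\<^sub>0\<close> under \<open>\<mu>C\<close> has density \<open>fibre_mass\<close> with respect to \<open>p\<close>, and it equals \<open>p\<close>.\<close>

lemma AE_fibre_mass: "AE t in p. fibre_mass t = 1"
proof -
  have mp: "fibre_mass \<in> borel_measurable p" using fibre_mass_measurable measurable_prob_cong[OF p] by blast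
  have "density p fibre_mass = density p (\<lambda>_. 1)"
  proof (rule measure_eqI)
    fix A assume "A \<in> sets (density p fibre_mass)"
    then have A: "A \<in> sets borel" "A \<in> sets p" using sets_p by auto
    have ind: "(\<lambda>z :: 't \<times> 'x. indicator A (fst z) :: ennreal) \<in> borel_measurable borel"
      using measurable_compose[OF measurable_fst borel_measurable_indicator[OF A(1)]] by (simp add: borel_prod[symmetric])
    have "emeasure p A = (\<integral>\<^sup>+t. indicator A t \<partial>distr \<mu>C borel (\<lambda>w. fst w 0))"
      unfolding distr_\<mu>C_fst_0 using A(2) by simp
    also have "\<dots> = (\<integral>\<^sup>+w. indicator A (fst (start w)) \<partial>\<mu>C)"
      using nn_integral_distr_prob[OF \<mu>C_in_space fst_0_measurable borel_measurable_indicator[OF A(1)]] by (simp add: start_def)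
    also have "\<dots> = (\<integral>\<^sup>+z. indicator A (fst z) * cond_dens C z \<partial>lam)" by (rule nn_integral_\<mu>C_start[OF ind])
    also have "\<dots> = (\<integral>\<^sup>+t. (\<integral>\<^sup>+x. indicator A t * cond_dens C (t, x) \<partial>m) \<partial>p)"
      using nn_integral_lam(2)[OF borel_measurable_times_ennreal[OF ind cond_dens_measurable[OF C_sets(1)]]] by simp
    also have "\<dots> = (\<integral>\<^sup>+t. fibre_mass t * indicator A t \<partial>p)"
    proof (rule nn_integral_cong)
      fix t
      have "(\<lambda>x. cond_dens C (t, x)) \<in> borel_measurable m"
        using measurable_Pair2[OF cond_dens_pair, of t] by simp
      then show "(\<integral>\<^sup>+x. indicator A t * cond_dens C (t, x) \<partial>m) = fibre_mass t * indicator A t"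
        by (simp add: nn_integral_cmult fibre_mass_def mult.commute)
    qed
    also have "\<dots> = emeasure (density p fibre_mass) A" using mp A(2) by (simp add: emeasure_density)
    finally show "emeasure (density p fibre_mass) A = emeasure (density p (\<lambda>_. 1)) A" by (simp add: density_1)
  qed simp
  then show ?thesis using mp by (subst (asm) p.density_unique_iff) auto
qed

text \<open>The fibre measures of \<open>\<mu>C\<close>; on the null set of letters where the density does not have
  integral 1, the value \<open>m\<close> keeps them probabilities.\<close>

definition fibre :: "'t \<Rightarrow> 'x measure" where
  "fibre t = (if fibre_mass t = 1 then density m (\<lambda>x. cond_dens C (t, x)) else m)"

lemma fibre_measurable: "fibre \<in> borel \<rightarrow>\<^sub>M prob_algebra borel"
proof (rule measurable_prob_algebraI)
  have dm: "(\<lambda>x. cond_dens C (t, x)) \<in> borel_measurable m" for t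
    using measurable_Pair2[OF cond_dens_pair, of t] by simp
  show pr: "prob_space (fibre t)" for t
  proof (cases "fibre_mass t = 1")
    case True
    then have "emeasure (density m (\<lambda>x. cond_dens C (t, x))) (space m) = 1"
      using dm by (simp add: emeasure_density fibre_mass_def nn_integral_set_ennreal[symmetric] cong: nn_integral_cong)
    then show ?thesis using True by (auto simp: fibre_def intro: prob_spaceI)
  next
    case False
    then show ?thesis by (simp add: fibre_def m.prob_space_axioms)
  qed
  show "fibre \<in> borel \<rightarrow>\<^sub>M subprob_algebra borel"
  proof (rule measurable_subprob_algebra)
    show "subprob_space (fibre t)" for t using pr by (rule prob_space_imp_subprob_space)
    show "sets (fibre t) = sets borel" for t using sets_m by (simp add: fibre_def)
    fix B :: "'x set" assume "B \<in> sets borel"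
    then have B: "B \<in> sets m" using sets_m by simp
    have "emeasure (fibre t) B = (if fibre_mass t = 1 then \<integral>\<^sup>+x. cond_dens C (t, x) * indicator B x \<partial>m else emeasure m B)" for t
      using dm B by (simp add: fibre_def emeasure_density)
    moreover have "(\<lambda>t. \<integral>\<^sup>+x. cond_dens C (t, x) * indicator B x \<partial>m) \<in> borel_measurable borel"
    proof -
      have "(\<lambda>z. cond_dens C z * indicator B (snd z)) \<in> borel_measurable (borel \<Otimes>\<^sub>M m)"
        by (intro borel_measurable_times_ennreal cond_dens_pair measurable_compose[OF measurable_snd borel_measurable_indicator[OF B]])
      from m.borel_measurable_nn_integral_fst[OF this] show ?thesis by simp
    qed
    ultimately show "(\<lambda>t. emeasure (fibre t) B) \<in> borel_measurable borel"
      using fibre_mass_measurable by simp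
  qed
qed

lemma markovian_\<mu>C:
  assumes P: "markov_measure Q p \<P>"
  shows "markovian_measure \<P> m F \<mu>C"
  unfolding markovian_measure_def
proof (intro conjI exI[of _ fibre])
  note PmK = pair_markov_measure[OF P]
  have P_eq: "\<P> = p \<bind> path" by (rule markov_measure_eq_bind_path[OF P p])
  have Psp: "\<P> \<in> space (prob_algebra paths)" unfolding P_eq by (rule bind_path_in_space[OF p])
  interpret P: prob_space \<P> using Psp by (simp add: space_prob_algebra)
  interpret Pm: pair_prob_space \<P> m ..
  show "prob_space \<mu>C" using \<mu>C_in_space by (simp add: space_prob_algebra)
  show "sets \<mu>C = sets (\<P> \<Otimes>\<^sub>M m)" using sets_\<mu> PmK(2) by simp
  have sC: "sets \<mu>C = sets E" using sets_\<mu> by simp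
  show "invariant_measure F \<mu>C"
    unfolding invariant_measure_def
  proof
    show "F \<in> \<mu>C \<rightarrow>\<^sub>M \<mu>C" using F_measurable measurable_cong_sets[OF sC sC] by blast
    show "distr \<mu>C \<mu>C F = \<mu>C" using distr_\<mu>C_F distr_cong[OF refl sC, of \<mu>C F F] by simp
  qed
  have "distr \<mu>C \<P> fst = distr \<mu>C paths fst"
    using Psp by (intro distr_cong) (auto simp: space_prob_algebra)
  then show "distr \<mu>C \<P> fst = \<P>" by (simp only: distr_\<mu>C_fst P_eq)
  show "fibre \<in> borel \<rightarrow>\<^sub>M prob_algebra borel" by (rule fibre_measurable)
  show "\<forall>D\<in>sets \<mu>C. emeasure \<mu>C D = (\<integral>\<^sup>+\<omega>. emeasure (fibre (\<omega> 0)) (Pair \<omega> -` D) \<partial>\<P>)"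
  proof
    fix D assume "D \<in> sets \<mu>C"
    then have D: "D \<in> sets E" "D \<in> sets (\<P> \<Otimes>\<^sub>M m)" using sC PmK(2) by auto
    have AE_P: "AE \<omega> in \<P>. fibre_mass (\<omega> 0) = 1"
    proof -
      define Z where "Z = {t. fibre_mass t \<noteq> 1}"
      have Z: "Z \<in> sets borel" unfolding Z_def using borel_measurable_neq[OF fibre_mass_measurable borel_measurable_const[of 1]] by simp
      have i0: "(\<lambda>\<omega>. indicator Z (\<omega> 0) :: ennreal) \<in> borel_measurable paths"
        by (rule measurable_compose[OF measurable_component_singleton[of 0] borel_measurable_indicator[OF Z]]) simp
      have "(\<integral>\<^sup>+\<omega>. indicator Z (\<omega> 0) \<partial>\<P>) = (\<integral>\<^sup>+t. indicator Z t \<partial>p)"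
        unfolding P_eq nn_integral_bind_prob[OF p path_measurable i0]
          nn_integral_path_0[OF borel_measurable_indicator[OF Z]] ..
      also have "\<dots> = (\<integral>\<^sup>+t. 0 \<partial>p)"
        by (rule nn_integral_cong_AE) (use AE_fibre_mass in \<open>eventually_elim, auto simp: Z_def\<close>)
      finally have "(\<integral>\<^sup>+\<omega>. indicator Z (\<omega> 0) \<partial>\<P>) = 0" by simp
      moreover have "(\<lambda>\<omega>. indicator Z (\<omega> 0) :: ennreal) \<in> borel_measurable \<P>"
        using i0 measurable_prob_cong[OF Psp] by blast
      ultimately have "AE \<omega> in \<P>. indicator Z (\<omega> 0) = (0::ennreal)"
        by (simp add: nn_integral_0_iff_AE)
      then show ?thesis by eventually_elim (auto simp: Z_def indicator_def split: if_splits)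
    qed
    have im: "(\<lambda>w. indicator D w * cond_dens C (start w)) \<in> borel_measurable (\<P> \<Otimes>\<^sub>M m)"
    proof -
      have "(\<lambda>w. indicator D w * cond_dens C (start w)) \<in> borel_measurable E"
        using D(1) by (intro borel_measurable_times_ennreal measurable_compose[OF start_measurable cond_dens_measurable[OF C_sets(1)]]) auto
      then show ?thesis using measurable_cong_sets[OF PmK(2) refl] by blast
    qed
    have "emeasure \<mu>C D = (\<integral>\<^sup>+w. indicator D w * cond_dens C (start w) \<partial>(\<P> \<Otimes>\<^sub>M m))"
      unfolding emeasure_\<mu>C[OF D(1)] PmK(1) ..
    also have "\<dots> = (\<integral>\<^sup>+\<omega>. (\<integral>\<^sup>+x. indicator D (\<omega>, x) * cond_dens C (\<omega> 0, x) \<partial>m) \<partial>\<P>)"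
      using m.nn_integral_fst[OF im] by (simp add: start_def)
    also have "\<dots> = (\<integral>\<^sup>+\<omega>. emeasure (fibre (\<omega> 0)) (Pair \<omega> -` D) \<partial>\<P>)"
      using AE_P
    proof (intro nn_integral_cong_AE, eventually_elim)
      case (elim \<omega>)
      have "(\<lambda>x. cond_dens C (\<omega> 0, x)) \<in> borel_measurable m"
        using measurable_Pair2[OF cond_dens_pair, of "\<omega> 0"] by simp
      then have "emeasure (fibre (\<omega> 0)) (Pair \<omega> -` D) = (\<integral>\<^sup>+x. cond_dens C (\<omega> 0, x) * indicator (Pair \<omega> -` D) x \<partial>m)"
        using elim sets_Pair1[OF D(2)] by (simp add: fibre_def emeasure_density)
      also have "\<dots> = (\<integral>\<^sup>+x. indicator D (\<omega>, x) * cond_dens C (\<omega> 0, x) \<partial>m)"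
        by (intro nn_integral_cong) (auto simp: indicator_def)
      finally show ?case by simp
    qed
    finally show "emeasure \<mu>C D = (\<integral>\<^sup>+\<omega>. emeasure (fibre (\<omega> 0)) (Pair \<omega> -` D) \<partial>\<P>)" .
  qed
qed

end

lemma invariant_sets_\<mu>: "A \<in> invariant_sets F \<mu> \<longleftrightarrow> strictly_invariant A"
  by (simp add: invariant_sets_def strictly_invariant_def sets_\<mu> space_\<mu>)

lemma ergodic_\<mu>C:
  assumes C: "strictly_invariant C" and pos: "0 < measure \<mu> C"
    and atom: "\<And>B. strictly_invariant B \<Longrightarrow> measure \<mu> (C \<inter> B) = 0 \<or> measure \<mu> (C - B) = 0"
  shows "ergodic_measure F (uniform_measure \<mu> C)"
  unfolding ergodic_measure_def invariant_measure_def
proof (intro conjI ballI impI)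
  have C_pos: "emeasure \<mu> C \<noteq> 0" using pos by (simp add: \<mu>.emeasure_eq_measure)
  have C\<mu>: "C \<in> sets \<mu>" using strictly_invariantD(1)[OF C] sets_\<mu> by simp
  have sC: "sets (uniform_measure \<mu> C) = sets E" using sets_\<mu> by simp
  show "prob_space (uniform_measure \<mu> C)" using \<mu>C_in_space[OF C C_pos] by (simp add: space_prob_algebra)
  show "F \<in> uniform_measure \<mu> C \<rightarrow>\<^sub>M uniform_measure \<mu> C"
    using F_measurable measurable_cong_sets[OF sC sC] by blast
  show "distr (uniform_measure \<mu> C) (uniform_measure \<mu> C) F = uniform_measure \<mu> C"
    using distr_\<mu>C_F[OF C C_pos] distr_cong[OF refl sC, of "uniform_measure \<mu> C" F F] by simp
  fix A assume "A \<in> sets (uniform_measure \<mu> C)" "F -` A \<inter> space (uniform_measure \<mu> C) = A"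
  then have A: "strictly_invariant A" "A \<in> sets \<mu>"
    using sets_\<mu> by (auto simp: strictly_invariant_def space_\<mu>)
  from atom[OF A(1)]
  show "emeasure (uniform_measure \<mu> C) A = 0 \<or> emeasure (uniform_measure \<mu> C) A = 1"
  proof
    assume "measure \<mu> (C \<inter> A) = 0"
    then have "emeasure (uniform_measure \<mu> C) A = 0"
      using A(2) C\<mu> by (simp add: \<mu>.emeasure_eq_measure)
    then show ?thesis ..
  next
    assume "measure \<mu> (C - A) = 0"
    moreover have "measure \<mu> C = measure \<mu> (C \<inter> A) + measure \<mu> (C - A)"
      using \<mu>.finite_measure_Union[of "C \<inter> A" "C - A"] A(2) C\<mu> by (simp add: Int_Diff_Un Int_Diff_disjoint)
    ultimately have "emeasure (uniform_measure \<mu> C) A = 1"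
      using A(2) C\<mu> pos by (simp add: \<mu>.emeasure_eq_measure divide_ennreal)
    then show ?thesis ..
  qed
qed

text \<open>The basins of the conditional measures on the atoms cover \<open>\<mu>\<close>-almost everything by Birkhoff's theorem.
  Their union is an invariant set, and \<open>\<mu>\<close> agrees with \<open>lam \<bind> K\<close> on those, so it has full measure
  there as well, although \<open>\<mu>\<close> need not charge every set that \<open>lam \<bind> K\<close> charges.\<close>

lemma finitely_many_physical_measures:
  assumes P: "markov_measure Q p \<P>"
    and gap: "0 < v" "\<And>C. strictly_invariant C \<Longrightarrow> measure \<mu> C = 0 \<or> v \<le> measure \<mu> C"
    and same: "\<And>C. strictly_invariant C \<Longrightarrow> measure \<mu> C = measure (lam \<bind> K) C"
  shows "FPM \<P> m F"
proof -
  note PmK = pair_markov_measure[OF P]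
  interpret Pm: prob_space "lam \<bind> K" using bind_in_space[OF lam K_measurable] by (simp add: space_prob_algebra)
  have "\<exists>\<A>. finite \<A> \<and> \<A> \<subseteq> invariant_sets F \<mu> \<and> measure \<mu> (UNIV - \<Union>\<A>) = 0 \<and>
    (\<forall>A\<in>\<A>. 0 < measure \<mu> A \<and> (\<forall>B\<in>invariant_sets F \<mu>. measure \<mu> (A \<inter> B) = 0 \<or> measure \<mu> (A - B) = 0))"
    by (rule finite_invariant_atoms[OF \<mu>.prob_space_axioms gap(1)])
      (use gap(2) strictly_invariant_UNIV in \<open>simp_all add: invariant_sets_\<mu>\<close>)
  then obtain \<A> where \<A>: "finite \<A>" "\<And>A. A \<in> \<A> \<Longrightarrow> strictly_invariant A"
    "measure \<mu> (UNIV - \<Union>\<A>) = 0" "\<And>A. A \<in> \<A> \<Longrightarrow> 0 < measure \<mu> A"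
    and atom: "\<And>A B. A \<in> \<A> \<Longrightarrow> strictly_invariant B \<Longrightarrow> measure \<mu> (A \<inter> B) = 0 \<or> measure \<mu> (A - B) = 0"
    by (auto simp: invariant_sets_\<mu> subset_iff)
  have pos: "emeasure \<mu> A \<noteq> 0" if "A \<in> \<A>" for A using \<A>(4)[OF that] by (simp add: \<mu>.emeasure_eq_measure)
  have \<A>s: "A \<in> sets \<mu>" if "A \<in> \<A>" for A using strictly_invariantD(1)[OF \<A>(2)[OF that]] sets_\<mu> by simp
  define S where "S = uniform_measure \<mu> ` \<A>"
  have basin: "emeasure (lam \<bind> K) (\<Union>M\<in>S. birkhoff_basin F M \<phi>) = 1"
    if \<phi>: "\<phi> \<in> borel_measurable E" "bounded (range \<phi>)" for \<phi>
  proof -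
    obtain c where c: "\<And>w. \<bar>\<phi> w\<bar> \<le> c" using \<phi>(2) by (auto simp: bounded_iff)
    define U where "U = (\<Union>M\<in>S. birkhoff_basin F M \<phi>)"
    have bs: "birkhoff_basin F M \<phi> \<in> sets E" for M
      by (rule birkhoff_basin_sets[OF F_measurable \<phi>(1) space_E])
    have U: "strictly_invariant U"
      unfolding strictly_invariant_def
    proof
      show "U \<in> sets E" unfolding U_def S_def using \<A>(1) bs by (intro sets.finite_UN) auto
      show "F -` U = U" unfolding U_def vimage_UN using birkhoff_basin_invariant[of \<phi> c F, OF c] by simp
    qed
    have null: "A - birkhoff_basin F (uniform_measure \<mu> A) \<phi> \<in> null_sets \<mu>" if A: "A \<in> \<A>" for A
    proof -
      have \<phi>A: "\<phi> \<in> borel_measurable (uniform_measure \<mu> A)"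
        using \<phi>(1) measurable_prob_cong[OF \<mu>C_in_space[OF \<A>(2)[OF A] pos[OF A]]] by blast
      have "AE w in uniform_measure \<mu> A. w \<in> birkhoff_basin F (uniform_measure \<mu> A) \<phi>"
        by (rule birkhoff_ergodic[OF ergodic_\<mu>C[OF \<A>(2)[OF A] \<A>(4)[OF A] atom[OF A]] _ \<phi>A c]) (simp_all add: space_\<mu>)
      then have "AE w in \<mu>. w \<in> A \<longrightarrow> w \<in> birkhoff_basin F (uniform_measure \<mu> A) \<phi>"
        using AE_uniform_measure[of \<mu> A] pos[OF A] by (simp add: \<mu>.emeasure_eq_measure less_top[symmetric] zero_less_iff_neq_zero)
      then have "AE w in \<mu>. w \<notin> A - birkhoff_basin F (uniform_measure \<mu> A) \<phi>" by eventually_elim simp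
      moreover have "A - birkhoff_basin F (uniform_measure \<mu> A) \<phi> \<in> sets \<mu>"
        using \<A>s[OF A] bs sets_\<mu> by auto
      ultimately show ?thesis using AE_iff_null_sets by blast
    qed
    have "UNIV - \<Union>\<A> \<in> null_sets \<mu>"
    proof (rule null_setsI)
      have "UNIV - \<Union>\<A> = space \<mu> - \<Union>\<A>" by (simp add: space_\<mu>)
      also have "\<dots> \<in> sets \<mu>" using \<A>(1) \<A>s by (intro sets.compl_sets sets.finite_Union) auto
      finally show "UNIV - \<Union>\<A> \<in> sets \<mu>" .
      show "emeasure \<mu> (UNIV - \<Union>\<A>) = 0" using \<A>(3) by (simp add: \<mu>.emeasure_eq_measure)
    qed
    then have N: "(UNIV - \<Union>\<A>) \<union> (\<Union>A\<in>\<A>. A - birkhoff_basin F (uniform_measure \<mu> A) \<phi>) \<in> null_sets \<mu>"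
      using null by (intro null_sets.Un null_sets.finite_UN \<A>(1)) auto
    have "UNIV - U \<in> sets \<mu>"
      using strictly_invariantD(1)[OF strictly_invariant_Diff[OF strictly_invariant_UNIV U]] sets_\<mu> by simp
    moreover have "UNIV - U \<subseteq> (UNIV - \<Union>\<A>) \<union> (\<Union>A\<in>\<A>. A - birkhoff_basin F (uniform_measure \<mu> A) \<phi>)"
      by (auto simp: U_def S_def)
    ultimately have "UNIV - U \<in> null_sets \<mu>" by (rule null_sets_subset[OF N])
    then have "measure \<mu> (UNIV - U) = 0" by (simp add: measure_def null_setsD1)
    then have "measure \<mu> U = 1"
      using \<mu>.prob_compl[of U] strictly_invariantD(1)[OF U] by (simp add: sets_\<mu> space_\<mu>)
    then show ?thesis unfolding U_def[symmetric] using same[OF U] by (simp add: Pm.emeasure_eq_measure)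
  qed
  show ?thesis
    unfolding FPM_def
  proof (intro exI[of _ S] conjI ballI allI impI)
    show "finite S" using \<A>(1) by (simp add: S_def)
    fix M assume "M \<in> S"
    then obtain A where A: "A \<in> \<A>" and M: "M = uniform_measure \<mu> A" by (auto simp: S_def)
    show "sets M = sets (\<P> \<Otimes>\<^sub>M m)" unfolding PmK(2) M using sets_\<mu> by simp
    show "ergodic_measure F M" unfolding M by (rule ergodic_\<mu>C[OF \<A>(2)[OF A] \<A>(4)[OF A] atom[OF A]])
    show "markovian_measure \<P> m F M" unfolding M by (rule markovian_\<mu>C[OF \<A>(2)[OF A] pos[OF A] P])
    show "absolutely_continuous (\<P> \<Otimes>\<^sub>M m) M"
      unfolding absolutely_continuous_def PmK(1)
    proof
      fix D assume "D \<in> null_sets (lam \<bind> K)"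
      then have D: "D \<in> null_sets \<mu>" using \<mu>_ac by (auto simp: absolutely_continuous_def)
      have Ds: "D \<in> sets \<mu>" using D by auto
      have "emeasure \<mu> (A \<inter> D) \<le> emeasure \<mu> D" using Ds by (intro emeasure_mono) auto
      then have "emeasure \<mu> (A \<inter> D) = 0" using null_setsD1[OF D] by simp
      then have "emeasure M D = 0" unfolding M using Ds \<A>s[OF A] by simp
      then show "D \<in> null_sets M" using Ds by (intro null_setsI) (simp_all add: M)
    qed
  next
    fix \<phi> :: "(nat \<Rightarrow> 't) \<times> 'x \<Rightarrow> real"
    assume \<phi>: "\<phi> \<in> borel_measurable (\<P> \<Otimes>\<^sub>M m) \<and> bounded (range \<phi>)"
    then have "\<phi> \<in> borel_measurable E" using measurable_cong_sets[OF PmK(2) refl] by blast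
    then show "emeasure (\<P> \<Otimes>\<^sub>M m) (\<Union>M\<in>S. birkhoff_basin F M \<phi>) = 1"
      unfolding PmK(1) using \<phi> by (intro basin) auto
  qed
qed

end

section \<open>Compactness on the space of essentially bounded functions\<close>

text \<open>Replace the terms of a sequence in the closure by points of \<open>S\<close> at distances tending to 0.\<close>

lemma (in Metric_space) compactin_closure_of_sequentially:
  assumes S: "S \<subseteq> M"
    and seq: "\<And>\<sigma> :: nat \<Rightarrow> 'a. range \<sigma> \<subseteq> S \<Longrightarrow>
      \<exists>l r. strict_mono r \<and> limitin mtopology (\<sigma> \<circ> r) l sequentially"
  shows "compactin mtopology (mtopology closure_of S)"
  unfolding compactin_sequentially
proof (intro conjI allI impI)
  show "mtopology closure_of S \<subseteq> M" using closure_of_subset_topspace[of mtopology S] by simp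
  fix \<sigma> :: "nat \<Rightarrow> 'a" assume \<sigma>: "range \<sigma> \<subseteq> mtopology closure_of S"
  have "\<exists>s. s \<in> S \<and> \<sigma> n \<in> M \<and> d (\<sigma> n) s < inverse (real (Suc n))" for n
  proof -
    have "\<sigma> n \<in> mtopology closure_of S" using \<sigma> by auto
    then have "\<exists>y\<in>S. y \<in> mball (\<sigma> n) (inverse (real (Suc n)))"
      unfolding metric_closure_of by (simp del: of_nat_Suc)
    then show ?thesis by (auto simp: in_mball)
  qed
  then obtain s where s: "\<And>n. s n \<in> S" "\<And>n. \<sigma> n \<in> M" "\<And>n. d (\<sigma> n) (s n) < inverse (real (Suc n))"
    by metis
  obtain l r where r: "strict_mono r" and l: "limitin mtopology (s \<circ> r) l sequentially"
    using seq[of s] s(1) by blast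
  have lM: "l \<in> M" using l by (simp add: limitin_metric)
  have lim: "(\<lambda>n. d (s (r n)) l) \<longlonglongrightarrow> 0"
    using l by (simp add: limitin_metric_dist_null comp_def)
  have "limitin mtopology (\<sigma> \<circ> r) l sequentially"
    unfolding limitin_metric_dist_null
  proof (intro conjI)
    show "(\<lambda>n. d ((\<sigma> \<circ> r) n) l) \<longlonglongrightarrow> 0"
    proof (rule tendsto_sandwich[OF _ _ tendsto_const])
      have "(\<lambda>n. inverse (real (Suc (r n)))) \<longlonglongrightarrow> 0"
        using LIMSEQ_subseq_LIMSEQ[OF LIMSEQ_inverse_real_of_nat r] by (simp add: comp_def)
      from tendsto_add[OF this lim]
      show "(\<lambda>n. inverse (real (Suc (r n))) + d (s (r n)) l) \<longlonglongrightarrow> 0" by simp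
      show "\<forall>\<^sub>F n in sequentially. d ((\<sigma> \<circ> r) n) l \<le> inverse (real (Suc (r n))) + d (s (r n)) l"
      proof (rule always_eventually, rule allI)
        fix n
        have "d (\<sigma> (r n)) l \<le> d (\<sigma> (r n)) (s (r n)) + d (s (r n)) l"
          using s S lM by (intro triangle) auto
        then show "d ((\<sigma> \<circ> r) n) l \<le> inverse (real (Suc (r n))) + d (s (r n)) l"
          using s(3)[of "r n"] by simp
      qed
    qed simp
  qed (use lM s(2) in auto)
  moreover have "l \<in> mtopology closure_of S"
    unfolding metric_closure_of
  proof (intro CollectI conjI allI impI lM)
    fix e :: real assume "0 < e"
    from order_tendstoD(2)[OF lim this] obtain n where "d (s (r n)) l < e"
      by (auto simp: eventually_sequentially)
    then show "\<exists>y\<in>S. y \<in> mball l e"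
      using s(1)[of "r n"] S lM by (intro bexI[of _ "s (r n)"]) (auto simp: in_mball commute)
  qed
  ultimately show "\<exists>l r. l \<in> mtopology closure_of S \<and> strict_mono r \<and> limitin mtopology (\<sigma> \<circ> r) l sequentially"
    using r by blast
qed

abbreviation Linf_class :: "'a measure \<Rightarrow> ('a \<Rightarrow> real) \<Rightarrow> ('a \<Rightarrow> real) set" where
  "Linf_class M \<phi> \<equiv> ae_eq M `` {\<phi>}"

lemma ae_eq_iff: "(\<phi>, \<psi>) \<in> ae_eq M \<longleftrightarrow> \<phi> \<in> ess_bounded M \<and> \<psi> \<in> ess_bounded M \<and> (AE x in M. \<phi> x = \<psi> x)"
  by (simp add: ae_eq_def)

lemma Linf_class_in_Linf: "\<phi> \<in> ess_bounded M \<Longrightarrow> Linf_class M \<phi> \<in> Linf M"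
  unfolding Linf_def by (rule quotientI)

lemma Linf_class_self: "\<phi> \<in> ess_bounded M \<Longrightarrow> \<phi> \<in> Linf_class M \<phi>"
  by (rule equiv_class_self[OF equiv_ae_eq])

lemma Linf_class_eqI: "(\<phi>, \<psi>) \<in> ae_eq M \<Longrightarrow> Linf_class M \<phi> = Linf_class M \<psi>"
  by (rule equiv_class_eq[OF equiv_ae_eq])

lemma Linf_cases:
  assumes "c \<in> Linf M" obtains \<phi> where "\<phi> \<in> ess_bounded M" "c = Linf_class M \<phi>"
  using assms unfolding Linf_def by (rule quotientE)

lemma ess_bounded_comb:
  assumes M: "prob_space M" and \<phi>: "\<phi> \<in> ess_bounded M" and \<psi>: "\<psi> \<in> ess_bounded M"
  shows "(\<lambda>x. a * \<phi> x + b * \<psi> x) \<in> ess_bounded M"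
proof -
  obtain C D where "AE x in M. \<bar>\<phi> x\<bar> \<le> C" "AE x in M. \<bar>\<psi> x\<bar> \<le> D"
    using \<phi> \<psi> ess_bounded_iff[OF M] by blast
  then have "AE x in M. \<bar>a * \<phi> x + b * \<psi> x\<bar> \<le> \<bar>a\<bar> * C + \<bar>b\<bar> * D"
  proof eventually_elim
    case (elim x)
    have "\<bar>a * \<phi> x + b * \<psi> x\<bar> \<le> \<bar>a\<bar> * \<bar>\<phi> x\<bar> + \<bar>b\<bar> * \<bar>\<psi> x\<bar>"
      using abs_triangle_ineq[of "a * \<phi> x" "b * \<psi> x"] by (simp add: abs_mult)
    also have "\<dots> \<le> \<bar>a\<bar> * C + \<bar>b\<bar> * D" using elim by (intro add_mono mult_left_mono) auto
    finally show ?case .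
  qed
  moreover have "(\<lambda>x. a * \<phi> x + b * \<psi> x) \<in> borel_measurable M"
  proof -
    have "\<phi> \<in> borel_measurable M" "\<psi> \<in> borel_measurable M" using \<phi> \<psi> by (simp_all add: ess_bounded_def)
    then show ?thesis by (intro borel_measurable_add borel_measurable_times borel_measurable_const)
  qed
  ultimately show ?thesis using ess_bounded_iff[OF M] by blast
qed

lemma Image_eq_class:
  assumes "\<And>\<psi>. \<psi> \<in> S \<Longrightarrow> (\<phi>, \<psi>) \<in> ae_eq M" "S \<noteq> {}"
  shows "ae_eq M `` S = Linf_class M \<phi>"
proof -
  have "Linf_class M \<psi> = Linf_class M \<phi>" if "\<psi> \<in> S" for \<psi>
    using Linf_class_eqI[OF assms(1)[OF that]] by simp
  then show ?thesis using assms(2) unfolding Image_eq_UN[of "ae_eq M" S] by auto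
qed

lemma Linf_comb_class:
  assumes M: "prob_space M" and \<phi>: "\<phi> \<in> ess_bounded M" and \<psi>: "\<psi> \<in> ess_bounded M"
  shows "Linf_comb M a (Linf_class M \<phi>) b (Linf_class M \<psi>) = Linf_class M (\<lambda>x. a * \<phi> x + b * \<psi> x)"
  unfolding Linf_comb_def
proof (rule Image_eq_class)
  show "{\<lambda>x. a * \<phi>' x + b * \<psi>' x |\<phi>' \<psi>'. \<phi>' \<in> Linf_class M \<phi> \<and> \<psi>' \<in> Linf_class M \<psi>} \<noteq> {}"
    using Linf_class_self[OF \<phi>] Linf_class_self[OF \<psi>] by blast
  fix \<eta> assume "\<eta> \<in> {\<lambda>x. a * \<phi>' x + b * \<psi>' x |\<phi>' \<psi>'. \<phi>' \<in> Linf_class M \<phi> \<and> \<psi>' \<in> Linf_class M \<psi>}"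
  then obtain \<phi>' \<psi>' where \<eta>: "\<eta> = (\<lambda>x. a * \<phi>' x + b * \<psi>' x)"
    and *: "(\<phi>, \<phi>') \<in> ae_eq M" "(\<psi>, \<psi>') \<in> ae_eq M" by auto
  from * have ae: "AE x in M. \<phi> x = \<phi>' x" "AE x in M. \<psi> x = \<psi>' x" by (auto simp: ae_eq_iff)
  have "AE x in M. a * \<phi> x + b * \<psi> x = a * \<phi>' x + b * \<psi>' x"
    using ae by eventually_elim simp
  then show "(\<lambda>x. a * \<phi> x + b * \<psi> x, \<eta>) \<in> ae_eq M"
    unfolding \<eta> using * ess_bounded_comb[OF M] by (auto simp: ae_eq_iff)
qed

lemma Linf_lift_class:
  assumes \<phi>: "\<phi> \<in> ess_bounded M"
    and resp: "\<And>\<phi> \<psi>. (\<phi>, \<psi>) \<in> ae_eq M \<Longrightarrow> (A \<phi>, A \<psi>) \<in> ae_eq M"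
  shows "Linf_lift M A (Linf_class M \<phi>) = Linf_class M (A \<phi>)"
  unfolding Linf_lift_def
  by (rule Image_eq_class) (use resp Linf_class_self[OF \<phi>] in auto)

lemma Linf_linear_lift:
  assumes M: "prob_space M"
    and resp: "\<And>\<phi> \<psi>. (\<phi>, \<psi>) \<in> ae_eq M \<Longrightarrow> (A \<phi>, A \<psi>) \<in> ae_eq M"
    and lin: "\<And>\<phi> \<psi> a b. \<phi> \<in> ess_bounded M \<Longrightarrow> \<psi> \<in> ess_bounded M \<Longrightarrow>
      AE x in M. A (\<lambda>x. a * \<phi> x + b * \<psi> x) x = a * A \<phi> x + b * A \<psi> x"
  shows "Linf_linear M (Linf_lift M A)"
proof -
  have A: "A \<phi> \<in> ess_bounded M" if "\<phi> \<in> ess_bounded M" for \<phi>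
    using resp[of \<phi> \<phi>] that by (simp add: ae_eq_iff)
  note L = Linf_lift_class[OF _ resp]
  show ?thesis
    unfolding Linf_linear_def
  proof (intro conjI ballI allI funcsetI)
    show "Linf_lift M A c \<in> Linf M" if "c \<in> Linf M" for c
      using that by (rule Linf_cases) (simp add: L A Linf_class_in_Linf)
    fix c d a b assume "c \<in> Linf M" "d \<in> Linf M"
    then obtain \<phi> \<psi> where \<phi>: "\<phi> \<in> ess_bounded M" "c = Linf_class M \<phi>"
      and \<psi>: "\<psi> \<in> ess_bounded M" "d = Linf_class M \<psi>" by (metis Linf_cases)
    have "Linf_lift M A (Linf_comb M a c b d) = Linf_class M (A (\<lambda>x. a * \<phi> x + b * \<psi> x))"
      unfolding \<phi>(2) \<psi>(2) Linf_comb_class[OF M \<phi>(1) \<psi>(1)] by (rule L[OF ess_bounded_comb[OF M \<phi>(1) \<psi>(1)]])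
    also have "\<dots> = Linf_class M (\<lambda>x. a * A \<phi> x + b * A \<psi> x)"
      using lin[OF \<phi>(1) \<psi>(1)] A ess_bounded_comb[OF M] \<phi>(1) \<psi>(1)
      by (intro Linf_class_eqI) (auto simp: ae_eq_iff)
    also have "\<dots> = Linf_comb M a (Linf_lift M A c) b (Linf_lift M A d)"
    proof -
      have "Linf_lift M A c = Linf_class M (A \<phi>)" unfolding \<phi>(2) by (rule L[OF \<phi>(1)])
      moreover have "Linf_lift M A d = Linf_class M (A \<psi>)" unfolding \<psi>(2) by (rule L[OF \<psi>(1)])
      ultimately show ?thesis using Linf_comb_class[OF M A[OF \<phi>(1)] A[OF \<psi>(1)], of a b] by simp
    qed
    finally show "Linf_lift M A (Linf_comb M a c b d) = Linf_comb M a (Linf_lift M A c) b (Linf_lift M A d)" .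
  qed
qed

lemma Linf_linear_funpow:
  assumes "Linf_linear M B" shows "Linf_linear M (B ^^ n)"
proof (induction n)
  case 0 then show ?case by (simp add: Linf_linear_def)
next
  case (Suc n)
  then have n: "\<And>c. c \<in> Linf M \<Longrightarrow> (B ^^ n) c \<in> Linf M"
    "\<And>c d a b. c \<in> Linf M \<Longrightarrow> d \<in> Linf M \<Longrightarrow> (B ^^ n) (Linf_comb M a c b d) = Linf_comb M a ((B ^^ n) c) b ((B ^^ n) d)"
    by (auto simp: Linf_linear_def)
  with assms show ?case by (auto simp: Linf_linear_def)
qed

lemma Linf_lift_funpow_class:
  assumes \<phi>: "\<phi> \<in> ess_bounded M"
    and resp: "\<And>\<phi> \<psi>. (\<phi>, \<psi>) \<in> ae_eq M \<Longrightarrow> (A \<phi>, A \<psi>) \<in> ae_eq M"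
  shows "(Linf_lift M A ^^ n) (Linf_class M \<phi>) = Linf_class M ((A ^^ n) \<phi>)"
proof -
  have "(A ^^ n) \<phi> \<in> ess_bounded M \<and> (Linf_lift M A ^^ n) (Linf_class M \<phi>) = Linf_class M ((A ^^ n) \<phi>)"
  proof (induction n)
    case (Suc n)
    then have b: "(A ^^ n) \<phi> \<in> ess_bounded M" by blast
    from resp[of "(A ^^ n) \<phi>" "(A ^^ n) \<phi>"] b have "A ((A ^^ n) \<phi>) \<in> ess_bounded M" by (simp add: ae_eq_iff)
    then show ?case using Suc Linf_lift_class[OF b resp] by simp
  qed (simp add: \<phi>)
  then show ?thesis ..
qed

lemma ess_bounded_of_bounded:
  assumes "prob_space M" "\<phi> \<in> borel_measurable M" "\<And>x. \<bar>\<phi> x\<bar> \<le> C"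
  shows "\<phi> \<in> ess_bounded M"
  using assms ess_bounded_iff[OF assms(1)] by blast

text \<open>Truncating a representative at the essential bound gives one that is bounded everywhere, to which
  the pointwise statements on kernels apply.\<close>

lemma Linf_mbounded_representative:
  assumes M: "prob_space M" and S: "Metric_space.mbounded (Linf M) (Linf_dist M) S"
  obtains C where "\<And>c. c \<in> S \<Longrightarrow> \<exists>\<phi>. \<phi> \<in> borel_measurable M \<and> (\<forall>x. \<bar>\<phi> x\<bar> \<le> C) \<and> c = Linf_class M \<phi>"
proof -
  interpret L: Metric_space "Linf M" "Linf_dist M" by (rule Metric_space_Linf[OF M])
  obtain x B where x: "S \<subseteq> L.mcball x B" using S unfolding L.mbounded_def by blast
  show ?thesis
  proof (cases "x \<in> Linf M")
    case False
    then have "S = {}" using x by auto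
    then show ?thesis using that by blast
  next
    case True
    then obtain \<eta> where \<eta>: "\<eta> \<in> ess_bounded M" "x = Linf_class M \<eta>" by (rule Linf_cases)
    define C where "C = ess_norm M \<eta> + \<bar>B\<bar>"
    have C0: "0 \<le> C" using ess_norm_AE(1)[OF M \<eta>(1)] by (simp add: C_def)
    have "\<exists>\<phi>. \<phi> \<in> borel_measurable M \<and> (\<forall>x. \<bar>\<phi> x\<bar> \<le> C) \<and> c = Linf_class M \<phi>" if "c \<in> S" for c
    proof -
      have c: "c \<in> Linf M" "Linf_dist M x c \<le> B" using x that by auto
      obtain \<psi> where \<psi>: "\<psi> \<in> ess_bounded M" "c = Linf_class M \<psi>" using c(1) by (rule Linf_cases)
      have "ess_norm M (\<lambda>x. \<eta> x - \<psi> x) \<le> B"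
        using c(2) Linf_dist_class[OF M True c(1)] Linf_class_self[OF \<eta>(1)] Linf_class_self[OF \<psi>(1)] \<eta>(2) \<psi>(2) by metis
      note dist_le = this
      have ae: "AE x in M. \<bar>\<psi> x\<bar> \<le> C"
        using ess_norm_AE(2)[OF M \<eta>(1)] ess_norm_AE(2)[OF M ess_bounded_diff[OF M \<eta>(1) \<psi>(1)]]
      proof eventually_elim
        case (elim x)
        then show ?case using dist_le unfolding C_def by linarith
      qed
      \<comment> \<open>the truncation of \<open>\<psi>\<close> to \<open>[-C, C]\<close>\<close>
      define \<phi> where "\<phi> x = max (- C) (min (\<psi> x) C)" for x
      have \<phi>m: "\<phi> \<in> borel_measurable M"
        unfolding \<phi>_def using \<psi>(1)
        by (intro borel_measurable_max borel_measurable_min borel_measurable_const) (simp add: ess_bounded_def)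
      have \<phi>b: "\<bar>\<phi> x\<bar> \<le> C" for x using C0 by (auto simp: \<phi>_def)
      have "AE x in M. \<psi> x = \<phi> x" using ae by eventually_elim (auto simp: \<phi>_def)
      then have "c = Linf_class M \<phi>"
        unfolding \<psi>(2) using \<psi>(1) ess_bounded_of_bounded[OF M \<phi>m \<phi>b] by (intro Linf_class_eqI) (simp add: ae_eq_iff)
      with \<phi>m \<phi>b show ?thesis by blast
    qed
    then show ?thesis using that by blast
  qed
qed

lemma Linf_limit_of_uniform_limit:
  fixes g :: "nat \<Rightarrow> 'a \<Rightarrow> real"
  assumes M: "prob_space M" and g: "\<And>n. g n \<in> ess_bounded M" and h: "h \<in> ess_bounded M"
    and ul: "uniform_limit UNIV g h sequentially"
  shows "limitin (Linf_topology M) (\<lambda>n. Linf_class M (g n)) (Linf_class M h) sequentially"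
proof -
  interpret L: Metric_space "Linf M" "Linf_dist M" by (rule Metric_space_Linf[OF M])
  show ?thesis
    unfolding L.limitin_metric
  proof (intro conjI allI impI)
    show "Linf_class M h \<in> Linf M" by (rule Linf_class_in_Linf[OF h])
    fix e :: real assume e: "0 < e"
    have "\<forall>\<^sub>F n in sequentially. \<forall>x\<in>UNIV. dist (g n x) (h x) < e / 2"
      using uniform_limitD[OF ul, of "e / 2"] e by simp
    then show "\<forall>\<^sub>F n in sequentially. Linf_class M (g n) \<in> Linf M \<and> Linf_dist M (Linf_class M (g n)) (Linf_class M h) < e"
    proof eventually_elim
      case (elim n)
      have "ess_norm M (\<lambda>x. g n x - h x) \<le> e / 2"
        using elim by (intro ess_norm_le[OF M ess_bounded_diff[OF M g h]]) (auto simp: dist_real_def less_imp_le)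
      moreover have "Linf_dist M (Linf_class M (g n)) (Linf_class M h) = ess_norm M (\<lambda>x. g n x - h x)"
        by (rule Linf_dist_class[OF M Linf_class_in_Linf[OF g] Linf_class_in_Linf[OF h] Linf_class_self[OF g] Linf_class_self[OF h]])
      ultimately show ?case using e Linf_class_in_Linf[OF g] by simp
    qed
  qed
qed

context nonsingular_random_map
begin

lemma borel_measurable_lam: "\<phi> \<in> borel_measurable lam \<longleftrightarrow> \<phi> \<in> borel_measurable borel"
  by (rule measurable_prob_cong[OF lam])

text \<open>After one step from \<open>lam\<close> the chain charges no null set; this makes the operator well defined on
  classes.\<close>

lemma AE_phat:
  assumes "AE y in lam. R y" shows "AE z in lam. AE y in ph z. R y"
proof -
  obtain N where N: "{y \<in> space lam. \<not> R y} \<subseteq> N" "emeasure lam N = 0" "N \<in> sets lam"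
    using assms by (rule AE_E)
  have sp: "space lam = UNIV" using sets_eq_imp_space_eq[OF sets_lam] by simp
  have Ns: "N \<in> sets borel" "emeasure lam N = 0" using N(2,3) sets_lam by auto
  have mN: "(\<lambda>z. emeasure (ph z) N) \<in> borel_measurable lam"
    using measurable_compose[OF measurable_prob_algebraD[OF phat_measurable] measurable_emeasure_subprob_algebra[OF Ns(1)]]
      borel_measurable_lam measurable_prob_cong[OF lam] by blast
  have "(\<integral>\<^sup>+z. emeasure (ph z) N \<partial>lam) = 0"
    using phat_null[OF Ns] emeasure_bind_prob_algebra[OF lam phat_measurable Ns(1)] by simp
  then have "AE z in lam. emeasure (ph z) N = 0" using mN by (simp add: nn_integral_0_iff_AE)
  then show ?thesis
  proof eventually_elim
    case (elim z)
    have "sets (ph z) = sets borel" using phat_in_space[of z] by (simp add: space_prob_algebra)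
    then have "N \<in> null_sets (ph z)" using elim Ns(1) by auto
    then have "AE y in ph z. y \<notin> N" by (rule AE_not_in)
    then show ?case
    proof eventually_elim
      case (elim y)
      then show ?case using N(1) sp by blast
    qed
  qed
qed

lemma kernel_op_measurable: "\<phi> \<in> borel_measurable borel \<Longrightarrow> kernel_op ph \<phi> \<in> borel_measurable borel"
  unfolding kernel_op_def[abs_def] by (rule measurable_integral_kernel[OF phat_measurable])

lemma kernel_op_ess_bounded:
  assumes \<phi>: "\<phi> \<in> ess_bounded lam" shows "kernel_op ph \<phi> \<in> ess_bounded lam"
proof -
  obtain C where m: "\<phi> \<in> borel_measurable borel" and ae: "AE y in lam. \<bar>\<phi> y\<bar> \<le> C"
    using \<phi> ess_bounded_iff[OF pm.prob_space_axioms] borel_measurable_lam by blast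
  have "AE z in lam. \<bar>kernel_op ph \<phi> z\<bar> \<le> C"
    using AE_phat[OF ae]
  proof eventually_elim
    case (elim z)
    interpret z: prob_space "ph z" using phat_in_space by (simp add: space_prob_algebra)
    have "\<phi> \<in> borel_measurable (ph z)" using m measurable_prob_cong[OF phat_in_space] by blast
    then have i: "integrable (ph z) \<phi>" using elim by (intro z.integrable_const_bound[where B = C]) auto
    have "\<bar>\<integral>y. \<phi> y \<partial>ph z\<bar> \<le> (\<integral>y. \<bar>\<phi> y\<bar> \<partial>ph z)" by (rule integral_abs_bound)
    also have "\<dots> \<le> (\<integral>y. C \<partial>ph z)" using i elim by (intro integral_mono_AE) auto
    finally show ?case by (simp add: kernel_op_def z.prob_space)
  qed
  then show ?thesis
    using kernel_op_measurable[OF m] borel_measurable_lam ess_bounded_iff[OF pm.prob_space_axioms] by blast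
qed

lemma kernel_op_ae_eq:
  assumes "(\<phi>, \<psi>) \<in> ae_eq lam" shows "(kernel_op ph \<phi>, kernel_op ph \<psi>) \<in> ae_eq lam"
proof -
  have b: "\<phi> \<in> ess_bounded lam" "\<psi> \<in> ess_bounded lam" and ae: "AE y in lam. \<phi> y = \<psi> y"
    using assms by (auto simp: ae_eq_iff)
  have m: "\<phi> \<in> borel_measurable borel" "\<psi> \<in> borel_measurable borel"
    using b borel_measurable_lam unfolding ess_bounded_def by blast+
  have "AE z in lam. kernel_op ph \<phi> z = kernel_op ph \<psi> z"
    using AE_phat[OF ae]
  proof eventually_elim
    case (elim z)
    have "\<phi> \<in> borel_measurable (ph z)" "\<psi> \<in> borel_measurable (ph z)"
      using m measurable_prob_cong[OF phat_in_space] by blast+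
    then show ?case unfolding kernel_op_def by (rule integral_cong_AE) (rule elim)
  qed
  then show ?thesis using b kernel_op_ess_bounded by (simp add: ae_eq_iff)
qed

lemma kernel_op_linear:
  assumes "\<phi> \<in> ess_bounded lam" "\<psi> \<in> ess_bounded lam"
  shows "AE z in lam. kernel_op ph (\<lambda>y. a * \<phi> y + b * \<psi> y) z = a * kernel_op ph \<phi> z + b * kernel_op ph \<psi> z"
proof -
  obtain C D where m: "\<phi> \<in> borel_measurable borel" "\<psi> \<in> borel_measurable borel"
    and ae: "AE y in lam. \<bar>\<phi> y\<bar> \<le> C" "AE y in lam. \<bar>\<psi> y\<bar> \<le> D"
    using assms ess_bounded_iff[OF pm.prob_space_axioms] borel_measurable_lam by blast
  show ?thesis
    using AE_phat[OF ae(1)] AE_phat[OF ae(2)]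
  proof eventually_elim
    case (elim z)
    interpret z: prob_space "ph z" using phat_in_space by (simp add: space_prob_algebra)
    have pm: "\<phi> \<in> borel_measurable (ph z)" "\<psi> \<in> borel_measurable (ph z)"
      using m measurable_prob_cong[OF phat_in_space] by blast+
    have "integrable (ph z) \<phi>" by (rule z.integrable_const_bound[of _ C]) (simp_all add: elim pm)
    moreover have "integrable (ph z) \<psi>" by (rule z.integrable_const_bound[of _ D]) (simp_all add: elim pm)
    ultimately have "integrable (ph z) (\<lambda>y. a * \<phi> y)" "integrable (ph z) (\<lambda>y. b * \<psi> y)" by simp_all
    then show ?case by (simp add: kernel_op_def)
  qed
qed

lemma integral_bind_prob:
  fixes \<phi> :: "'b \<Rightarrow> real"
  assumes M: "M \<in> space (prob_algebra N)" and T: "T \<in> N \<rightarrow>\<^sub>M prob_algebra L"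
    and \<phi>: "\<phi> \<in> borel_measurable L" "\<And>x. \<bar>\<phi> x\<bar> \<le> C"
  shows "(\<integral>y. \<phi> y \<partial>(M \<bind> T)) = (\<integral>x. (\<integral>y. \<phi> y \<partial>T x) \<partial>M)"
proof -
  interpret prob_space M using M by (simp add: space_prob_algebra)
  have sp: "space M = space N" using M sets_eq_imp_space_eq[of M N] by (simp add: space_prob_algebra)
  show ?thesis
  proof (rule integral_bind[OF \<phi>(1), where B = C and B' = 1])
    show "T \<in> M \<rightarrow>\<^sub>M subprob_algebra L"
      using measurable_prob_algebraD[OF T] measurable_prob_cong[OF M, of T "subprob_algebra L"] by simp
    show "AE x in M. emeasure (T x) (space (T x)) \<le> ennreal 1"
      using prob_space.emeasure_space_1[OF kernel_prob(1)[OF T]] sp by (intro AE_I2) simp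
    show "finite_measure M" by unfold_locales
  qed (use \<phi>(2) in auto)
qed

lemma kernel_op_funpow:
  assumes \<phi>: "\<phi> \<in> borel_measurable borel" "\<And>x. \<bar>\<phi> x\<bar> \<le> C"
  shows "(kernel_op ph ^^ n) \<phi> = (\<lambda>z. \<integral>y. \<phi> y \<partial>pow n z)"
proof (induction n)
  case 0
  show ?case using \<phi>(1) by (simp add: integral_return)
next
  case (Suc n)
  show ?case
  proof
    fix z
    have "(kernel_op ph ^^ Suc n) \<phi> z = (\<integral>y. (\<integral>x. \<phi> x \<partial>pow n y) \<partial>ph z)"
      by (simp add: Suc kernel_op_def)
    also have "\<dots> = (\<integral>x. \<phi> x \<partial>(ph z \<bind> pow n))"
      by (rule integral_bind_prob[OF phat_in_space pow_measurable \<phi>, symmetric])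
    finally show "(kernel_op ph ^^ Suc n) \<phi> z = (\<integral>y. \<phi> y \<partial>pow (Suc n) z)" by simp
  qed
qed

lemma Linf_linear_phat: "Linf_linear lam (Linf_lift lam (kernel_op ph))"
  by (rule Linf_linear_lift[OF pm.prob_space_axioms kernel_op_ae_eq kernel_op_linear])

text \<open>On bounded representatives the power of the operator is integration against
  \<open>pow n0\<close> twice, so the uniform convergence along a subsequence of strong Feller compositions applies;
  a uniform limit is a limit in the essential norm.\<close>

lemma Linf_compact_phat_power:
  assumes comp: "compact (UNIV :: ('t \<times> 'x) set)" and sf: "strong_feller (pow n0) borel"
  shows "Linf_compact lam (Linf_lift lam (kernel_op ph) ^^ (2 * n0))"
  unfolding Linf_compact_def
proof (intro conjI allI impI)
  let ?T = "Linf_lift lam (kernel_op ph) ^^ (2 * n0)"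
  note M = pm.prob_space_axioms
  interpret L: Metric_space "Linf lam" "Linf_dist lam" by (rule Metric_space_Linf[OF M])
  show lin: "Linf_linear lam ?T" by (rule Linf_linear_funpow[OF Linf_linear_phat])
  fix S assume S: "L.mbounded S"
  obtain C where C: "\<And>c. c \<in> S \<Longrightarrow> \<exists>\<phi>. \<phi> \<in> borel_measurable lam \<and> (\<forall>x. \<bar>\<phi> x\<bar> \<le> C) \<and> c = Linf_class lam \<phi>"
    using Linf_mbounded_representative[OF M S] by blast
  show "compactin L.mtopology (L.mtopology closure_of (?T ` S))"
  proof (rule L.compactin_closure_of_sequentially)
    show "?T ` S \<subseteq> Linf lam" using lin L.mbounded_subset_mspace[OF S] by (auto simp: Linf_linear_def)
    fix \<sigma> :: "nat \<Rightarrow> _" assume "range \<sigma> \<subseteq> ?T ` S"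
    then have \<sigma>_mem: "\<sigma> n \<in> ?T ` S" for n by auto
    have "\<exists>\<phi>. \<phi> \<in> borel_measurable borel \<and> (\<forall>x. \<bar>\<phi> x\<bar> \<le> C) \<and> \<sigma> n = ?T (Linf_class lam \<phi>)" for n
    proof -
      obtain c where c: "c \<in> S" "\<sigma> n = ?T c" using \<sigma>_mem[of n] by (rule imageE)
      obtain \<phi> where "\<phi> \<in> borel_measurable lam" "\<forall>x. \<bar>\<phi> x\<bar> \<le> C" "c = Linf_class lam \<phi>"
        using C[OF c(1)] by blast
      with c(2) borel_measurable_lam show ?thesis by blast
    qed
    then obtain \<phi> where \<phi>: "\<And>n. \<phi> n \<in> borel_measurable borel" "\<And>n x. \<bar>\<phi> n x\<bar> \<le> C"
      and \<sigma>: "\<And>n. \<sigma> n = ?T (Linf_class lam (\<phi> n))" by metis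
    have \<phi>b: "\<phi> n \<in> ess_bounded lam" for n
      using ess_bounded_of_bounded[OF M] \<phi> borel_measurable_lam by blast
    define g where "g n z = (\<integral>y. (\<integral>x. \<phi> n x \<partial>pow n0 y) \<partial>pow n0 z)" for n z
    have \<sigma>g: "\<sigma> n = Linf_class lam (g n)" for n
    proof -
      have "(kernel_op ph ^^ (2 * n0)) (\<phi> n) = g n"
      proof
        fix z
        have "(kernel_op ph ^^ (2 * n0)) (\<phi> n) z = (\<integral>x. \<phi> n x \<partial>(pow n0 z \<bind> pow n0))"
          unfolding kernel_op_funpow[OF \<phi>] using pow_add[of n0 n0 z] by (simp add: mult_2)
        then show "(kernel_op ph ^^ (2 * n0)) (\<phi> n) z = g n z"
          unfolding g_def by (simp only: integral_bind_prob[OF pow_in_space pow_measurable \<phi>])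
      qed
      then show ?thesis unfolding \<sigma> by (simp only: Linf_lift_funpow_class[OF \<phi>b kernel_op_ae_eq])
    qed
    have inner: "(\<lambda>y. \<integral>x. \<phi> n x \<partial>pow n0 y) \<in> borel_measurable borel" "\<bar>\<integral>x. \<phi> n x \<partial>pow n0 y\<bar> \<le> C" for n y
      using measurable_integral_kernel[OF pow_measurable \<phi>(1)] abs_integral_le[OF pow_in_space \<phi>] by auto
    have ess: "(\<lambda>z. \<integral>y. \<eta> y \<partial>pow n0 z) \<in> ess_bounded lam"
      if \<eta>: "\<eta> \<in> borel_measurable borel" "\<And>x. \<bar>\<eta> x\<bar> \<le> C" for \<eta>
    proof (rule ess_bounded_of_bounded[OF M])
      show "(\<lambda>z. \<integral>y. \<eta> y \<partial>pow n0 z) \<in> borel_measurable lam"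
        using measurable_integral_kernel[OF pow_measurable \<eta>(1)] borel_measurable_lam by blast
      show "\<bar>\<integral>y. \<eta> y \<partial>pow n0 z\<bar> \<le> C" for z by (rule abs_integral_le[OF pow_in_space \<eta>])
    qed
    obtain r :: "nat \<Rightarrow> nat" and \<psi> where r: "strict_mono r"
      and \<psi>: "\<psi> \<in> borel_measurable borel" "\<And>x. \<bar>\<psi> x\<bar> \<le> C"
      and ul: "uniform_limit UNIV (\<lambda>n. g (r n)) (\<lambda>z. \<integral>y. \<psi> y \<partial>pow n0 z) sequentially"
      using strong_feller_comp_uniform_subsequence[OF comp pow_measurable sf pow_measurable sf, of \<phi> C, OF \<phi>]
      unfolding g_def by metis
    have "limitin L.mtopology (\<lambda>n. Linf_class lam (g (r n))) (Linf_class lam (\<lambda>z. \<integral>y. \<psi> y \<partial>pow n0 z)) sequentially"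
    proof (rule Linf_limit_of_uniform_limit[OF M _ _ ul])
      show "g (r n) \<in> ess_bounded lam" for n unfolding g_def[abs_def] by (rule ess[OF inner])
      show "(\<lambda>z. \<integral>y. \<psi> y \<partial>pow n0 z) \<in> ess_bounded lam" by (rule ess[OF \<psi>])
    qed
    then have "limitin L.mtopology (\<sigma> \<circ> r) (Linf_class lam (\<lambda>z. \<integral>y. \<psi> y \<partial>pow n0 z)) sequentially"
      by (simp add: comp_def \<sigma>g)
    with r show "\<exists>l r. strict_mono r \<and> limitin L.mtopology (\<sigma> \<circ> r) l sequentially" by blast
  qed
qed

end

section \<open>The main theorem\<close>

theorem theorem2:
  fixes m :: "'x::polish_space measure"
    and p :: "'t::polish_space measure"
    and Q :: "'t \<Rightarrow> 't measure"
    and \<P> :: "(nat \<Rightarrow> 't) measure"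
    and f :: "'t \<times> 'x \<Rightarrow> 'x"
    and n0 :: nat
  assumes "compact (UNIV :: 'x set)" and "prob_space m" and "sets m = sets borel"
    and "compact (UNIV :: 't set)" and "prob_space p" and "sets p = sets borel"
    and "Q \<in> borel \<rightarrow>\<^sub>M prob_algebra borel"
    and "stationary Q p" and "\<And>q. stationary Q q \<Longrightarrow> q = p"
    and "markov_measure Q p \<P>"
    and "f \<in> borel \<Otimes>\<^sub>M borel \<rightarrow>\<^sub>M borel"
    and "fibered_nonsingular f p m"
    and "strong_feller (kernel_pow (phat Q f) (borel \<Otimes>\<^sub>M borel) n0) (borel \<Otimes>\<^sub>M borel)"
  shows "FPM \<P> m (skew_product f) \<and>
         Linf_eventually_compact (p \<Otimes>\<^sub>M m) (Linf_lift (p \<Otimes>\<^sub>M m) (kernel_op (phat Q f))) \<and>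
         Linf_compact (p \<Otimes>\<^sub>M m) (Linf_lift (p \<Otimes>\<^sub>M m) (kernel_op (phat Q f)) ^^ (2 * n0))"
proof -
  interpret markov_random_map Q f using assms(7,11) by unfold_locales
  interpret nonsingular_random_map Q f p m
  proof
    show "p \<in> space (prob_algebra borel)" "m \<in> space (prob_algebra borel)"
      using assms(2,3,5,6) by (simp_all add: space_prob_algebra)
    show "p \<bind> Q = p" using assms(8) by (simp add: stationary_def)
    show "fibered_nonsingular f p m" by (rule assms(12))
  qed
  have comp: "compact (UNIV :: ('t \<times> 'x) set)" by (rule compact_state_space[OF assms(4,1)])
  have sf: "strong_feller (pow n0) borel" using assms(13) unfolding borel_prod .
  obtain \<rho> where \<rho>: "\<rho> \<in> space (prob_algebra borel)" "\<rho> \<bind> ph = \<rho>" "absolutely_continuous lam \<rho>"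
    and same: "\<And>C. strictly_invariant C \<Longrightarrow> measure (\<rho> \<bind> K) C = measure (lam \<bind> K) C"
    using stationary_limit[OF comp sf lam phat_null] by blast
  obtain v where v: "0 < v"
    "\<And>C. strictly_invariant C \<Longrightarrow> measure (\<rho> \<bind> K) C = 0 \<or> v \<le> measure (\<rho> \<bind> K) C"
    using invariant_measure_gap[OF comp sf \<rho>(1,2)] by blast
  interpret stationary_random_map Q f p m \<rho>
    by unfold_locales (rule assms(9) \<rho>, assumption?)+
  have "FPM \<P> m F"
  proof (rule finitely_many_physical_measures[OF assms(10) v(1)])
    show "measure \<mu> C = 0 \<or> v \<le> measure \<mu> C" if "strictly_invariant C" for C
      unfolding \<mu>_def by (rule v(2)[OF that])
    show "measure \<mu> C = measure (lam \<bind> K) C" if "strictly_invariant C" for C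
      unfolding \<mu>_def by (rule same[OF that])
  qed
  moreover have "Linf_compact lam (Linf_lift lam (kernel_op ph) ^^ (2 * n0))"
    by (rule Linf_compact_phat_power[OF comp sf])
  moreover have "Linf_eventually_compact lam (Linf_lift lam (kernel_op ph))"
    unfolding Linf_eventually_compact_def using Linf_linear_phat calculation(2) by blast
  ultimately show ?thesis by blast
qed

end
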